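(* Let $\Omega$ be a locally compact Hausdorff space, let $\sigma:U\to V$ be a homeomorphism between two open subsets $U,V$ of $\Omega$, let $\theta:C_0(U)\to C_0(V)$ be the induced $*$-isomorphism, let $C_0(\Omega)\times_\theta\mathbb{Z}$ be Exel's crossed product by the partial automorphism $(\theta,C_0(U),C_0(V))$ of $C_0(\Omega)$, and let $C_0(\Omega)\times_\theta\mathbb{Z}^+$ be the associated tensor algebra. Then every approximately local derivation on $C_0(\Omega)\times_\theta\mathbb{Z}^+$ is a derivation.
   Context: Exel's crossed product $C_0(\Omega)\times_\theta\mathbb{Z}$ is the Cuntz–Pimsner algebra of the graph with vertex space $\mathcal{G}^0=\Omega$, edge space $\mathcal{G}^1=U$, range map $r=\sigma$ and source map $s$ the inclusion $U\hookrightarrow\Omega$. The associated tensor algebra $C_0(\Omega)\times_\theta\mathbb{Z}^+$ is the tensor algebra $\mathcal{T}_X^+$ of the corresponding $C^*$-correspondence $X=C_0(U)$ over $C_0(\Omega)$, with actions $(fFg)(x)=f(\sigma(x))F(x)g(x)$ for $x\in U$, and inner product $\langle F,G\rangle=\overline{F}G\in C_0(U)\subseteq C_0(\Omega)$. Here, a Toeplitz representation of a $C^*$-correspondence $X$ over $A$ is a pair $(\pi,t)$ of a $*$-homomorphism $\pi$ of $A$ and a linear map $t$ of $X$ into a $C^*$-algebra with $\pi(a)t(\xi)=t(a\xi)$ and $t(\xi)^*t(\eta)=\pi(\langle\xi,\eta\rangle)$, and $\mathcal{T}_X^+$ is the norm-closed algebra generated by the images of $A$ and $X$ under the universal Toeplitz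 representation. All linear maps are bounded. A derivation of a Banach algebra $\mathcal{A}$ is a bounded linear map $\delta:\mathcal{A}\to\mathcal{A}$ with $\delta(AB)=\delta(A)B+A\delta(B)$. A bounded linear map $\delta:\mathcal{A}\to\mathcal{A}$ is an approximately local derivation if for every $A\in\mathcal{A}$ there is a sequence of derivations $\delta_{A,k}$ of $\mathcal{A}$ with $\delta(A)=\lim_k\delta_{A,k}(A)$. *)

theory Defs
  imports "HOL-Analysis.Analysis" "HOL-Algebra.Module" "HOL-Algebra.Algebraic_Closure_Type"
begin

section \<open>Banach algebras and C*-algebras on carrier sets\<close>

text \<open>
  Algebras are not assumed unital: the field \<open>one\<close>, inherited from the record \<open>module\<close>,
  is never referred to.
\<close>

record 'a normed_alg = "(complex, 'a) module" +
  nrm :: "'a \<Rightarrow> real"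

record 'a star_alg = "'a normed_alg" +
  adj :: "'a \<Rightarrow> 'a"

abbreviation complex_ring :: "complex ring" where
  "complex_ring \<equiv> ring_of_type_algebra"

locale complex_banach_algebra = Module.module complex_ring B
  for B :: "('a, 'm) normed_alg_scheme" (structure) +
  assumes mult_closed: "\<lbrakk>x \<in> carrier B; y \<in> carrier B\<rbrakk> \<Longrightarrow> x \<otimes> y \<in> carrier B"
    and mult_assoc: "\<lbrakk>x \<in> carrier B; y \<in> carrier B; z \<in> carrier B\<rbrakk>
      \<Longrightarrow> (x \<otimes> y) \<otimes> z = x \<otimes> (y \<otimes> z)"
    and mult_l_distr: "\<lbrakk>x \<in> carrier B; y \<in> carrier B; z \<in> carrier B\<rbrakk>
      \<Longrightarrow> (x \<oplus> y) \<otimes> z = x \<otimes> z \<oplus> y \<otimes> z"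
    and mult_r_distr: "\<lbrakk>x \<in> carrier B; y \<in> carrier B; z \<in> carrier B\<rbrakk>
      \<Longrightarrow> z \<otimes> (x \<oplus> y) = z \<otimes> x \<oplus> z \<otimes> y"
    and smult_mult_left: "\<lbrakk>x \<in> carrier B; y \<in> carrier B\<rbrakk> \<Longrightarrow> (c \<odot> x) \<otimes> y = c \<odot> (x \<otimes> y)"
    and smult_mult_right: "\<lbrakk>x \<in> carrier B; y \<in> carrier B\<rbrakk> \<Longrightarrow> x \<otimes> (c \<odot> y) = c \<odot> (x \<otimes> y)"
    and nrm_nonneg: "x \<in> carrier B \<Longrightarrow> 0 \<le> nrm B x"
    and nrm_eq_0_iff: "x \<in> carrier B \<Longrightarrow> nrm B x = 0 \<longleftrightarrow> x = \<zero>"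
    and nrm_triangle: "\<lbrakk>x \<in> carrier B; y \<in> carrier B\<rbrakk> \<Longrightarrow> nrm B (x \<oplus> y) \<le> nrm B x + nrm B y"
    and nrm_smult: "x \<in> carrier B \<Longrightarrow> nrm B (c \<odot> x) = cmod c * nrm B x"
    and nrm_mult: "\<lbrakk>x \<in> carrier B; y \<in> carrier B\<rbrakk> \<Longrightarrow> nrm B (x \<otimes> y) \<le> nrm B x * nrm B y"
    and complete: "\<lbrakk>\<And>n::nat. f n \<in> carrier B;
        \<And>e. e > 0 \<Longrightarrow> \<exists>N. \<forall>m\<ge>N. \<forall>n\<ge>N. nrm B (f m \<ominus> f n) < e\<rbrakk>
      \<Longrightarrow> \<exists>l\<in>carrier B. (\<lambda>n. nrm B (f n \<ominus> l)) \<longlonglongrightarrow> 0"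

locale cstar_algebra = complex_banach_algebra B
  for B :: "('a, 'm) star_alg_scheme" (structure) +
  assumes adj_closed: "x \<in> carrier B \<Longrightarrow> adj B x \<in> carrier B"
    and adj_adj: "x \<in> carrier B \<Longrightarrow> adj B (adj B x) = x"
    and adj_add: "\<lbrakk>x \<in> carrier B; y \<in> carrier B\<rbrakk> \<Longrightarrow> adj B (x \<oplus> y) = adj B x \<oplus> adj B y"
    and adj_smult: "x \<in> carrier B \<Longrightarrow> adj B (c \<odot> x) = cnj c \<odot> adj B x"
    and adj_mult: "\<lbrakk>x \<in> carrier B; y \<in> carrier B\<rbrakk> \<Longrightarrow> adj B (x \<otimes> y) = adj B y \<otimes> adj B x"
    and cstar_identity: "x \<in> carrier B \<Longrightarrow> nrm B (adj B x \<otimes> x) = (nrm B x)\<^sup>2"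

definition closed_subalgebra :: "('a, 'm) normed_alg_scheme \<Rightarrow> 'a set \<Rightarrow> bool" where
  "closed_subalgebra B S \<longleftrightarrow>
     S \<subseteq> carrier B \<and> \<zero>\<^bsub>B\<^esub> \<in> S \<and>
     (\<forall>x\<in>S. \<forall>y\<in>S. x \<oplus>\<^bsub>B\<^esub> y \<in> S \<and> x \<otimes>\<^bsub>B\<^esub> y \<in> S) \<and>
     (\<forall>c. \<forall>x\<in>S. c \<odot>\<^bsub>B\<^esub> x \<in> S) \<and>
     (\<forall>f. \<forall>l\<in>carrier B. (\<forall>n::nat. f n \<in> S) \<and> (\<lambda>n. nrm B (f n \<ominus>\<^bsub>B\<^esub> l)) \<longlonglongrightarrow> 0 \<longrightarrow> l \<in> S)"

definition cstar_subalgebra :: "('a, 'm) star_alg_scheme \<Rightarrow> 'a set \<Rightarrow> bool" where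
  "cstar_subalgebra B S \<longleftrightarrow> closed_subalgebra B S \<and> (\<forall>x\<in>S. adj B x \<in> S)"

definition linear_map ::
    "(complex, 'a, 'm) module_scheme \<Rightarrow> (complex, 'b, 'n) module_scheme \<Rightarrow> ('a \<Rightarrow> 'b) \<Rightarrow> bool" where
  "linear_map M N h \<longleftrightarrow>
     (\<forall>x\<in>carrier M. h x \<in> carrier N) \<and>
     (\<forall>x\<in>carrier M. \<forall>y\<in>carrier M. h (x \<oplus>\<^bsub>M\<^esub> y) = h x \<oplus>\<^bsub>N\<^esub> h y) \<and>
     (\<forall>c. \<forall>x\<in>carrier M. h (c \<odot>\<^bsub>M\<^esub> x) = c \<odot>\<^bsub>N\<^esub> h x)"

definition star_hom ::
    "('a, 'm) star_alg_scheme \<Rightarrow> ('b, 'n) star_alg_scheme \<Rightarrow> ('a \<Rightarrow> 'b) \<Rightarrow> bool" where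
  "star_hom A B h \<longleftrightarrow>
     linear_map A B h \<and>
     (\<forall>x\<in>carrier A. \<forall>y\<in>carrier A. h (x \<otimes>\<^bsub>A\<^esub> y) = h x \<otimes>\<^bsub>B\<^esub> h y) \<and>
     (\<forall>x\<in>carrier A. h (adj A x) = adj B (h x))"

section \<open>Derivations\<close>

definition bounded_linear_map ::
    "('a, 'm) normed_alg_scheme \<Rightarrow> ('b, 'n) normed_alg_scheme \<Rightarrow> ('a \<Rightarrow> 'b) \<Rightarrow> bool" where
  "bounded_linear_map A B h \<longleftrightarrow>
     linear_map A B h \<and> (\<exists>K. \<forall>x\<in>carrier A. nrm B (h x) \<le> K * nrm A x)"

definition derivation :: "('a, 'm) normed_alg_scheme \<Rightarrow> ('a \<Rightarrow> 'a) \<Rightarrow> bool" where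
  "derivation A \<delta> \<longleftrightarrow>
     bounded_linear_map A A \<delta> \<and>
     (\<forall>x\<in>carrier A. \<forall>y\<in>carrier A. \<delta> (x \<otimes>\<^bsub>A\<^esub> y) = \<delta> x \<otimes>\<^bsub>A\<^esub> y \<oplus>\<^bsub>A\<^esub> x \<otimes>\<^bsub>A\<^esub> \<delta> y)"

definition approximately_local_derivation ::
    "('a, 'm) normed_alg_scheme \<Rightarrow> ('a \<Rightarrow> 'a) \<Rightarrow> bool" where
  "approximately_local_derivation A \<delta> \<longleftrightarrow>
     bounded_linear_map A A \<delta> \<and>
     (\<forall>x\<in>carrier A. \<exists>D :: nat \<Rightarrow> 'a \<Rightarrow> 'a.
        (\<forall>k. derivation A (D k)) \<and> (\<lambda>k. nrm A (D k x \<ominus>\<^bsub>A\<^esub> \<delta> x)) \<longlonglongrightarrow> 0)"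

section \<open>Toeplitz representations and tensor algebras of C*-correspondences\<close>

text \<open>
  The data of a C*-correspondence over a C*-algebra with elements in \<open>'a\<close>. As usual for
  \<open>module\<close> records, the inherited fields \<open>mult\<close> and \<open>one\<close> are not used.
\<close>

record ('a, 'x) correspondence = "(complex, 'x) module" +
  lact :: "'a \<Rightarrow> 'x \<Rightarrow> 'x"
  ract :: "'x \<Rightarrow> 'a \<Rightarrow> 'x"
  ip :: "'x \<Rightarrow> 'x \<Rightarrow> 'a"

definition toeplitz_representation ::
    "'a star_alg \<Rightarrow> ('a, 'x) correspondence \<Rightarrow> 'b star_alg \<Rightarrow> ('a \<Rightarrow> 'b) \<Rightarrow> ('x \<Rightarrow> 'b) \<Rightarrow> bool" where
  "toeplitz_representation A E B \<pi> t \<longleftrightarrow>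
     star_hom A B \<pi> \<and> linear_map E B t \<and>
     (\<forall>a\<in>carrier A. \<forall>\<xi>\<in>carrier E. \<pi> a \<otimes>\<^bsub>B\<^esub> t \<xi> = t (lact E a \<xi>)) \<and>
     (\<forall>\<xi>\<in>carrier E. \<forall>\<eta>\<in>carrier E. adj B (t \<xi>) \<otimes>\<^bsub>B\<^esub> t \<eta> = \<pi> (ip E \<xi> \<eta>))"

text \<open>
  A formula cannot quantify over types, so the universal property is tested on the C*-algebras
  carried by one sufficiently large type. Each element of a C*-algebra generated by a Toeplitz
  representation is the limit of a sequence of *-polynomial expressions in the generators; mapping
  the element to such a sequence of formal expressions is injective. Hence
  every such C*-algebra has an isomorphic copy carried by the type \<open>('a, 'x) test_type\<close>. The
  theorem \<open>universal_property\<close> below recovers the universal property for C*-algebras carried by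
  arbitrary types.
\<close>

datatype ('a, 'x) toeplitz_term =
    Coeff 'a
  | Vec 'x
  | Plus "('a, 'x) toeplitz_term" "('a, 'x) toeplitz_term"
  | Times "('a, 'x) toeplitz_term" "('a, 'x) toeplitz_term"
  | Scale complex "('a, 'x) toeplitz_term"
  | Adj "('a, 'x) toeplitz_term"

type_synonym ('a, 'x) test_type = "nat \<Rightarrow> ('a, 'x) toeplitz_term"

definition universal_toeplitz_representation ::
    "'a star_alg \<Rightarrow> ('a, 'x) correspondence \<Rightarrow> 'b star_alg \<Rightarrow> ('a \<Rightarrow> 'b) \<Rightarrow> ('x \<Rightarrow> 'b) \<Rightarrow> bool" where
  "universal_toeplitz_representation A E B \<pi> t \<longleftrightarrow>
     cstar_algebra B \<and> toeplitz_representation A E B \<pi> t \<and>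
     cstar_subalgebra B hull (\<pi> ` carrier A \<union> t ` carrier E) = carrier B \<and>
     (\<forall>(D :: ('a, 'x) test_type star_alg) \<rho> \<tau>.
        cstar_algebra D \<and> toeplitz_representation A E D \<rho> \<tau> \<longrightarrow>
        (\<exists>\<Phi>. star_hom B D \<Phi> \<and>
             (\<forall>a\<in>carrier A. \<Phi> (\<pi> a) = \<rho> a) \<and> (\<forall>\<xi>\<in>carrier E. \<Phi> (t \<xi>) = \<tau> \<xi>)))"

text \<open>
  The closed, not necessarily self-adjoint, subalgebra generated by the representation, with the
  operations and the norm of the ambient C*-algebra.
\<close>

definition tensor_algebra ::
    "'a star_alg \<Rightarrow> ('a, 'x) correspondence \<Rightarrow> 'b star_alg \<Rightarrow> ('a \<Rightarrow> 'b) \<Rightarrow> ('x \<Rightarrow> 'b)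
      \<Rightarrow> 'b normed_alg" where
  "tensor_algebra A E B \<pi> t =
     normed_alg.truncate
       (B\<lparr>carrier := closed_subalgebra B hull (\<pi> ` carrier A \<union> t ` carrier E)\<rparr>)"

section \<open>The correspondence of a partial homeomorphism\<close>

text \<open>
  Functions in \<open>C0 \<Omega>\<close> are extended by \<open>0\<close> outside the space. For an open subset \<open>U\<close> this makes
  \<open>C0 (subtopology \<Omega> U)\<close> literally a subset of \<open>C0 \<Omega>\<close>, namely the ideal usually denoted
  $C_0(U)$.
\<close>

definition C0 :: "'o topology \<Rightarrow> ('o \<Rightarrow> complex) set" where
  "C0 \<Omega> = {f. continuous_map \<Omega> euclidean f \<and>
     (\<forall>e>0. compactin \<Omega> {x \<in> topspace \<Omega>. e \<le> cmod (f x)}) \<and>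
     (\<forall>x. x \<notin> topspace \<Omega> \<longrightarrow> f x = 0)}"

definition C0_alg :: "'o topology \<Rightarrow> ('o \<Rightarrow> complex) star_alg" where
  "C0_alg \<Omega> = \<lparr>carrier = C0 \<Omega>,
     mult = (\<lambda>f g x. f x * g x), one = undefined,
     zero = (\<lambda>x. 0), add = (\<lambda>f g x. f x + g x),
     smult = (\<lambda>c f x. c * f x),
     nrm = (\<lambda>f. SUP x. cmod (f x)),
     adj = (\<lambda>f x. cnj (f x))\<rparr>"

text \<open>
  For \<open>F \<in> C0 (subtopology \<Omega> U)\<close> the products below vanish outside \<open>U\<close> because \<open>F\<close> does, so the
  values of \<open>\<sigma>\<close> outside \<open>U\<close> are irrelevant.
\<close>

definition partial_homeo_corr ::
    "'o topology \<Rightarrow> 'o set \<Rightarrow> ('o \<Rightarrow> 'o) \<Rightarrow> ('o \<Rightarrow> complex, 'o \<Rightarrow> complex) correspondence" where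
  "partial_homeo_corr \<Omega> U \<sigma> = \<lparr>carrier = C0 (subtopology \<Omega> U),
     mult = undefined, one = undefined,
     zero = (\<lambda>x. 0), add = (\<lambda>F G x. F x + G x),
     smult = (\<lambda>c F x. c * F x),
     lact = (\<lambda>f F x. f (\<sigma> x) * F x),
     ract = (\<lambda>F g x. F x * g x),
     ip = (\<lambda>F G x. cnj (F x) * G x)\<rparr>"

section \<open>The universal property for C*-algebras on arbitrary types\<close>

lemma complex_ring_simps [simp]:
  "carrier complex_ring = UNIV" "x \<oplus>\<^bsub>complex_ring\<^esub> y = x + y" "x \<otimes>\<^bsub>complex_ring\<^esub> y = x * y"
  "\<one>\<^bsub>complex_ring\<^esub> = 1" "\<zero>\<^bsub>complex_ring\<^esub> = 0"
  by (simp_all add: ring_of_type_algebra_def)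

lemma smult_minus_one:
  assumes "Module.module complex_ring M" "x \<in> carrier M"
  shows "(-1) \<odot>\<^bsub>M\<^esub> x = \<ominus>\<^bsub>M\<^esub> x"
proof -
  interpret Module.module complex_ring M by fact
  have "(-1) \<odot>\<^bsub>M\<^esub> x \<oplus>\<^bsub>M\<^esub> 1 \<odot>\<^bsub>M\<^esub> x = \<zero>\<^bsub>M\<^esub>"
    using smult_l_distr[of "-1" 1 x] smult_l_null[of x] assms(2) by simp
  then show ?thesis
    using assms(2) smult_one[of x] smult_closed[of "-1" x] by (simp add: M.minus_equality)
qed

lemma cstar_algebra_embedding:
  fixes D :: "('a, 'm) star_alg_scheme" and S :: "('b, 'n) star_alg_scheme"
  assumes D: "cstar_algebra D"
    and sub: "cstar_subalgebra D (h ` carrier S)"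
    and inj: "inj_on h (carrier S)"
    and z: "\<zero>\<^bsub>S\<^esub> \<in> carrier S" "h \<zero>\<^bsub>S\<^esub> = \<zero>\<^bsub>D\<^esub>"
    and p: "\<And>x y. x \<in> carrier S \<Longrightarrow> y \<in> carrier S \<Longrightarrow> x \<oplus>\<^bsub>S\<^esub> y \<in> carrier S \<and> h (x \<oplus>\<^bsub>S\<^esub> y) = h x \<oplus>\<^bsub>D\<^esub> h y"
    and m: "\<And>x y. x \<in> carrier S \<Longrightarrow> y \<in> carrier S \<Longrightarrow> x \<otimes>\<^bsub>S\<^esub> y \<in> carrier S \<and> h (x \<otimes>\<^bsub>S\<^esub> y) = h x \<otimes>\<^bsub>D\<^esub> h y"
    and s: "\<And>c x. x \<in> carrier S \<Longrightarrow> c \<odot>\<^bsub>S\<^esub> x \<in> carrier S \<and> h (c \<odot>\<^bsub>S\<^esub> x) = c \<odot>\<^bsub>D\<^esub> h x"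
    and a: "\<And>x. x \<in> carrier S \<Longrightarrow> adj S x \<in> carrier S \<and> h (adj S x) = adj D (h x)"
    and n: "\<And>x. x \<in> carrier S \<Longrightarrow> nrm S x = nrm D (h x)"
  shows "cstar_algebra S"
proof -
  interpret D: cstar_algebra D by fact
  have hD [simp]: "h x \<in> carrier D" if "x \<in> carrier S" for x
    using sub that by (auto simp: cstar_subalgebra_def closed_subalgebra_def)
  note [simp] = z p m s a n
  have eq: "x = y" if "h x = h y" "x \<in> carrier S" "y \<in> carrier S" for x y
    using inj that by (auto dest: inj_onD)
  have minus1: "(-1) \<odot>\<^bsub>D\<^esub> x = \<ominus>\<^bsub>D\<^esub> x" if "x \<in> carrier D" for x
    using smult_minus_one[OF D.module_axioms that] .
  have "abelian_group S"
  proof (rule abelian_groupI)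
    fix x assume x: "x \<in> carrier S"
    show "\<exists>y\<in>carrier S. y \<oplus>\<^bsub>S\<^esub> x = \<zero>\<^bsub>S\<^esub>"
      by (rule bexI[of _ "(-1) \<odot>\<^bsub>S\<^esub> x"], rule eq) (auto simp: x minus1 D.l_neg)
  qed (auto intro!: eq simp: D.a_ac)
  then have mod: "Module.module complex_ring S"
    using D.smult_l_distr D.smult_assoc1 D.smult_one
    by (intro moduleI) (auto intro!: eq simp: D.smult_r_distr D.R.cring_axioms)
  then interpret S: Module.module complex_ring S .
  have hm: "h (x \<ominus>\<^bsub>S\<^esub> y) = h x \<ominus>\<^bsub>D\<^esub> h y" if "x \<in> carrier S" "y \<in> carrier S" for x y
    using that by (simp add: a_minus_def smult_minus_one[OF mod, symmetric] minus1[symmetric])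
  have hmc: "x \<ominus>\<^bsub>S\<^esub> y \<in> carrier S" if "x \<in> carrier S" "y \<in> carrier S" for x y
    using that by simp
  show ?thesis
  proof
    fix f :: "nat \<Rightarrow> 'b"
    assume f: "\<And>n. f n \<in> carrier S" and C: "\<And>e. 0 < e \<Longrightarrow> \<exists>N. \<forall>m\<ge>N. \<forall>n\<ge>N. nrm S (f m \<ominus>\<^bsub>S\<^esub> f n) < e"
    have "\<exists>l\<in>carrier D. (\<lambda>n. nrm D (h (f n) \<ominus>\<^bsub>D\<^esub> l)) \<longlonglongrightarrow> 0"
      using D.complete[of "\<lambda>n. h (f n)"] f C hmc by (simp add: hm)
    then obtain l where l: "l \<in> carrier D" "(\<lambda>n. nrm D (h (f n) \<ominus>\<^bsub>D\<^esub> l)) \<longlonglongrightarrow> 0" by blast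
    moreover have "l \<in> h ` carrier S"
    proof -
      have "\<forall>n. h (f n) \<in> h ` carrier S" using f by blast
      with sub l show ?thesis unfolding cstar_subalgebra_def closed_subalgebra_def
        by (elim conjE allE[of _ "\<lambda>n. h (f n)"]) blast
    qed
    ultimately show "\<exists>l\<in>carrier S. (\<lambda>n. nrm S (f n \<ominus>\<^bsub>S\<^esub> l)) \<longlonglongrightarrow> 0"
      using f hmc by (auto simp: hm)
  next
    fix x assume "x \<in> carrier S"
    then show "(nrm S x = 0) = (x = \<zero>\<^bsub>S\<^esub>)"
      using D.nrm_eq_0_iff[of "h x"] eq[of x "\<zero>\<^bsub>S\<^esub>"] by auto
  qed (auto intro!: eq simp: D.mult_assoc D.mult_l_distr D.mult_r_distr D.smult_mult_left
      D.smult_mult_right D.nrm_nonneg D.nrm_triangle D.nrm_smult D.nrm_mult D.mult_closed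
      D.adj_adj D.adj_add D.adj_smult D.adj_mult D.cstar_identity)
qed

lemma closed_subalgebra_Inter:
  assumes "\<And>S. S \<in> \<S> \<Longrightarrow> closed_subalgebra B S" "\<S> \<noteq> {}"
  shows "closed_subalgebra B (\<Inter>\<S>)"
proof -
  have 1: "l \<in> \<Inter>\<S>" if "l \<in> carrier B" "\<forall>n. f n \<in> \<Inter>\<S>" "(\<lambda>n::nat. nrm B (f n \<ominus>\<^bsub>B\<^esub> l)) \<longlonglongrightarrow> 0" for f l
  proof
    fix S assume S: "S \<in> \<S>"
    then have "\<forall>n. f n \<in> S" using that(2) by blast
    then show "l \<in> S" using assms(1)[OF S] that unfolding closed_subalgebra_def by blast
  qed
  have 2: "\<Inter>\<S> \<subseteq> carrier B"
    using assms unfolding closed_subalgebra_def by blast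
  show ?thesis
    unfolding closed_subalgebra_def
  proof (intro conjI allI ballI impI 2)
    show "\<zero>\<^bsub>B\<^esub> \<in> \<Inter>\<S>" using assms(1) by (auto simp: closed_subalgebra_def)
  next
    fix x y assume "x \<in> \<Inter>\<S>" "y \<in> \<Inter>\<S>"
    then show "x \<oplus>\<^bsub>B\<^esub> y \<in> \<Inter>\<S>" "x \<otimes>\<^bsub>B\<^esub> y \<in> \<Inter>\<S>"
      using assms(1) by (auto simp: closed_subalgebra_def)
  next
    fix c x assume "x \<in> \<Inter>\<S>"
    then show "c \<odot>\<^bsub>B\<^esub> x \<in> \<Inter>\<S>"
      using assms(1) by (auto simp: closed_subalgebra_def)
  next
    fix f l assume "l \<in> carrier B" "(\<forall>n. f n \<in> \<Inter>\<S>) \<and> (\<lambda>n::nat. nrm B (f n \<ominus>\<^bsub>B\<^esub> l)) \<longlonglongrightarrow> 0"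
    then show "l \<in> \<Inter>\<S>" using 1 by blast
  qed
qed

lemma (in complex_banach_algebra) closed_subalgebra_carrier: "closed_subalgebra B (carrier B)"
  unfolding closed_subalgebra_def using mult_closed smult_closed by auto

lemma (in complex_banach_algebra) closed_subalgebra_hull:
  assumes "G \<subseteq> carrier B"
  shows "closed_subalgebra B (closed_subalgebra B hull G)"
  unfolding hull_def using closed_subalgebra_carrier assms
  by (intro closed_subalgebra_Inter) auto

lemma (in cstar_algebra) cstar_subalgebra_hull:
  assumes "G \<subseteq> carrier B"
  shows "cstar_subalgebra B (cstar_subalgebra B hull G)"
proof -
  have "cstar_subalgebra B (carrier B)"
    using closed_subalgebra_carrier adj_closed by (auto simp: cstar_subalgebra_def)
  then have "closed_subalgebra B (cstar_subalgebra B hull G)"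
    unfolding hull_def using assms
    by (intro closed_subalgebra_Inter) (auto simp: cstar_subalgebra_def)
  then show ?thesis unfolding cstar_subalgebra_def hull_def by auto
qed

context complex_banach_algebra
begin

lemma minus_conv: "x \<in> carrier B \<Longrightarrow> \<ominus> x = (-1) \<odot> x"
  using smult_minus_one[OF module_axioms] by simp

lemma smult_in [simp, intro]: "x \<in> carrier B \<Longrightarrow> c \<odot> x \<in> carrier B"
  using smult_closed by simp

lemma nrm_a_inv: "x \<in> carrier B \<Longrightarrow> nrm B (\<ominus> x) = nrm B x"
  by (simp add: minus_conv nrm_smult)

lemma add_minus_add:
  assumes "a \<in> carrier B" "b \<in> carrier B" "x \<in> carrier B" "y \<in> carrier B"
  shows "(a \<oplus> b) \<ominus> (x \<oplus> y) = (a \<ominus> x) \<oplus> (b \<ominus> y)"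
  using assms by (simp add: a_minus_def M.minus_add M.a_ac)

lemma minus_minus_add:
  assumes "a \<in> carrier B" "x \<in> carrier B" "y \<in> carrier B"
  shows "(a \<ominus> x) \<oplus> (x \<ominus> y) = a \<ominus> y"
proof -
  have "(a \<ominus> x) \<oplus> (x \<ominus> y) = a \<oplus> ((\<ominus> x \<oplus> x) \<oplus> \<ominus> y)"
    unfolding a_minus_def using assms by (metis M.a_assoc M.a_inv_closed M.add.m_closed)
  then show ?thesis using assms by (simp add: M.l_neg a_minus_def)
qed

lemma smult_minus_smult:
  assumes "a \<in> carrier B" "x \<in> carrier B"
  shows "c \<odot> a \<ominus> c \<odot> x = c \<odot> (a \<ominus> x)"
  using assms smult_assoc1[of "-1" c x] smult_assoc1[of c "-1" x]
  by (simp add: a_minus_def minus_conv smult_r_distr)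

lemma mult_minus_mult:
  assumes "a \<in> carrier B" "b \<in> carrier B" "x \<in> carrier B" "y \<in> carrier B"
  shows "a \<otimes> b \<ominus> x \<otimes> y = (a \<ominus> x) \<otimes> b \<oplus> x \<otimes> (b \<ominus> y)"
proof -
  have "(a \<ominus> x) \<otimes> b = a \<otimes> b \<ominus> x \<otimes> b" "x \<otimes> (b \<ominus> y) = x \<otimes> b \<ominus> x \<otimes> y"
    using assms by (simp_all add: a_minus_def minus_conv mult_l_distr mult_r_distr
        smult_mult_left smult_mult_right mult_closed)
  then show ?thesis using assms by (simp add: minus_minus_add mult_closed)
qed

lemma nrm_dist_triangle:
  assumes "a \<in> carrier B" "x \<in> carrier B" "y \<in> carrier B"
  shows "nrm B (a \<ominus> y) \<le> nrm B (a \<ominus> x) + nrm B (x \<ominus> y)"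
  using nrm_triangle[of "a \<ominus> x" "x \<ominus> y"] assms by (simp add: minus_minus_add)

lemma nrm_le_dist:
  assumes "a \<in> carrier B" "x \<in> carrier B"
  shows "nrm B a \<le> nrm B (a \<ominus> x) + nrm B x"
  using nrm_dist_triangle[of a x \<zero>] assms M.minus_equality[of \<zero> \<zero>] by (simp add: a_minus_def)

lemma dist_self: "x \<in> carrier B \<Longrightarrow> nrm B (x \<ominus> x) = 0"
  by (simp add: nrm_eq_0_iff a_minus_def M.r_neg)

lemma limit_unique:
  assumes "\<And>n::nat. f n \<in> carrier B" "x \<in> carrier B" "y \<in> carrier B"
    "(\<lambda>n. nrm B (f n \<ominus> x)) \<longlonglongrightarrow> 0" "(\<lambda>n. nrm B (f n \<ominus> y)) \<longlonglongrightarrow> 0"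
  shows "x = y"
proof -
  have sym: "nrm B (x \<ominus> f n) = nrm B (f n \<ominus> x)" for n
    using assms(1)[of n] assms(2) nrm_a_inv[of "f n \<ominus> x"]
    by (simp add: a_minus_def M.minus_add M.a_comm)
  have "(\<lambda>n. nrm B (f n \<ominus> x) + nrm B (f n \<ominus> y)) \<longlonglongrightarrow> 0"
    using tendsto_add[OF assms(4,5)] by simp
  moreover have "nrm B (x \<ominus> y) \<le> nrm B (f n \<ominus> x) + nrm B (f n \<ominus> y)" for n
    using nrm_dist_triangle[of x "f n" y] assms by (simp add: sym)
  ultimately have "nrm B (x \<ominus> y) \<le> 0"
    by (intro LIMSEQ_le_const) auto
  then have "x \<ominus> y = \<zero>"
    using nrm_nonneg[of "x \<ominus> y"] nrm_eq_0_iff[of "x \<ominus> y"] assms by auto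
  then show ?thesis using assms by (metis M.minus_equality M.minus_minus M.a_inv_closed a_minus_def)
qed

end

context cstar_algebra
begin

lemma nrm_adj: 
  assumes "x \<in> carrier B"
  shows "nrm B (adj B x) = nrm B x"
proof -
  have *: "nrm B x \<le> nrm B (adj B x)" if "x \<in> carrier B" for x
  proof (cases "nrm B x = 0")
    case True
    then show ?thesis using that nrm_nonneg adj_closed by simp
  next
    case False
    then have "nrm B x > 0" using nrm_nonneg[OF that] by simp
    moreover have "nrm B x * nrm B x \<le> nrm B (adj B x) * nrm B x"
      using cstar_identity[OF that] nrm_mult[of "adj B x" x] that adj_closed
      by (simp add: power2_eq_square)
    ultimately show ?thesis by simp
  qed
  from *[OF assms] *[of "adj B x"] assms show ?thesis by (simp add: adj_closed adj_adj)
qed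

lemma adj_minus_adj:
  assumes "a \<in> carrier B" "x \<in> carrier B"
  shows "adj B a \<ominus> adj B x = adj B (a \<ominus> x)"
  using assms by (simp add: a_minus_def minus_conv adj_add adj_smult adj_closed)

end

primrec term_eval ::
    "'a star_alg \<Rightarrow> ('a, 'x) correspondence \<Rightarrow> 'b star_alg \<Rightarrow> ('a \<Rightarrow> 'b) \<Rightarrow> ('x \<Rightarrow> 'b)
      \<Rightarrow> ('a, 'x) toeplitz_term \<Rightarrow> 'b" where
  "term_eval A E B \<pi> t (Coeff a) = (if a \<in> carrier A then \<pi> a else \<zero>\<^bsub>B\<^esub>)"
| "term_eval A E B \<pi> t (Vec \<xi>) = (if \<xi> \<in> carrier E then t \<xi> else \<zero>\<^bsub>B\<^esub>)"
| "term_eval A E B \<pi> t (Plus p q) = term_eval A E B \<pi> t p \<oplus>\<^bsub>B\<^esub> term_eval A E B \<pi> t q"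
| "term_eval A E B \<pi> t (Times p q) = term_eval A E B \<pi> t p \<otimes>\<^bsub>B\<^esub> term_eval A E B \<pi> t q"
| "term_eval A E B \<pi> t (Scale c p) = c \<odot>\<^bsub>B\<^esub> term_eval A E B \<pi> t p"
| "term_eval A E B \<pi> t (Adj p) = adj B (term_eval A E B \<pi> t p)"

lemma generated_element_is_limit_of_terms:
  fixes B :: "'b star_alg" and E :: "('a, 'x) correspondence"
  assumes B: "cstar_algebra B" and rep: "toeplitz_representation A E B \<pi> t"
    and y: "y \<in> cstar_subalgebra B hull (\<pi> ` carrier A \<union> t ` carrier E)"
  shows "\<exists>f::nat \<Rightarrow> _. (\<lambda>n. nrm B (term_eval A E B \<pi> t (f n) \<ominus>\<^bsub>B\<^esub> y)) \<longlonglongrightarrow> 0"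
    and "term_eval A E B \<pi> t p \<in> carrier B"
proof -
  interpret cstar_algebra B by fact
  let ?ev = "term_eval A E B \<pi> t"
  have \<pi>: "\<pi> a \<in> carrier B" if "a \<in> carrier A" for a
    using rep that by (auto simp: toeplitz_representation_def star_hom_def linear_map_def)
  have t: "t \<xi> \<in> carrier B" if "\<xi> \<in> carrier E" for \<xi>
    using rep that by (auto simp: toeplitz_representation_def linear_map_def)
  have ev [simp]: "?ev p \<in> carrier B" for p
    by (induction p) (auto simp: \<pi> t mult_closed adj_closed)
  show "?ev p \<in> carrier B" by simp
  define L where "L = {y \<in> carrier B. \<exists>f::nat \<Rightarrow> _. (\<lambda>n. nrm B (?ev (f n) \<ominus>\<^bsub>B\<^esub> y)) \<longlonglongrightarrow> 0}"
  have LI: "z \<in> L" if "(\<lambda>n. nrm B (?ev (F n) \<ominus>\<^bsub>B\<^esub> z)) \<longlonglongrightarrow> 0" "z \<in> carrier B"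
    for z and F :: "nat \<Rightarrow> ('a, 'x) toeplitz_term"
    using that unfolding L_def by blast
  have ev_L: "?ev p \<in> L" for p
    unfolding L_def by (auto intro!: exI[of _ "\<lambda>_. p"] simp: dist_self)
  have gen: "\<pi> ` carrier A \<union> t ` carrier E \<subseteq> L"
  proof (clarsimp, intro conjI image_subsetI)
    show "\<pi> a \<in> L" if "a \<in> carrier A" for a using ev_L[of "Coeff a"] that by simp
    show "t a \<in> L" if "a \<in> carrier E" for a using ev_L[of "Vec a"] that by simp
  qed
  have squeeze: "(\<lambda>n. nrm B (g n)) \<longlonglongrightarrow> 0"
    if "\<And>n. g n \<in> carrier B" "\<And>n. nrm B (g n) \<le> h n" "h \<longlonglongrightarrow> 0" for g :: "nat \<Rightarrow> _" and h
    by (rule tendsto_sandwich[OF _ _ tendsto_const that(3)]) (use that nrm_nonneg in auto)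
  have "cstar_subalgebra B L"
    unfolding cstar_subalgebra_def closed_subalgebra_def
  proof (intro conjI ballI allI impI)
    show "L \<subseteq> carrier B" by (auto simp: L_def)
    show "\<zero>\<^bsub>B\<^esub> \<in> L"
      using ev_L[of "Scale 0 undefined"] smult_l_null[OF ev] by simp
  next
    fix x y assume "x \<in> L" "y \<in> L"
    then obtain f g :: "nat \<Rightarrow> ('a, 'x) toeplitz_term" where x: "x \<in> carrier B" "(\<lambda>n. nrm B (?ev (f n) \<ominus>\<^bsub>B\<^esub> x)) \<longlonglongrightarrow> 0"
      and y: "y \<in> carrier B" "(\<lambda>n. nrm B (?ev (g n) \<ominus>\<^bsub>B\<^esub> y)) \<longlonglongrightarrow> 0"
      unfolding L_def by blast
    have "(\<lambda>n. nrm B (?ev (Plus (f n) (g n)) \<ominus>\<^bsub>B\<^esub> (x \<oplus>\<^bsub>B\<^esub> y))) \<longlonglongrightarrow> 0"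
    proof (rule squeeze)
      show "(\<lambda>n. nrm B (?ev (f n) \<ominus>\<^bsub>B\<^esub> x) + nrm B (?ev (g n) \<ominus>\<^bsub>B\<^esub> y)) \<longlonglongrightarrow> 0"
        using tendsto_add[OF x(2) y(2)] by simp
    qed (use x y in \<open>auto simp: add_minus_add intro!: nrm_triangle\<close>)
    then show "x \<oplus>\<^bsub>B\<^esub> y \<in> L" by (rule LI) (use x y in auto)
    have "(\<lambda>n. nrm B (?ev (Times (f n) (g n)) \<ominus>\<^bsub>B\<^esub> (x \<otimes>\<^bsub>B\<^esub> y))) \<longlonglongrightarrow> 0"
    proof (rule squeeze)
      fix n
      let ?a = "?ev (f n)" and ?b = "?ev (g n)"
      have "nrm B (?a \<otimes>\<^bsub>B\<^esub> ?b \<ominus>\<^bsub>B\<^esub> x \<otimes>\<^bsub>B\<^esub> y) \<le> nrm B ((?a \<ominus>\<^bsub>B\<^esub> x) \<otimes>\<^bsub>B\<^esub> ?b) + nrm B (x \<otimes>\<^bsub>B\<^esub> (?b \<ominus>\<^bsub>B\<^esub> y))"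
        using x y by (auto simp: mult_minus_mult mult_closed intro!: nrm_triangle)
      also have "nrm B ((?a \<ominus>\<^bsub>B\<^esub> x) \<otimes>\<^bsub>B\<^esub> ?b) \<le> nrm B (?a \<ominus>\<^bsub>B\<^esub> x) * nrm B ?b"
        using x by (intro nrm_mult) auto
      also have "\<dots> \<le> nrm B (?a \<ominus>\<^bsub>B\<^esub> x) * (nrm B (?b \<ominus>\<^bsub>B\<^esub> y) + nrm B y)"
        using x y by (intro mult_left_mono nrm_le_dist nrm_nonneg) auto
      also have "nrm B (x \<otimes>\<^bsub>B\<^esub> (?b \<ominus>\<^bsub>B\<^esub> y)) \<le> nrm B x * nrm B (?b \<ominus>\<^bsub>B\<^esub> y)"
        using x y by (intro nrm_mult) auto
      finally show "nrm B (?ev (Times (f n) (g n)) \<ominus>\<^bsub>B\<^esub> x \<otimes>\<^bsub>B\<^esub> y)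
         \<le> nrm B (?a \<ominus>\<^bsub>B\<^esub> x) * (nrm B (?b \<ominus>\<^bsub>B\<^esub> y) + nrm B y) + nrm B x * nrm B (?b \<ominus>\<^bsub>B\<^esub> y)"
        by simp
    next
      show "(\<lambda>n. nrm B (?ev (f n) \<ominus>\<^bsub>B\<^esub> x) * (nrm B (?ev (g n) \<ominus>\<^bsub>B\<^esub> y) + nrm B y)
          + nrm B x * nrm B (?ev (g n) \<ominus>\<^bsub>B\<^esub> y)) \<longlonglongrightarrow> 0"
        by (rule tendsto_eq_intros x(2) y(2) refl | simp)+
    qed (use x y in \<open>auto simp: mult_closed\<close>)
    then show "x \<otimes>\<^bsub>B\<^esub> y \<in> L" by (rule LI) (use x y mult_closed in auto)
  next
    fix c x assume "x \<in> L"
    then obtain f :: "nat \<Rightarrow> ('a, 'x) toeplitz_term" where x: "x \<in> carrier B" "(\<lambda>n. nrm B (?ev (f n) \<ominus>\<^bsub>B\<^esub> x)) \<longlonglongrightarrow> 0"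
      unfolding L_def by blast
    have "(\<lambda>n. nrm B (?ev (Scale c (f n)) \<ominus>\<^bsub>B\<^esub> (c \<odot>\<^bsub>B\<^esub> x))) \<longlonglongrightarrow> 0"
      using tendsto_mult_left[OF x(2), of "cmod c"] x(1) by (simp add: smult_minus_smult nrm_smult)
    then show "c \<odot>\<^bsub>B\<^esub> x \<in> L" by (rule LI) (use x in auto)
  next
    fix x assume "x \<in> L"
    then obtain f :: "nat \<Rightarrow> ('a, 'x) toeplitz_term" where x: "x \<in> carrier B" "(\<lambda>n. nrm B (?ev (f n) \<ominus>\<^bsub>B\<^esub> x)) \<longlonglongrightarrow> 0"
      unfolding L_def by blast
    have "(\<lambda>n. nrm B (?ev (Adj (f n)) \<ominus>\<^bsub>B\<^esub> adj B x)) \<longlonglongrightarrow> 0"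
      using x by (simp add: adj_minus_adj nrm_adj)
    then show "adj B x \<in> L" by (rule LI) (use x adj_closed in auto)
  next
    fix g :: "nat \<Rightarrow> 'b" and l
    assume l: "l \<in> carrier B" and "(\<forall>n. g n \<in> L) \<and> (\<lambda>n. nrm B (g n \<ominus>\<^bsub>B\<^esub> l)) \<longlonglongrightarrow> 0"
    then have g: "\<And>n. g n \<in> L" and lim: "(\<lambda>n. nrm B (g n \<ominus>\<^bsub>B\<^esub> l)) \<longlonglongrightarrow> 0" by auto
    have gB: "g n \<in> carrier B" for n using g[of n] by (auto simp: L_def)
    have "\<exists>p. nrm B (?ev p \<ominus>\<^bsub>B\<^esub> g n) < inverse (real (Suc n))" for n
    proof -
      obtain f :: "nat \<Rightarrow> ('a, 'x) toeplitz_term" where "(\<lambda>k. nrm B (?ev (f k) \<ominus>\<^bsub>B\<^esub> g n)) \<longlonglongrightarrow> 0"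
        using g[of n] unfolding L_def by blast
      then have "\<forall>\<^sub>F k in sequentially. nrm B (?ev (f k) \<ominus>\<^bsub>B\<^esub> g n) < inverse (real (Suc n))"
        by (rule order_tendstoD) simp
      then show ?thesis by (auto simp: eventually_sequentially)
    qed
    then obtain p where p: "\<And>n. nrm B (?ev (p n) \<ominus>\<^bsub>B\<^esub> g n) < inverse (real (Suc n))" by metis
    have "(\<lambda>n. nrm B (?ev (p n) \<ominus>\<^bsub>B\<^esub> l)) \<longlonglongrightarrow> 0"
    proof (rule squeeze)
      show "nrm B (?ev (p n) \<ominus>\<^bsub>B\<^esub> l) \<le> inverse (real (Suc n)) + nrm B (g n \<ominus>\<^bsub>B\<^esub> l)" for n
        using nrm_dist_triangle[of "?ev (p n)" "g n" l] p[of n] gB l by simp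
      show "(\<lambda>n. inverse (real (Suc n)) + nrm B (g n \<ominus>\<^bsub>B\<^esub> l)) \<longlonglongrightarrow> 0"
        using tendsto_add[OF LIMSEQ_inverse_real_of_nat lim] by simp
    qed (use l in auto)
    then show "l \<in> L" by (rule LI) (use l in auto)
  qed
  then have "y \<in> L" using y gen unfolding hull_def by blast
  then show "\<exists>f::nat \<Rightarrow> _. (\<lambda>n. nrm B (?ev (f n) \<ominus>\<^bsub>B\<^esub> y)) \<longlonglongrightarrow> 0" by (auto simp: L_def)
qed

theorem universal_property:
  fixes B :: "'b star_alg" and D :: "'d star_alg" and E :: "('a, 'x) correspondence"
  assumes univ: "universal_toeplitz_representation A E B \<pi> t"
    and D: "cstar_algebra D" and rep: "toeplitz_representation A E D \<rho> \<tau>"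
  shows "\<exists>\<Phi>. star_hom B D \<Phi> \<and>
     (\<forall>a\<in>carrier A. \<Phi> (\<pi> a) = \<rho> a) \<and> (\<forall>\<xi>\<in>carrier E. \<Phi> (t \<xi>) = \<tau> \<xi>)"
proof -
  interpret D: cstar_algebra D by fact
  define G where "G = \<rho> ` carrier A \<union> \<tau> ` carrier E"
  define S where "S = cstar_subalgebra D hull G"
  have "G \<subseteq> carrier D"
    using rep by (auto simp: G_def toeplitz_representation_def star_hom_def linear_map_def)
  then have S: "cstar_subalgebra D S"
    unfolding S_def by (rule D.cstar_subalgebra_hull)
  have GS: "G \<subseteq> S" unfolding S_def by (rule hull_subset)
  have SD: "S \<subseteq> carrier D" using S by (auto simp: cstar_subalgebra_def closed_subalgebra_def)
  have Sops: "\<zero>\<^bsub>D\<^esub> \<in> S" "\<And>x y. x \<in> S \<Longrightarrow> y \<in> S \<Longrightarrow> x \<oplus>\<^bsub>D\<^esub> y \<in> S"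
    "\<And>x y. x \<in> S \<Longrightarrow> y \<in> S \<Longrightarrow> x \<otimes>\<^bsub>D\<^esub> y \<in> S" "\<And>c x. x \<in> S \<Longrightarrow> c \<odot>\<^bsub>D\<^esub> x \<in> S"
    "\<And>x. x \<in> S \<Longrightarrow> adj D x \<in> S"
    using S by (auto simp: cstar_subalgebra_def closed_subalgebra_def)
  let ?ev = "term_eval A E D \<rho> \<tau>"
  define i :: "'d \<Rightarrow> ('a, 'x) test_type"
    where "i y = (SOME f. (\<lambda>n. nrm D (?ev (f n) \<ominus>\<^bsub>D\<^esub> y)) \<longlonglongrightarrow> 0)" for y
  have i: "(\<lambda>n. nrm D (?ev (i y n) \<ominus>\<^bsub>D\<^esub> y)) \<longlonglongrightarrow> 0" if "y \<in> S" for y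
    unfolding i_def using generated_element_is_limit_of_terms(1)[OF D rep that[unfolded S_def G_def]]
    by (rule someI_ex)
  have ev: "?ev p \<in> carrier D" for p
    using generated_element_is_limit_of_terms(2)[OF D rep Sops(1)[unfolded S_def G_def]] .
  have inj: "inj_on i S"
  proof (rule inj_onI)
    fix x y assume xy: "x \<in> S" "y \<in> S" "i x = i y"
    show "x = y"
      by (rule D.limit_unique[of "\<lambda>n. ?ev (i x n)"]) (use xy SD ev i[of x] i[of y] in auto)
  qed
  define j where "j = inv_into S i"
  have ji [simp]: "j (i x) = x" if "x \<in> S" for x
    unfolding j_def using inj that by simp
  define D' :: "('a, 'x) test_type star_alg" where
    "D' = \<lparr>carrier = i ` S, mult = (\<lambda>u v. i (j u \<otimes>\<^bsub>D\<^esub> j v)), one = undefined,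
       zero = i \<zero>\<^bsub>D\<^esub>, add = (\<lambda>u v. i (j u \<oplus>\<^bsub>D\<^esub> j v)), smult = (\<lambda>c u. i (c \<odot>\<^bsub>D\<^esub> j u)),
       nrm = (\<lambda>u. nrm D (j u)), adj = (\<lambda>u. i (adj D (j u)))\<rparr>"
  have jS: "j ` i ` S = S" by (auto simp: image_image)
  have D': "cstar_algebra D'"
    by (rule cstar_algebra_embedding[OF D, of j])
      (use S in \<open>auto simp: D'_def jS Sops intro!: inj_onI\<close>)
  have rep': "toeplitz_representation A E D' (i \<circ> \<rho>) (i \<circ> \<tau>)"
  proof -
    have "\<And>a. a \<in> carrier A \<Longrightarrow> \<rho> a \<in> S" "\<And>\<xi>. \<xi> \<in> carrier E \<Longrightarrow> \<tau> \<xi> \<in> S"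
      using GS by (auto simp: G_def)
    then show ?thesis
      using rep unfolding toeplitz_representation_def star_hom_def linear_map_def
      by (simp add: D'_def Sops)
  qed
  obtain \<Phi> where \<Phi>: "star_hom B D' \<Phi>" "\<And>a. a\<in>carrier A \<Longrightarrow> \<Phi> (\<pi> a) = (i \<circ> \<rho>) a"
    "\<And>\<xi>. \<xi>\<in>carrier E \<Longrightarrow> \<Phi> (t \<xi>) = (i \<circ> \<tau>) \<xi>"
    using univ D' rep' unfolding universal_toeplitz_representation_def by metis
  have \<Phi>S: "\<Phi> x \<in> i ` S" if "x \<in> carrier B" for x
    using \<Phi>(1) that by (auto simp: star_hom_def linear_map_def D'_def)
  have jS': "j u \<in> S" if "u \<in> i ` S" for u using that by auto
  show ?thesis
  proof (intro exI[of _ "j \<circ> \<Phi>"] conjI ballI)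
    show "star_hom B D (j \<circ> \<Phi>)"
      using \<Phi>(1) jS'[OF \<Phi>S] SD unfolding star_hom_def linear_map_def
      by (auto simp: D'_def Sops)
  qed (use \<Phi>(2,3) GS in \<open>auto simp: G_def\<close>)
qed

end

theory Submission
  imports Defs
begin

text \<open>
  An element of the tensor algebra is determined by its Fourier coefficients, which are functions on
  the support \<open>supp\<close> of \<open>\<pi>\<close>: the universal property, applied to \<open>B\<close> itself, provides a gauge action,
  and averaging over roots of unity gives bounded coefficient maps and Fejer means. No concrete
  faithful representation is needed, because everything happens over \<open>supp\<close>.

  Summing the coefficients along the orbit of a point, with weights \<open>l ^ m\<close>, represents the algebra
  by finite matrices. Over a periodic orbit the image is a full matrix algebra, and over a
  segment of an aperiodic orbit it is spanned by the matrix units that point forward. Every bounded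
  derivation preserves the kernels of these representations: in the first case by Sinclair's
  argument \<open>D\<^sup>n(a\<^sup>n) = n! (D a)\<^sup>n\<close> modulo the kernel, in the second case by localizing at the
  points of the segment. An approximately local derivation therefore induces on each image a map
  \<open>\<Delta>\<close> such that \<open>x y = 0 = y z\<close> implies \<open>x \<Delta>(y) z = 0\<close>; since the image is unital and spanned by
  idempotents, \<open>\<Delta>\<close> is a derivation. The kernels have zero intersection.
\<close>

section \<open>Linear endomorphisms of a function space\<close>

text \<open>Each of the two invariance arguments fails in the other case. Over an aperiodic segment
  the image in general has nonzero nilpotent ideals, so Sinclair's bound, which only makes the
  derivative of a kernel element quasinilpotent modulo the kernel, proves nothing. Over a cycle each
  matrix position receives infinitely many degrees, so an element cannot be corrected one degree at
  a time. The weights are there because coefficients are only known to be bounded: with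
  \<open>l < 1\<close> the sum over a cycle converges, and letting \<open>l\<close> vary separates
  the degrees which the cycle adds up. The derivations that approximate at a point depend on that
  point and have no common bound. Hence invariance is proved for every single bounded derivation,
  and the limit is taken only afterwards, using that the kernels are closed. The product rule comes
  out of the zero products by inserting the unit of the image between two factors; this unit is sent
  to 0. The factors 2 and 4 in the norm estimates stem from a square-root argument that takes the
  place of spectral theory.\<close>

text \<open>Matrices are treated as endomorphisms: their size varies with the orbit, and composition makes
  them a type of class \<open>ring_1\<close>.\<close>

typedef 'i cend = "{T :: ('i \<Rightarrow> complex) \<Rightarrow> ('i \<Rightarrow> complex).
    (\<forall>v w. T (\<lambda>i. v i + w i) = (\<lambda>i. T v i + T w i)) \<and> (\<forall>c v. T (\<lambda>i. c * v i) = (\<lambda>i. c * T v i))}"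
  morphisms app Cend
  by (rule exI[of _ "\<lambda>v i. 0"]) auto

setup_lifting type_definition_cend

instantiation cend :: (type) ring_1
begin

lift_definition zero_cend :: "'a cend" is "\<lambda>v i. 0" by simp
lift_definition one_cend :: "'a cend" is "\<lambda>v. v" by simp
lift_definition plus_cend :: "'a cend \<Rightarrow> 'a cend \<Rightarrow> 'a cend" is "\<lambda>S T v i. S v i + T v i"
  by (simp add: algebra_simps)
lift_definition uminus_cend :: "'a cend \<Rightarrow> 'a cend" is "\<lambda>T v i. - T v i"
  by (simp add: algebra_simps)
lift_definition minus_cend :: "'a cend \<Rightarrow> 'a cend \<Rightarrow> 'a cend" is "\<lambda>S T v i. S v i - T v i"
  by (simp add: algebra_simps)
lift_definition times_cend :: "'a cend \<Rightarrow> 'a cend \<Rightarrow> 'a cend" is "\<lambda>S T v. S (T v)"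
  by simp

instance
proof
  fix a b c :: "'a cend"
  show "0 \<noteq> (1 :: 'a cend)"
  proof
    assume "0 = (1 :: 'a cend)"
    then have "app (0 :: 'a cend) (\<lambda>_. 1) = app 1 (\<lambda>_. 1)" by simp
    then show False by (simp add: zero_cend.rep_eq one_cend.rep_eq fun_eq_iff)
  qed
qed (transfer; simp add: algebra_simps fun_eq_iff)+

end

text \<open>Scalars are embedded as central ring elements, so that linear combinations of matrices
  are written with ring operations alone.\<close>

lift_definition scal :: "complex \<Rightarrow> 'i cend" is "\<lambda>c v i. c * v i"
  by (simp add: algebra_simps)

lemma scal_simps [simp]: "scal 1 = 1" "scal 0 = 0"
  by (transfer; simp)+

lemma scal_add: "scal (a + b) = scal a + scal b"
  by transfer (simp add: algebra_simps)

lemma scal_mult: "scal (a * b) = scal a * scal b"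
  by transfer (simp add: algebra_simps)

lemma scal_minus: "scal (- a) = - scal a"
  by transfer simp

lemma scal_commute: "T * scal c = scal c * T"
  by transfer (auto simp: fun_eq_iff)

lemma scal_left_commute: "S * (scal c * T) = scal c * (S * T)"
  by (metis scal_commute mult.assoc)

lemma scal_sum: "scal (sum f A) = (\<Sum>a\<in>A. scal (f a))"
  by (induction A rule: infinite_finite_induct) (auto simp: scal_add)

text \<open>The matrix unit with row \<open>z\<close> and column \<open>y\<close>: it carries the
  basis vector at \<open>y\<close> to the one at \<open>z\<close>.\<close>

lift_definition munit :: "'i \<Rightarrow> 'i \<Rightarrow> 'i cend" is "\<lambda>z y v i. if i = z then v y else 0"
  by (auto simp: fun_eq_iff)

lemma munit_mult: "munit z y * munit k l = (if y = k then munit z l else 0)"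
  by transfer (auto simp: fun_eq_iff)

text \<open>On an infinite index type these numbers do not determine the endomorphism. They serve to
  read values off a finite matrix; equality of matrices is obtained from
  \<open>matr_eqI\<close>.\<close>

definition entry :: "'i cend \<Rightarrow> 'i \<Rightarrow> 'i \<Rightarrow> complex" where
  "entry S z y = app S (\<lambda>i. if i = y then 1 else 0) z"

lemma entry_simps [simp]:
  "entry 0 z y = 0" "entry (S + T) z y = entry S z y + entry T z y"
  "entry (S - T) z y = entry S z y - entry T z y"
  "entry (scal c * S) z y = c * entry S z y"
  unfolding entry_def by (transfer; simp)+

lemma entry_munit [simp]: "entry (munit k l) z y = (if z = k \<and> y = l then 1 else 0)"
  unfolding entry_def by transfer auto

lemma entry_sum [simp]: "entry (sum f A) z y = (\<Sum>a\<in>A. entry (f a) z y)"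
  by (induction A rule: infinite_finite_induct) auto

definition matr :: "'i set \<Rightarrow> ('i \<Rightarrow> 'i \<Rightarrow> complex) \<Rightarrow> 'i cend" where
  "matr I m = (\<Sum>z\<in>I. \<Sum>y\<in>I. scal (m z y) * munit z y)"

lemma entry_matr: "finite I \<Longrightarrow> entry (matr I m) z y = (if z \<in> I \<and> y \<in> I then m z y else 0)"
proof -
  assume fin: "finite I"
  have 1: "(\<Sum>l\<in>I. m k l * entry (munit k l) z y) = (if z = k \<and> y \<in> I then m k y else 0)" for k
  proof -
    have "(\<Sum>l\<in>I. m k l * entry (munit k l) z y) = (\<Sum>l\<in>I. if l = y then (if z = k then m k y else 0) else 0)"
      by (rule sum.cong) auto
    then show ?thesis using fin by simp
  qed
  have "entry (matr I m) z y = (\<Sum>k\<in>I. if k = z then (if y \<in> I then m z y else 0) else 0)"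
    unfolding matr_def by (auto simp: 1 simp del: entry_munit intro!: sum.cong)
  then show ?thesis using fin by simp
qed

lemma matr_eqI:
  assumes "\<And>z y. z \<in> I \<Longrightarrow> y \<in> I \<Longrightarrow> m z y = n z y"
  shows "matr I m = matr I n"
  using assms by (auto simp: matr_def intro!: sum.cong)

lemma matr_add: "matr I m + matr I n = matr I (\<lambda>z y. m z y + n z y)"
  by (simp add: matr_def scal_add distrib_right sum.distrib)

lemma matr_scal: "scal c * matr I m = matr I (\<lambda>z y. c * m z y)"
  by (simp add: matr_def scal_mult sum_distrib_left mult.assoc)

lemma matr_mult:
  assumes "finite I"
  shows "matr I m * matr I n = matr I (\<lambda>z y. \<Sum>k\<in>I. m z k * n k y)"
proof -
  have 1: "scal (m z k) * munit z k * (\<Sum>k'\<in>I. \<Sum>y\<in>I. scal (n k' y) * munit k' y)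
      = (\<Sum>y\<in>I. scal (m z k * n k y) * munit z y)" if "k \<in> I" for z k
  proof -
    have "scal (m z k) * munit z k * (\<Sum>k'\<in>I. \<Sum>y\<in>I. scal (n k' y) * munit k' y)
       = (\<Sum>k'\<in>I. if k' = k then \<Sum>y\<in>I. scal (m z k * n k y) * munit z y else 0)"
      by (auto simp: sum_distrib_left scal_mult mult.assoc scal_left_commute[of "munit _ _"] munit_mult
          intro!: sum.cong)
    then show ?thesis using assms that by simp
  qed
  have "matr I m * matr I n = (\<Sum>z\<in>I. \<Sum>k\<in>I. \<Sum>y\<in>I. scal (m z k * n k y) * munit z y)"
    unfolding matr_def[of I m] matr_def[of I n] sum_distrib_right by (simp add: 1)
  also have "\<dots> = (\<Sum>z\<in>I. \<Sum>y\<in>I. \<Sum>k\<in>I. scal (m z k * n k y) * munit z y)"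
    by (intro sum.cong refl sum.swap)
  finally show ?thesis by (simp add: matr_def scal_sum sum_distrib_right)
qed

lemma matr_munit:
  assumes "finite I" "k \<in> I" "l \<in> I"
  shows "matr I (\<lambda>z y. if z = k \<and> y = l then c else 0) = scal c * munit k l"
proof -
  have "(\<Sum>y\<in>I. scal (if z = k \<and> y = l then c else 0) * munit z y) = (if z = k then scal c * munit k l else 0)" for z
  proof -
    have "(\<Sum>y\<in>I. scal (if z = k \<and> y = l then c else 0) * munit z y)
        = (\<Sum>y\<in>I. if y = l then (if z = k then scal c * munit k l else 0) else 0)"
      by (rule sum.cong) auto
    then show ?thesis using assms by simp
  qed
  then show ?thesis using assms by (simp add: matr_def)
qed

section \<open>Maps with the zero product property\<close>

text \<open>Write e' = u - e and f' = u - f. Each of the four corners e'bf', ebf', e'bf and ebf is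
  annihilated by the complementary idempotents on its two sides, so \<open>zp\<close> yields four
  equations. Their alternating sum is the claim.\<close>

lemma idempotent_zero_product:
  fixes \<Delta> :: "'r::ring \<Rightarrow> 'r"
  assumes zp: "\<And>a b c. a \<in> S \<Longrightarrow> b \<in> S \<Longrightarrow> c \<in> S \<Longrightarrow> a * b = 0 \<Longrightarrow> b * c = 0 \<Longrightarrow> a * \<Delta> b * c = 0"
    and diff: "\<And>a b. a \<in> S \<Longrightarrow> b \<in> S \<Longrightarrow> a - b \<in> S \<and> \<Delta> (a - b) = \<Delta> a - \<Delta> b"
    and mult: "\<And>a b. a \<in> S \<Longrightarrow> b \<in> S \<Longrightarrow> a * b \<in> S"
    and u: "u \<in> S" "\<And>a. a \<in> S \<Longrightarrow> u * a = a \<and> a * u = a" "\<And>a. a \<in> S \<Longrightarrow> u * \<Delta> a = \<Delta> a \<and> \<Delta> a * u = \<Delta> a"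
    and e: "e \<in> S" "e * e = e" and f: "f \<in> S" "f * f = f" and b: "b \<in> S"
  shows "\<Delta> (e * b * f) = \<Delta> (e * b) * f + e * \<Delta> (b * f) - e * \<Delta> b * f"
proof -
  have S: "e * b \<in> S" "b * f \<in> S" "e * b * f \<in> S" "u - e \<in> S" "u - f \<in> S" "b - e * b \<in> S" "b * f - e * b * f \<in> S" "b - b * f \<in> S" "e * b - e * b * f \<in> S"
    "b - e * b - (b * f - e * b * f) \<in> S"
    by (simp_all add: mult u(1) e f b diff[THEN conjunct1])
  note D = diff[THEN conjunct2]
  have ee: "e * (e * x) = e * x" for x using e(2) by (metis mult.assoc)
  have ff: "f * (f * x) = f * x" for x using f(2) by (metis mult.assoc)
  have ui: "u * x = x" "x * u = x" if "x \<in> S" for x using u(2) that by auto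
  have ui': "u * (x * y) = x * y" if "x \<in> S" for x y using u(2)[OF that] by (metis mult.assoc)
  have ud: "u * \<Delta> x = \<Delta> x" "\<Delta> x * u = \<Delta> x" if "x \<in> S" for x using u(3) that by auto
  have ud': "u * (\<Delta> x * y) = \<Delta> x * y" if "x \<in> S" for x y using u(3)[OF that] by (metis mult.assoc)
  have 1: "e * \<Delta> (b - e * b - (b * f - e * b * f)) * f = 0"
    by (rule zp) (simp_all add: S[unfolded mult.assoc] S e f b left_diff_distrib right_diff_distrib mult.assoc ee ff ui ui')
  have 2: "(u - e) * \<Delta> (e * b - e * b * f) * f = 0"
    by (rule zp) (simp_all add: S[unfolded mult.assoc] S e f b left_diff_distrib right_diff_distrib mult.assoc ee ff ui ui')
  have 3: "e * \<Delta> (b * f - e * b * f) * (u - f) = 0"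
    by (rule zp) (simp_all add: S[unfolded mult.assoc] S e f b left_diff_distrib right_diff_distrib mult.assoc ee ff ui ui')
  have 4: "(u - e) * \<Delta> (e * b * f) * (u - f) = 0"
    by (rule zp) (simp_all add: S[unfolded mult.assoc] S e f b left_diff_distrib right_diff_distrib mult.assoc ee ff ui ui')
  have eq1: "e * \<Delta> b * f - e * \<Delta> (e * b) * f - (e * \<Delta> (b * f) * f - e * \<Delta> (e * b * f) * f) = 0"
    using 1 S b by (simp add: D left_diff_distrib right_diff_distrib)
  have eq2: "\<Delta> (e * b) * f - \<Delta> (e * b * f) * f - (e * \<Delta> (e * b) * f - e * \<Delta> (e * b * f) * f) = 0"
    using 2 S b by (simp add: D ud left_diff_distrib right_diff_distrib) (simp add: algebra_simps)
  have eq3: "e * \<Delta> (b * f) - e * \<Delta> (e * b * f) - (e * \<Delta> (b * f) * f - e * \<Delta> (e * b * f) * f) = 0"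
    using 3 S b by (simp add: D ud left_diff_distrib right_diff_distrib mult.assoc)
  have eq4: "\<Delta> (e * b * f) - e * \<Delta> (e * b * f) - (\<Delta> (e * b * f) * f - e * \<Delta> (e * b * f) * f) = 0"
    using 4 S b by (simp add: D ud ud' left_diff_distrib right_diff_distrib mult.assoc)
  have sub: "p = q + r - s" if "p - q - (r - s) = 0" for p q r s :: 'r
    using that by (metis add_diff_eq diff_add_cancel add_0 add.commute)
  show ?thesis
    by (subst sub[OF eq4], subst sub[OF eq3], subst sub[OF eq2], subst sub[OF eq1]) (simp add: add_ac)
qed

text \<open>The identity is linear in the two outer factors, so it passes from idempotents to their
  differences, the members of \<open>P\<close>, and then to all of \<open>S\<close>, first on the
  left and then on the right. The index sets consist of pairs because the spanning elements will be
  matrix units.\<close>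

lemma span_idempotents_zero_product:
  fixes \<Delta> :: "'i cend \<Rightarrow> 'i cend" and P :: "'i cend set"
  assumes zp: "\<And>a b c. a \<in> S \<Longrightarrow> b \<in> S \<Longrightarrow> c \<in> S \<Longrightarrow> a * b = 0 \<Longrightarrow> b * c = 0 \<Longrightarrow> a * \<Delta> b * c = 0"
    and add: "\<And>a b. a \<in> S \<Longrightarrow> b \<in> S \<Longrightarrow> a + b \<in> S \<and> \<Delta> (a + b) = \<Delta> a + \<Delta> b"
    and scal: "\<And>c a. a \<in> S \<Longrightarrow> scal c * a \<in> S \<and> \<Delta> (scal c * a) = scal c * \<Delta> a"
    and mult: "\<And>a b. a \<in> S \<Longrightarrow> b \<in> S \<Longrightarrow> a * b \<in> S"
    and u: "u \<in> S" "\<And>a. a \<in> S \<Longrightarrow> u * a = a \<and> a * u = a" "\<And>a. a \<in> S \<Longrightarrow> u * \<Delta> a = \<Delta> a \<and> \<Delta> a * u = \<Delta> a"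
    and P: "P \<subseteq> S" "\<And>e. e \<in> P \<Longrightarrow> \<exists>f\<in>S. \<exists>g\<in>S. f * f = f \<and> g * g = g \<and> e = f - g"
    and span: "\<And>a. a \<in> S \<Longrightarrow> \<exists>I::('i \<times> 'i) set. \<exists>c g. finite I \<and> g ` I \<subseteq> P \<and> a = (\<Sum>i\<in>I. scal (c i) * g i)"
    and abc: "a \<in> S" "b \<in> S" "c \<in> S"
  shows "\<Delta> (a * b * c) = \<Delta> (a * b) * c + a * \<Delta> (b * c) - a * \<Delta> b * c"
proof -
  have neg: "- a \<in> S \<and> \<Delta> (- a) = - \<Delta> a" if "a \<in> S" for a
    using scal[OF that, of "-1"] by (simp add: scal_minus)
  have diff: "a - b \<in> S \<and> \<Delta> (a - b) = \<Delta> a - \<Delta> b" if "a \<in> S" "b \<in> S" for a b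
    using add[of a "- b"] neg that by simp
  have zero: "0 \<in> S \<and> \<Delta> 0 = 0" using diff[OF u(1) u(1)] by simp
  note [simp] = add[THEN conjunct1] add[THEN conjunct2] scal[THEN conjunct1] scal[THEN conjunct2] mult
  define Q where "Q a b c \<longleftrightarrow> \<Delta> (a * b * c) = \<Delta> (a * b) * c + a * \<Delta> (b * c) - a * \<Delta> b * c" for a b c
  have Q_idem: "Q e b f" if "e \<in> S" "f \<in> S" "e * e = e" "f * f = f" "b \<in> S" for e b f
    unfolding Q_def by (rule idempotent_zero_product[OF zp diff mult u]) (use that in auto)
  have Qef: "Q e b f" if ef: "e \<in> P" "f \<in> P" and b: "b \<in> S" for e b f
  proof -
    obtain e1 e2 where e: "e1 \<in> S" "e2 \<in> S" "e1 * e1 = e1" "e2 * e2 = e2" "e = e1 - e2"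
      using P(2)[OF ef(1)] by blast
    obtain f1 f2 where f: "f1 \<in> S" "f2 \<in> S" "f1 * f1 = f1" "f2 * f2 = f2" "f = f1 - f2"
      using P(2)[OF ef(2)] by blast
    have left: "Q (x1 - x2) b y" if "Q x1 b y" "Q x2 b y" "x1 \<in> S" "x2 \<in> S" "y \<in> S" for x1 x2 y
      using that b diff unfolding Q_def by (simp add: left_diff_distrib)
    have right: "Q x b (y1 - y2)" if "Q x b y1" "Q x b y2" "y1 \<in> S" "y2 \<in> S" "x \<in> S" for x y1 y2
      using that b diff unfolding Q_def by (simp add: right_diff_distrib)
    have "e \<in> S" using ef P by blast
    then show ?thesis unfolding f(5)
      by (rule right[rotated 4]) (use e f b left Q_idem in \<open>auto\<close>)
  qed
  have suml: "(\<Sum>i\<in>I. scal (d i) * g i) \<in> S \<and> Q (\<Sum>i\<in>I. scal (d i) * g i) b f"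
    if "finite I" "g ` I \<subseteq> P" "f \<in> P" "b \<in> S" for I :: "('i \<times> 'i) set" and d g b f
    using that
  proof (induction I)
    case empty
    then show ?case using zero by (simp add: Q_def)
  next
    case (insert i I)
    have S: "g i \<in> S" "f \<in> S" "(\<Sum>i\<in>I. scal (d i) * g i) \<in> S" using insert P by auto
    have 1: "Q (g i) b f" using insert by (intro Qef) auto
    have 2: "Q (\<Sum>i\<in>I. scal (d i) * g i) b f" using insert by auto
    then show ?case using insert S 1 unfolding Q_def
      by (simp add: distrib_left distrib_right mult.assoc right_diff_distrib)
  qed
  have Qaf: "Q a b f" if abf: "a \<in> S" "b \<in> S" "f \<in> P" for a b f
  proof -
    obtain I :: "('i \<times> 'i) set" and d g where "finite I" "g ` I \<subseteq> P" "a = (\<Sum>i\<in>I. scal (d i) * g i)"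
      using span[OF abf(1)] by blast
    then show ?thesis using suml[of I g f b d] abf by blast
  qed
  have sumr: "(\<Sum>i\<in>I. scal (d i) * g i) \<in> S \<and> Q a b (\<Sum>i\<in>I. scal (d i) * g i)"
    if "finite I" "g ` I \<subseteq> P" "a \<in> S" "b \<in> S" for I :: "('i \<times> 'i) set" and d g a b
    using that
  proof (induction I)
    case empty
    then show ?case using zero by (simp add: Q_def)
  next
    case (insert i I)
    have S: "g i \<in> S" "(\<Sum>i\<in>I. scal (d i) * g i) \<in> S" using insert P by auto
    have 1: "Q a b (g i)" using insert by (intro Qaf) auto
    have 2: "Q a b (\<Sum>i\<in>I. scal (d i) * g i)" using insert by auto
    then show ?case using insert S 1 unfolding Q_def
      by (simp add: distrib_left distrib_right scal_left_commute mult.assoc right_diff_distrib)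
  qed
  obtain I :: "('i \<times> 'i) set" and d g where "finite I" "g ` I \<subseteq> P" "c = (\<Sum>i\<in>I. scal (d i) * g i)"
    using span[OF abc(3)] by blast
  then show ?thesis using sumr[of I g a b d] abc(1,2) unfolding Q_def by blast
qed

section \<open>Automatic continuity of *-homomorphisms\<close>

context complex_banach_algebra
begin

declare mult_closed [simp, intro]

lemma
  assumes "x \<in> carrier B"
  shows smult_add_left: "(a + b) \<odot> x = a \<odot> x \<oplus> b \<odot> x"
    and smult_smult: "a \<odot> (b \<odot> x) = (a * b) \<odot> x"
    and smult_1 [simp]: "1 \<odot> x = x" and smult_0 [simp]: "0 \<odot> x = \<zero>"
  using smult_l_distr[of a b x] smult_assoc1[of a b x] smult_one[of x] smult_l_null[of x] assms
  by simp_all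

lemma smult_add_right:
  "x \<in> carrier B \<Longrightarrow> y \<in> carrier B \<Longrightarrow> a \<odot> (x \<oplus> y) = a \<odot> x \<oplus> a \<odot> y"
  using smult_r_distr[of a x y] by simp

lemma minus_eq: "x \<in> carrier B \<Longrightarrow> y \<in> carrier B \<Longrightarrow> x \<ominus> y = x \<oplus> (-1) \<odot> y"
  by (simp add: a_minus_def minus_conv)

lemma smult_zero [simp]: "c \<odot> \<zero> = \<zero>"
  using smult_r_null[of c] by simp

lemma nrm_zero [simp]: "nrm B \<zero> = 0"
  using nrm_eq_0_iff by simp

lemma minus_zero [simp]: "x \<in> carrier B \<Longrightarrow> x \<ominus> \<zero> = x"
  by (simp add: minus_eq)

lemma nrm_minus_commute: "x \<in> carrier B \<Longrightarrow> y \<in> carrier B \<Longrightarrow> nrm B (x \<ominus> y) = nrm B (y \<ominus> x)"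
  using nrm_a_inv[of "y \<ominus> x"] by (simp add: a_minus_def M.minus_add M.a_comm)

lemma eq_of_nrm_minus: "x \<in> carrier B \<Longrightarrow> y \<in> carrier B \<Longrightarrow> nrm B (x \<ominus> y) = 0 \<Longrightarrow> x = y"
  using limit_unique[of "\<lambda>_. x" x y] by (simp add: dist_self)

lemma tendsto_dist_squeeze:
  fixes f :: "nat \<Rightarrow> 'a"
  assumes "\<And>n. f n \<in> carrier B" "x \<in> carrier B" "\<And>n. nrm B (f n \<ominus> x) \<le> g n" "g \<longlonglongrightarrow> 0"
  shows "(\<lambda>n. nrm B (f n \<ominus> x)) \<longlonglongrightarrow> 0"
  by (rule tendsto_sandwich[OF _ _ tendsto_const assms(4)]) (use assms nrm_nonneg in auto)

lemma nrm_mult_minus_mult: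
  assumes "a \<in> carrier B" "b \<in> carrier B" "x \<in> carrier B" "y \<in> carrier B"
  shows "nrm B (a \<otimes> b \<ominus> x \<otimes> y) \<le> nrm B (a \<ominus> x) * nrm B b + nrm B x * nrm B (b \<ominus> y)"
  using nrm_triangle[of "(a \<ominus> x) \<otimes> b" "x \<otimes> (b \<ominus> y)"] nrm_mult[of "a \<ominus> x" b] nrm_mult[of x "b \<ominus> y"]
  by (simp add: mult_minus_mult assms)

lemma tendsto_mult:
  fixes f g :: "nat \<Rightarrow> 'a"
  assumes "\<And>n. f n \<in> carrier B" "x \<in> carrier B" "\<And>n. g n \<in> carrier B" "y \<in> carrier B"
    and f: "(\<lambda>n. nrm B (f n \<ominus> x)) \<longlonglongrightarrow> 0" and g: "(\<lambda>n. nrm B (g n \<ominus> y)) \<longlonglongrightarrow> 0"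
  shows "(\<lambda>n. nrm B (f n \<otimes> g n \<ominus> x \<otimes> y)) \<longlonglongrightarrow> 0"
proof (rule tendsto_dist_squeeze)
  fix n
  have "nrm B (f n \<otimes> g n \<ominus> x \<otimes> y) \<le> nrm B (f n \<ominus> x) * nrm B (g n) + nrm B x * nrm B (g n \<ominus> y)"
    using assms by (intro nrm_mult_minus_mult) auto
  also have "nrm B (f n \<ominus> x) * nrm B (g n) \<le> nrm B (f n \<ominus> x) * (nrm B (g n \<ominus> y) + nrm B y)"
    using assms by (intro mult_left_mono nrm_le_dist nrm_nonneg) auto
  finally show "nrm B (f n \<otimes> g n \<ominus> x \<otimes> y)
    \<le> nrm B (f n \<ominus> x) * (nrm B (g n \<ominus> y) + nrm B y) + nrm B x * nrm B (g n \<ominus> y)" by simp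
next
  show "(\<lambda>n. nrm B (f n \<ominus> x) * (nrm B (g n \<ominus> y) + nrm B y) + nrm B x * nrm B (g n \<ominus> y)) \<longlonglongrightarrow> 0"
    by (rule tendsto_eq_intros f g refl | simp)+
qed (use assms in auto)

lemma tendsto_add:
  fixes f g :: "nat \<Rightarrow> 'a"
  assumes "\<And>n. f n \<in> carrier B" "x \<in> carrier B" "\<And>n. g n \<in> carrier B" "y \<in> carrier B"
    and f: "(\<lambda>n. nrm B (f n \<ominus> x)) \<longlonglongrightarrow> 0" and g: "(\<lambda>n. nrm B (g n \<ominus> y)) \<longlonglongrightarrow> 0"
  shows "(\<lambda>n. nrm B (f n \<oplus> g n \<ominus> (x \<oplus> y))) \<longlonglongrightarrow> 0"
proof (rule tendsto_dist_squeeze)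
  show "nrm B (f n \<oplus> g n \<ominus> (x \<oplus> y)) \<le> nrm B (f n \<ominus> x) + nrm B (g n \<ominus> y)" for n
    using assms by (simp add: add_minus_add nrm_triangle)
  show "(\<lambda>n. nrm B (f n \<ominus> x) + nrm B (g n \<ominus> y)) \<longlonglongrightarrow> 0"
    using Limits.tendsto_add[OF f g] by simp
qed (use assms in auto)

lemma tendsto_smult:
  fixes f :: "nat \<Rightarrow> 'a"
  assumes "\<And>n. f n \<in> carrier B" "x \<in> carrier B" "(\<lambda>n. nrm B (f n \<ominus> x)) \<longlonglongrightarrow> 0"
  shows "(\<lambda>n. nrm B (c \<odot> f n \<ominus> c \<odot> x)) \<longlonglongrightarrow> 0"
  using tendsto_mult_left[OF assms(3), of "cmod c"] assms(1,2)
  by (simp add: smult_minus_smult nrm_smult)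

end

context cstar_algebra
begin

declare adj_closed [simp, intro]

text \<open>\<open>h - \<i>(s - 1)\<close> is a unitary of the unitization.\<close>

lemma nrm_le_2_of_sqrt:
  assumes h: "h \<in> carrier B" "adj B h = h" and s: "s \<in> carrier B" "adj B s = s"
    and comm: "h \<otimes> s = s \<otimes> h" and eq: "s \<oplus> s = h \<otimes> h \<oplus> s \<otimes> s"
  shows "nrm B h \<le> 2"
proof -
  define v where "v = h \<oplus> (-\<i>) \<odot> s"
  have v: "v \<in> carrier B" using h s by (simp add: v_def)
  have av: "adj B v = h \<oplus> \<i> \<odot> s" using h s by (simp add: v_def adj_add adj_smult)
  have cancel: "(-\<i>) \<odot> x \<oplus> \<i> \<odot> x = \<zero>" if "x \<in> carrier B" for x
    using that smult_add_left[of x "-\<i>" \<i>] by simp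
  have "adj B v \<otimes> v = (h \<otimes> h \<oplus> s \<otimes> s) \<oplus> ((-\<i>) \<odot> (s \<otimes> h) \<oplus> \<i> \<odot> (s \<otimes> h))"
    unfolding av unfolding v_def using h s
    by (simp add: mult_l_distr mult_r_distr smult_mult_left smult_mult_right comm smult_smult
        M.a_ac smult_add_right)
  also have "\<dots> = 2 \<odot> s"
    using h s eq smult_add_left[of s 1 1] by (simp add: cancel)
  finally have vv: "adj B v \<otimes> v = 2 \<odot> s" .
  have "v \<oplus> adj B v = (h \<oplus> h) \<oplus> ((-\<i>) \<odot> s \<oplus> \<i> \<odot> s)"
    unfolding av unfolding v_def using h s by (simp add: M.a_ac)
  then have hv: "v \<oplus> adj B v = 2 \<odot> h"
    using h s cancel smult_add_left[of h 1 1] by simp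
  \<comment> \<open>The product of the adjoint of \<open>v\<close> with \<open>v\<close> is
    \<open>2 \<odot> s\<close>. Writing \<open>2 \<odot> s\<close> also as a combination of
    \<open>v\<close> and its adjoint turns the C*-identity into |v|^2 <= 2 |v|.\<close>
  have "\<i> \<odot> v \<oplus> (-\<i>) \<odot> adj B v = (s \<oplus> s) \<oplus> ((-\<i>) \<odot> h \<oplus> \<i> \<odot> h)"
    unfolding av unfolding v_def using h s by (simp add: M.a_ac smult_add_right smult_smult)
  then have sv: "\<i> \<odot> v \<oplus> (-\<i>) \<odot> adj B v = 2 \<odot> s"
    using h s cancel smult_add_left[of s 1 1] by simp
  have "2 * nrm B s \<le> 2 * nrm B v"
    using nrm_triangle[of "\<i> \<odot> v" "(-\<i>) \<odot> adj B v"] v s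
    by (simp add: sv nrm_smult nrm_adj)
  then have "(nrm B v)\<^sup>2 \<le> 2 * nrm B v"
    using cstar_identity[OF v] s by (simp add: vv nrm_smult)
  then have "nrm B v \<le> 2"
    using nrm_nonneg[OF v] by (cases "nrm B v = 0") (auto simp: power2_eq_square)
  then show ?thesis
    using nrm_triangle[of v "adj B v"] v h by (simp add: hv nrm_smult nrm_adj)
qed

text \<open>The equation says that 1 - s is a square root of 1 - h h in the unitization. Its
  solution is the fixed point of x |-> (h h + x x) / 2, which maps the ball of radius 1/4 into
  itself and contracts it by the factor 1/4. The iterates start at 0, so they are self-adjoint and
  commute with \<open>h\<close>, and so does the limit.\<close>

lemma ex_sqrt:
  assumes h: "h \<in> carrier B" "adj B h = h" and small: "nrm B h \<le> 1 / 2"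
  shows "\<exists>s\<in>carrier B. adj B s = s \<and> h \<otimes> s = s \<otimes> h \<and> s \<oplus> s = h \<otimes> h \<oplus> s \<otimes> s"
proof -
  define s where "s = rec_nat \<zero> (\<lambda>_ x. (1/2) \<odot> (h \<otimes> h \<oplus> x \<otimes> x))"
  have s0: "s 0 = \<zero>" and sS: "s (Suc n) = (1/2) \<odot> (h \<otimes> h \<oplus> s n \<otimes> s n)" for n
    by (simp_all add: s_def)
  have adj0: "adj B \<zero> = \<zero>"
    using adj_smult[of \<zero> 0] by simp
  have mult0: "\<zero> \<otimes> x = \<zero>" "x \<otimes> \<zero> = \<zero>" if "x \<in> carrier B" for x
    using smult_mult_left[of \<zero> x 0] smult_mult_right[of x \<zero> 0] that by simp_all
  have hh: "nrm B (h \<otimes> h) \<le> 1/4"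
    using nrm_mult[of h h] h mult_mono[OF small small] nrm_nonneg[of h] by simp
  have s: "s n \<in> carrier B \<and> adj B (s n) = s n \<and> h \<otimes> s n = s n \<otimes> h \<and> nrm B (s n) \<le> 1/4" for n
  proof (induction n)
    case 0
    then show ?case using h by (simp add: s0 adj0 mult0)
  next
    case (Suc n)
    have "nrm B (s n \<otimes> s n) \<le> 1/4"
      using nrm_mult[of "s n" "s n"] Suc mult_mono[of "nrm B (s n)" "1/4" "nrm B (s n)" "1/4"]
        nrm_nonneg[of "s n"] by simp
    then have "nrm B (s (Suc n)) \<le> 1/4"
      using nrm_triangle[of "h \<otimes> h" "s n \<otimes> s n"] Suc h hh by (simp add: sS nrm_smult)
    moreover have "h \<otimes> (s n \<otimes> s n) = s n \<otimes> s n \<otimes> h"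
      using Suc h by (metis mult_assoc)
    ultimately show ?case
      using Suc h
      by (simp add: sS adj_smult adj_add adj_mult smult_mult_left smult_mult_right
          mult_l_distr mult_r_distr mult_assoc)
  qed
  have step: "nrm B (s (Suc m) \<ominus> s (Suc n)) \<le> 1/4 * nrm B (s m \<ominus> s n)" for m n
  proof -
    have "nrm B (s (Suc m) \<ominus> s (Suc n)) = 1/2 * nrm B (s m \<otimes> s m \<ominus> s n \<otimes> s n)"
      using s h by (simp add: sS smult_minus_smult nrm_smult add_minus_add dist_self)
         (simp add: a_minus_def M.r_neg)
    also have "\<dots> \<le> 1/2 * (nrm B (s m \<ominus> s n) * nrm B (s m) + nrm B (s n) * nrm B (s m \<ominus> s n))"
      using nrm_mult_minus_mult[of "s m" "s m" "s n" "s n"] s by simp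
    also have "\<dots> \<le> 1/2 * (nrm B (s m \<ominus> s n) * (1/4) + (1/4) * nrm B (s m \<ominus> s n))"
      using s by (intro mult_left_mono add_mono mult_right_mono nrm_nonneg) auto
    finally show ?thesis by simp
  qed
  have cau: "nrm B (s (m + k) \<ominus> s m) \<le> (1/4) ^ m" for m k
  proof (induction m)
    case 0
    then show ?case using s[of k] by (simp add: s0)
  next
    case (Suc m)
    then show ?case using step[of "m + k" m] by simp
  qed
  have "\<exists>l\<in>carrier B. (\<lambda>n. nrm B (s n \<ominus> l)) \<longlonglongrightarrow> 0"
  proof (rule complete)
    fix e :: real assume "e > 0"
    then obtain N where N: "(1/4::real) ^ N < e / 2"
      using real_arch_pow_inv[of "e/2" "1/4"] by auto
    show "\<exists>N. \<forall>m\<ge>N. \<forall>n\<ge>N. nrm B (s m \<ominus> s n) < e"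
    proof (intro exI allI impI)
      fix m n assume "m \<ge> N" "n \<ge> N"
      then have "nrm B (s m \<ominus> s N) \<le> (1/4)^N" "nrm B (s n \<ominus> s N) \<le> (1/4)^N"
        using cau[of N "m - N"] cau[of N "n - N"] by simp_all
      then show "nrm B (s m \<ominus> s n) < e"
        using nrm_dist_triangle[of "s m" "s N" "s n"] nrm_minus_commute[of "s n" "s N"] s N by simp
    qed
  qed (use s in auto)
  then obtain l where l: "l \<in> carrier B" and lim: "(\<lambda>n. nrm B (s n \<ominus> l)) \<longlonglongrightarrow> 0" by blast
  have const: "(\<lambda>n. nrm B (h \<ominus> h)) \<longlonglongrightarrow> 0" using h by (simp add: dist_self)
  have "(\<lambda>n. nrm B (s n \<ominus> adj B l)) \<longlonglongrightarrow> 0"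
  proof -
    have "nrm B (s n \<ominus> adj B l) = nrm B (s n \<ominus> l)" for n
      using adj_minus_adj[of "s n" l] nrm_adj[of "s n \<ominus> l"] s[of n] l by simp
    then show ?thesis using lim by simp
  qed
  then have 1: "adj B l = l" using limit_unique[of s "adj B l" l] s l lim by auto
  have 2: "h \<otimes> l = l \<otimes> h"
    by (rule limit_unique[of "\<lambda>n. h \<otimes> s n"])
      (use tendsto_mult[of "\<lambda>_. h" h s l] tendsto_mult[of s l "\<lambda>_. h" h] const lim s h l in auto)
  have "(\<lambda>n. nrm B (s (Suc n) \<ominus> (1/2) \<odot> (h \<otimes> h \<oplus> l \<otimes> l))) \<longlonglongrightarrow> 0"
    unfolding sS using s h l lim const
    by (intro tendsto_smult tendsto_add tendsto_mult) (auto simp: dist_self)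
  moreover have "(\<lambda>n. nrm B (s (Suc n) \<ominus> l)) \<longlonglongrightarrow> 0"
    by (rule LIMSEQ_Suc[OF lim])
  ultimately have "l = (1/2) \<odot> (h \<otimes> h \<oplus> l \<otimes> l)"
    using limit_unique[of "\<lambda>n. s (Suc n)" "(1/2) \<odot> (h \<otimes> h \<oplus> l \<otimes> l)" l] s h l by auto
  then have "2 \<odot> l = h \<otimes> h \<oplus> l \<otimes> l"
    using h l smult_smult[of "h \<otimes> h \<oplus> l \<otimes> l" 2 "1/2"] by simp
  then have 3: "l \<oplus> l = h \<otimes> h \<oplus> l \<otimes> l"
    using smult_add_left[of l 1 1] l by simp
  show ?thesis using 1 2 3 l by blast
qed

end

text \<open>The product of the adjoint of \<open>x\<close> with \<open>x\<close> is scaled to norm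
  1/2, so that \<open>ex_sqrt\<close> applies. The equation satisfied by \<open>s\<close> is
  algebraic, hence \<open>\<Phi>\<close> carries it to \<open>D\<close>, where
  \<open>nrm_le_2_of_sqrt\<close> bounds the image; undoing the scaling gives the factor 2.\<close>

lemma star_hom_bounded:
  fixes B :: "('a, 'm) star_alg_scheme" and D :: "('b, 'n) star_alg_scheme"
  assumes "cstar_algebra B" "cstar_algebra D" and hom: "star_hom B D \<Phi>" and x: "x \<in> carrier B"
  shows "nrm D (\<Phi> x) \<le> 2 * nrm B x"
proof (cases "nrm B x = 0")
  case True
  interpret B: cstar_algebra B by fact
  interpret D: cstar_algebra D by fact
  have "x = 0 \<odot>\<^bsub>B\<^esub> x" using B.nrm_eq_0_iff[OF x] x True by simp
  then have "\<Phi> x = 0 \<odot>\<^bsub>D\<^esub> \<Phi> x" using hom x unfolding star_hom_def linear_map_def by metis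
  then show ?thesis using hom x True by (simp add: star_hom_def linear_map_def)
next
  case False
  interpret B: cstar_algebra B by fact
  interpret D: cstar_algebra D by fact
  note hom' = hom[unfolded star_hom_def linear_map_def]
  have pos: "nrm B x > 0" using False B.nrm_nonneg[OF x] by simp
  define c where "c = 1 / (2 * (nrm B x)\<^sup>2)"
  have c: "c > 0" using pos by (simp add: c_def)
  define h where "h = of_real c \<odot>\<^bsub>B\<^esub> (adj B x \<otimes>\<^bsub>B\<^esub> x)"
  have h: "h \<in> carrier B" "adj B h = h" "nrm B h = 1/2"
    using x pos c by (auto simp: h_def B.adj_smult B.adj_mult B.adj_adj B.nrm_smult B.cstar_identity)
      (simp add: c_def)
  obtain s where s: "s \<in> carrier B" "adj B s = s" "h \<otimes>\<^bsub>B\<^esub> s = s \<otimes>\<^bsub>B\<^esub> h"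
      "s \<oplus>\<^bsub>B\<^esub> s = h \<otimes>\<^bsub>B\<^esub> h \<oplus>\<^bsub>B\<^esub> s \<otimes>\<^bsub>B\<^esub> s"
    using B.ex_sqrt[of h] h by auto
  have "nrm D (\<Phi> h) \<le> 2"
  proof (rule D.nrm_le_2_of_sqrt)
    show "\<Phi> h \<otimes>\<^bsub>D\<^esub> \<Phi> s = \<Phi> s \<otimes>\<^bsub>D\<^esub> \<Phi> h" using hom' h s by metis
    show "\<Phi> s \<oplus>\<^bsub>D\<^esub> \<Phi> s = \<Phi> h \<otimes>\<^bsub>D\<^esub> \<Phi> h \<oplus>\<^bsub>D\<^esub> \<Phi> s \<otimes>\<^bsub>D\<^esub> \<Phi> s"
      using hom' h s by (metis B.mult_closed)
    show "\<Phi> h \<in> carrier D" "\<Phi> s \<in> carrier D" using hom' h(1) s(1) by blast+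
    show "adj D (\<Phi> h) = \<Phi> h" "adj D (\<Phi> s) = \<Phi> s" using hom' h(1,2) s(1,2) by metis+
  qed
  moreover have "\<Phi> h = of_real c \<odot>\<^bsub>D\<^esub> (adj D (\<Phi> x) \<otimes>\<^bsub>D\<^esub> \<Phi> x)"
    using hom' x by (simp add: h_def)
  ultimately have "c * (nrm D (\<Phi> x))\<^sup>2 \<le> 2"
    using hom' x c by (simp add: D.nrm_smult D.cstar_identity)
  then have "(nrm D (\<Phi> x))\<^sup>2 \<le> (2 * nrm B x)\<^sup>2"
    using pos by (simp add: c_def field_simps power2_eq_square)
  then show ?thesis by (rule power2_le_imp_le) (use pos in simp)
qed

section \<open>Functions vanishing at infinity\<close>

lemma continuous_map_complex_iff:
  "continuous_map Y euclidean (f :: _ \<Rightarrow> complex) \<longleftrightarrow> (\<forall>x\<in>topspace Y. (f \<longlongrightarrow> f x) (atin Y x))"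
  by (auto simp: continuous_map_atin)

lemma continuous_map_complex_mult:
  "continuous_map Y euclidean (f :: _ \<Rightarrow> complex) \<Longrightarrow> continuous_map Y euclidean g
   \<Longrightarrow> continuous_map Y euclidean (\<lambda>x. f x * g x)"
  by (auto simp: continuous_map_complex_iff intro!: tendsto_intros)

lemma continuous_map_complex_add:
  "continuous_map Y euclidean (f :: _ \<Rightarrow> complex) \<Longrightarrow> continuous_map Y euclidean g
   \<Longrightarrow> continuous_map Y euclidean (\<lambda>x. f x + g x)"
  by (auto simp: continuous_map_complex_iff intro!: tendsto_intros)

lemma continuous_map_compose_complex:
  fixes \<phi> :: "complex \<Rightarrow> complex"
  assumes "continuous_map Y euclidean f" "continuous_on UNIV \<phi>"
  shows "continuous_map Y euclidean (\<lambda>x. \<phi> (f x))"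
  using continuous_map_compose[of Y euclidean f euclidean \<phi>] assms by (simp add: o_def)

lemma closedin_cmod_ge:
  assumes "continuous_map Y euclidean (f :: _ \<Rightarrow> complex)"
  shows "closedin Y {x \<in> topspace Y. e \<le> cmod (f x)}"
proof -
  have "closed {z :: complex. e \<le> cmod z}"
    by (intro closed_Collect_le continuous_intros)
  then show ?thesis using closedin_continuous_map_preimage[OF assms, of "{z. e \<le> cmod z}"] by simp
qed

lemma C0_D:
  assumes "f \<in> C0 Y"
  shows "continuous_map Y euclidean f" "e > 0 \<Longrightarrow> compactin Y {x \<in> topspace Y. e \<le> cmod (f x)}"
    "x \<notin> topspace Y \<Longrightarrow> f x = 0"
  using assms by (auto simp: C0_def)

lemma C0_I:
  assumes cont: "continuous_map Y euclidean f" and zero: "\<And>x. x \<notin> topspace Y \<Longrightarrow> f x = 0"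
    and K: "\<And>e. e > 0 \<Longrightarrow> \<exists>K. compactin Y K \<and> {x \<in> topspace Y. e \<le> cmod (f x)} \<subseteq> K"
  shows "f \<in> C0 Y"
  unfolding C0_def
proof (intro CollectI conjI allI impI cont zero)
  fix e :: real assume "e > 0"
  then obtain K where "compactin Y K" "{x \<in> topspace Y. e \<le> cmod (f x)} \<subseteq> K" using K by blast
  then show "compactin Y {x \<in> topspace Y. e \<le> cmod (f x)}"
    using closed_compactin[OF _ _ closedin_cmod_ge[OF cont]] by blast
qed

lemma C0_zero [simp]: "(\<lambda>x. 0) \<in> C0 Y"
  by (rule C0_I) (auto intro!: exI[of _ "{}"])

lemma C0_add:
  assumes f: "f \<in> C0 Y" and g: "g \<in> C0 Y"
  shows "(\<lambda>x. f x + g x) \<in> C0 Y"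
proof (rule C0_I)
  fix e :: real assume "e > 0"
  then have "compactin Y ({x \<in> topspace Y. e/2 \<le> cmod (f x)} \<union> {x \<in> topspace Y. e/2 \<le> cmod (g x)})"
    using C0_D(2)[OF f, of "e/2"] C0_D(2)[OF g, of "e/2"] by (intro compactin_Un) auto
  moreover have "cmod (f x) \<ge> e / 2 \<or> cmod (g x) \<ge> e / 2" if "e \<le> cmod (f x + g x)" for x
    using norm_triangle_ineq[of "f x" "g x"] that by linarith
  ultimately show "\<exists>K. compactin Y K \<and> {x \<in> topspace Y. e \<le> cmod (f x + g x)} \<subseteq> K" by blast
qed (use C0_D[OF f] C0_D[OF g] in \<open>auto intro: continuous_map_complex_add\<close>)

lemma C0_compose:
  fixes \<phi> :: "complex \<Rightarrow> complex"
  assumes f: "f \<in> C0 Y" and \<phi>: "continuous_on UNIV \<phi>" "\<phi> 0 = 0"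
  shows "(\<lambda>x. \<phi> (f x)) \<in> C0 Y"
proof (rule C0_I)
  fix e :: real assume e: "e > 0"
  have "isCont \<phi> 0" using \<phi>(1) by (simp add: continuous_on_eq_continuous_at)
  then obtain d where d: "d > 0" "\<And>w. cmod w < d \<Longrightarrow> cmod (\<phi> w) < e"
    using e \<phi>(2) unfolding continuous_at_eps_delta by (metis dist_norm diff_zero)
  have "{x \<in> topspace Y. e \<le> cmod (\<phi> (f x))} \<subseteq> {x \<in> topspace Y. d \<le> cmod (f x)}"
    using d(2) by (force simp: not_less[symmetric])
  then show "\<exists>K. compactin Y K \<and> {x \<in> topspace Y. e \<le> cmod (\<phi> (f x))} \<subseteq> K"
    using C0_D(2)[OF f d(1)] by blast
qed (use C0_D[OF f] \<phi> in \<open>auto intro: continuous_map_compose_complex\<close>)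

lemma C0_scale: "f \<in> C0 Y \<Longrightarrow> (\<lambda>x. c * f x) \<in> C0 Y"
  by (rule C0_compose[of f Y "\<lambda>w. c * w"]) (auto intro!: continuous_intros)

lemma C0_cnj: "f \<in> C0 Y \<Longrightarrow> (\<lambda>x. cnj (f x)) \<in> C0 Y"
  by (rule C0_compose[of f Y cnj]) (auto intro!: continuous_intros)

lemma C0_bounded:
  assumes f: "f \<in> C0 Y"
  shows "\<exists>M>0. \<forall>x. cmod (f x) \<le> M"
proof -
  let ?K = "{x \<in> topspace Y. 1 \<le> cmod (f x)}"
  have "compactin euclidean (f ` ?K)"
    using image_compactin[OF C0_D(2)[OF f] C0_D(1)[OF f]] by simp
  then have "bounded (f ` ?K)" by (simp add: compact_imp_bounded)
  then obtain M where "\<And>x. x \<in> ?K \<Longrightarrow> cmod (f x) \<le> M" by (auto simp: bounded_iff)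
  then have "cmod (f x) \<le> max M 1" for x
    using C0_D(3)[OF f, of x] by (cases "x \<in> ?K") (auto simp: le_max_iff_disj)
  then show ?thesis by (intro exI[of _ "max M 1"]) auto
qed

text \<open>Only continuity at the boundary of \<open>W\<close> is at issue. A compact level set is
  closed because \<open>Y\<close> is Hausdorff, so its complement is an open set on which
  \<open>k\<close> is small; this makes preimages of neighbourhoods of 0 open.\<close>

lemma C0_extend:
  assumes Y: "Hausdorff_space Y" and W: "openin Y W" and zero: "\<And>x. x \<notin> W \<Longrightarrow> k x = 0"
    and cont: "continuous_map (subtopology Y W) euclidean k"
    and K: "\<And>e. e > 0 \<Longrightarrow> compactin Y {x \<in> W. e \<le> cmod (k x)}"
  shows "k \<in> C0 Y"
proof (rule C0_I)
  have WX: "W \<subseteq> topspace Y" using W by (rule openin_subset)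
  show "continuous_map Y euclidean k"
    unfolding continuous_map_def
  proof (intro conjI allI impI)
    fix T :: "complex set" assume "openin euclidean T"
    then have T: "open T" by simp
    have 1: "openin Y {x \<in> W. k x \<in> T}"
      using openin_continuous_map_preimage[OF cont, of T] T W WX
      by (auto simp: openin_open_subtopology Int_absorb1)
    show "openin Y {x \<in> topspace Y. k x \<in> T}"
    proof (cases "0 \<in> T")
      case False
      then have "{x \<in> topspace Y. k x \<in> T} = {x \<in> W. k x \<in> T}" using zero WX by force
      then show ?thesis using 1 by simp
    next
      case True
      then obtain e where e: "e > 0" "ball 0 e \<subseteq> T" using T by (meson open_contains_ball)
      have "closedin Y {x \<in> W. e \<le> cmod (k x)}"
        using compactin_imp_closedin[OF Y K[OF e(1)]] .
      then have "openin Y ({x \<in> W. k x \<in> T} \<union> (topspace Y - {x \<in> W. e \<le> cmod (k x)}))"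
        using 1 by blast
      moreover have "k x \<in> T" if "x \<notin> W \<or> \<not> e \<le> cmod (k x)" for x
        using that zero[of x] True e(2) by (auto simp: subset_iff)
      ultimately show ?thesis
        using WX by (elim back_subst[of "openin Y"]) blast
    qed
  qed auto
  show "\<exists>K. compactin Y K \<and> {x \<in> topspace Y. e \<le> cmod (k x)} \<subseteq> K" if "e > 0" for e
    using K[OF that] zero that by (intro exI[of _ "{x \<in> W. e \<le> cmod (k x)}"]) force
  show "k x = 0" if "x \<notin> topspace Y" for x using zero[of x] that WX by blast
qed

lemma C0_subtopology:
  assumes "Hausdorff_space Y" "openin Y U" "F \<in> C0 (subtopology Y U)"
  shows "F \<in> C0 Y" "x \<notin> U \<Longrightarrow> F x = 0"
proof -
  have U: "U \<subseteq> topspace Y" using assms(2) by (rule openin_subset)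
  show z: "F x = 0" if "x \<notin> U" for x using C0_D(3)[OF assms(3), of x] that by simp
  show "F \<in> C0 Y"
    by (rule C0_extend[OF assms(1,2)])
      (use z C0_D[OF assms(3)] U in \<open>auto simp: compactin_subtopology Int_absorb1\<close>)
qed

text \<open>Meant for \<open>h\<close> a function composed with an iterate of the partial
  homeomorphism: continuous and bounded on its domain \<open>W\<close>, but possibly without a limit
  at the boundary. The factor \<open>G\<close> absorbs this.\<close>

lemma C0_mult_extend:
  assumes Y: "Hausdorff_space Y" and W: "openin Y W" and G: "G \<in> C0 Y" "\<And>x. x \<notin> W \<Longrightarrow> G x = 0"
    and h: "continuous_map (subtopology Y W) euclidean h" "\<And>x. x \<in> W \<Longrightarrow> cmod (h x) \<le> M"
  shows "(\<lambda>x. h x * G x) \<in> C0 Y"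
proof (rule C0_extend[OF Y W])
  have WX: "W \<subseteq> topspace Y" using W by (rule openin_subset)
  have Gc: "continuous_map (subtopology Y W) euclidean G"
    using C0_D(1)[OF G(1)] by (rule continuous_map_from_subtopology)
  show c: "continuous_map (subtopology Y W) euclidean (\<lambda>x. h x * G x)"
    by (rule continuous_map_complex_mult[OF h(1) Gc])
  fix e :: real assume e: "e > 0"
  \<comment> \<open>Positive whatever \<open>M\<close> is, so that division by it is possible;
    \<open>M\<close> itself may be negative when \<open>W\<close> is empty.\<close>
  define M' where "M' = \<bar>M\<bar> + 1"
  have M': "M' > 0" "\<And>x. x \<in> W \<Longrightarrow> cmod (h x) \<le> M'" using h(2) by (fastforce simp: M'_def)+
  let ?K = "{x \<in> topspace Y. e / M' \<le> cmod (G x)}"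
  have "?K \<subseteq> W" using G(2) e M'(1) by (force simp: field_simps)
  then have K: "compactin (subtopology Y W) ?K"
    using C0_D(2)[OF G(1), of "e / M'"] e M'(1) by (simp add: compactin_subtopology)
  have "cmod (G x) \<ge> e / M'" if "x \<in> W" "e \<le> cmod (h x * G x)" for x
  proof -
    have "e \<le> M' * cmod (G x)"
      using that M'(2)[OF that(1)] mult_right_mono[of "cmod (h x)" M' "cmod (G x)"] by (simp add: norm_mult)
    then show ?thesis using M'(1) by (simp add: field_simps)
  qed
  then have "{x \<in> W. e \<le> cmod (h x * G x)} \<subseteq> ?K" using WX by blast
  moreover have "closedin (subtopology Y W) {x \<in> W. e \<le> cmod (h x * G x)}"
    using closedin_cmod_ge[OF c, of e] WX by (simp add: Int_absorb1)
  ultimately have "compactin (subtopology Y W) {x \<in> W. e \<le> cmod (h x * G x)}"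
    using closed_compactin[OF K] by blast
  then show "compactin Y {x \<in> W. e \<le> cmod (h x * G x)}" by (simp add: compactin_subtopology)
qed (use G in auto)

lemma C0_mult_continuous:
  assumes "Hausdorff_space Y" "G \<in> C0 Y" "continuous_map Y euclidean h"
    "\<And>x. x \<in> topspace Y \<Longrightarrow> cmod (h x) \<le> M"
  shows "(\<lambda>x. h x * G x) \<in> C0 Y"
  by (rule C0_mult_extend[OF assms(1) openin_topspace assms(2)])
    (use assms C0_D(3)[OF assms(2)] in auto)

lemma C0_mult:
  assumes "Hausdorff_space Y" "f \<in> C0 Y" "g \<in> C0 Y"
  shows "(\<lambda>x. f x * g x) \<in> C0 Y"
  using C0_bounded[OF assms(2)] C0_mult_continuous[OF assms(1,3) C0_D(1)[OF assms(2)]] by blast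

lemma C0_bump:
  assumes Y: "Hausdorff_space Y" "locally_compact_space Y" and x: "x \<in> topspace Y"
  shows "\<exists>f\<in>C0 Y. f x = 1 \<and> (\<forall>y. cmod (f y) \<le> 1)"
proof -
  obtain W K where WK: "openin Y W" "compactin Y K" "x \<in> W" "W \<subseteq> K"
    using Y(2) x unfolding locally_compact_space_def by blast
  have WX: "W \<subseteq> topspace Y" using WK(1) by (rule openin_subset)
  have cr: "completely_regular_space Y"
    using Y locally_compact_regular_imp_completely_regular_space by blast
  have "compactin Y {x}" using x by simp
  moreover have "closedin Y (topspace Y - W)" using WK(1) by blast
  ultimately obtain g where g: "continuous_map Y (top_of_set {0..1::real}) g"
      "g ` (topspace Y - W) \<subseteq> {0}" "g ` {x} \<subseteq> {1}"
    using Urysohn_completely_regular_compact_closed[of 0 "1::real" Y "{x}" "topspace Y - W"] cr WK(3)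
    by (auto simp: disjnt_def)
  have gc: "continuous_map Y euclideanreal g" and g01: "\<And>y. y \<in> topspace Y \<Longrightarrow> g y \<in> {0..1}"
    using g(1) by (auto simp: continuous_map_in_subtopology)
  define f where "f y = (if y \<in> topspace Y then complex_of_real (g y) else 0)" for y
  have "continuous_map Y euclidean (\<lambda>y. complex_of_real (g y))"
    using continuous_map_compose[OF gc, of euclidean complex_of_real]
    by (simp add: o_def continuous_on_of_real_id)
  then have fc: "continuous_map Y euclidean f"
    by (rule continuous_map_eq) (auto simp: f_def)
  have "f \<in> C0 Y"
  proof (rule C0_I[OF fc])
    fix e :: real assume "e > 0"
    then have "{x \<in> topspace Y. e \<le> cmod (f x)} \<subseteq> W" using g(2) by (force simp: f_def)
    then show "\<exists>K. compactin Y K \<and> {x \<in> topspace Y. e \<le> cmod (f x)} \<subseteq> K" using WK by blast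
  qed (simp add: f_def)
  moreover have "f x = 1" "\<forall>y. cmod (f y) \<le> 1" using g(3) x g01 by (auto simp: f_def)
  ultimately show ?thesis by blast
qed

lemma C0_bump_subtopology:
  assumes Y: "Hausdorff_space Y" "locally_compact_space Y" and W: "openin Y W" "x \<in> W"
  shows "\<exists>f\<in>C0 (subtopology Y W). f x = 1 \<and> (\<forall>y. cmod (f y) \<le> 1)"
proof (rule C0_bump)
  show "Hausdorff_space (subtopology Y W)" using Y(1) by (rule Hausdorff_space_subtopology)
  show "locally_compact_space (subtopology Y W)"
    using locally_compact_space_open_subset[of Y W] Y W by blast
  show "x \<in> topspace (subtopology Y W)" using W openin_subset by fastforce
qed

context complex_banach_algebra
begin

lemma mult_zero [simp]: "x \<in> carrier B \<Longrightarrow> \<zero> \<otimes> x = \<zero>" "x \<in> carrier B \<Longrightarrow> x \<otimes> \<zero> = \<zero>"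
  using smult_mult_left[of \<zero> x 0] smult_mult_right[of x \<zero> 0] by simp_all

end

section \<open>Homogeneous elements of the Toeplitz algebra\<close>

locale partial_homeo_toeplitz = cstar_algebra B
  for \<Omega> :: "'o topology" and U V :: "'o set" and \<sigma> :: "'o \<Rightarrow> 'o"
    and B :: "'b star_alg" (structure)
    and \<pi> :: "('o \<Rightarrow> complex) \<Rightarrow> 'b" and t :: "('o \<Rightarrow> complex) \<Rightarrow> 'b" +
  assumes lc: "locally_compact_space \<Omega>" and Hd: "Hausdorff_space \<Omega>"
    and U: "openin \<Omega> U" and V: "openin \<Omega> V"
    and \<sigma>: "homeomorphic_map (subtopology \<Omega> U) (subtopology \<Omega> V) \<sigma>"
    and univ: "universal_toeplitz_representation (C0_alg \<Omega>) (partial_homeo_corr \<Omega> U \<sigma>) B \<pi> t"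
begin

abbreviation C0_U :: "('o \<Rightarrow> complex) set" where
  "C0_U \<equiv> C0 (subtopology \<Omega> U)"

abbreviation corr :: "('o \<Rightarrow> complex, 'o \<Rightarrow> complex) correspondence" where
  "corr \<equiv> partial_homeo_corr \<Omega> U \<sigma>"

lemma rep: "toeplitz_representation (C0_alg \<Omega>) corr B \<pi> t"
  using univ by (simp add: universal_toeplitz_representation_def)

lemma
  shows pi_closed [simp, intro]: "f \<in> C0 \<Omega> \<Longrightarrow> \<pi> f \<in> carrier B"
    and pi_add: "f \<in> C0 \<Omega> \<Longrightarrow> g \<in> C0 \<Omega> \<Longrightarrow> \<pi> (\<lambda>x. f x + g x) = \<pi> f \<oplus> \<pi> g"
    and pi_scale: "f \<in> C0 \<Omega> \<Longrightarrow> \<pi> (\<lambda>x. c * f x) = c \<odot> \<pi> f"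
    and pi_mult: "f \<in> C0 \<Omega> \<Longrightarrow> g \<in> C0 \<Omega> \<Longrightarrow> \<pi> (\<lambda>x. f x * g x) = \<pi> f \<otimes> \<pi> g"
    and pi_adj: "f \<in> C0 \<Omega> \<Longrightarrow> \<pi> (\<lambda>x. cnj (f x)) = adj B (\<pi> f)"
    and t_closed [simp, intro]: "F \<in> C0_U \<Longrightarrow> t F \<in> carrier B"
    and t_add: "F \<in> C0_U \<Longrightarrow> G \<in> C0_U \<Longrightarrow> t (\<lambda>x. F x + G x) = t F \<oplus> t G"
    and t_scale: "F \<in> C0_U \<Longrightarrow> t (\<lambda>x. c * F x) = c \<odot> t F"
    and pi_t: "f \<in> C0 \<Omega> \<Longrightarrow> F \<in> C0_U \<Longrightarrow> \<pi> f \<otimes> t F = t (\<lambda>x. f (\<sigma> x) * F x)"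
    and adj_t_t: "F \<in> C0_U \<Longrightarrow> G \<in> C0_U
      \<Longrightarrow> adj B (t F) \<otimes> t G = \<pi> (\<lambda>x. cnj (F x) * G x)"
  using rep
  by (auto simp: toeplitz_representation_def star_hom_def linear_map_def C0_alg_def partial_homeo_corr_def)

lemma U_subset: "U \<subseteq> topspace \<Omega>"
  using U by (rule openin_subset)

lemmas C0U = C0_subtopology[OF Hd U]

lemma C0m [simp, intro]: "f \<in> C0 \<Omega> \<Longrightarrow> g \<in> C0 \<Omega> \<Longrightarrow> (\<lambda>x. f x * g x) \<in> C0 \<Omega>"
  by (rule C0_mult[OF Hd])

declare C0_add [simp, intro] C0_scale [simp, intro] C0_cnj [simp, intro]

lemma \<sigma>_continuous: "continuous_map (subtopology \<Omega> U) \<Omega> \<sigma>"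
  using homeomorphic_imp_continuous_map[OF \<sigma>] by (simp add: continuous_map_in_subtopology)

lemma \<sigma>_inj: "inj_on \<sigma> U"
  using homeomorphic_imp_injective_map[OF \<sigma>] U_subset by (simp add: Int_absorb1)

lemma \<sigma>_topspace: "x \<in> U \<Longrightarrow> \<sigma> x \<in> topspace \<Omega>"
  using continuous_map_image_subset_topspace[OF \<sigma>_continuous] U_subset by fastforce

abbreviation orb :: "nat \<Rightarrow> 'o \<Rightarrow> 'o" where
  "orb n \<equiv> \<sigma> ^^ n"

text \<open>\<open>\<sigma>\<close> is a total function, so its iterates have values everywhere;
  this is the domain of the iterate of the partial map.\<close>

definition dm :: "nat \<Rightarrow> 'o set" where
  "dm m = {x \<in> topspace \<Omega>. \<forall>i<m. orb i x \<in> U}"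

lemma dm_0 [simp]: "dm 0 = topspace \<Omega>" by (simp add: dm_def)

lemma dm_Suc: "dm (Suc m) = {x \<in> dm m. orb m x \<in> U}"
  by (auto simp: dm_def less_Suc_eq)

lemma dm_mono: "m \<le> n \<Longrightarrow> dm n \<subseteq> dm m"
  by (auto simp: dm_def)

lemma dm_open_continuous: "openin \<Omega> (dm m) \<and> continuous_map (subtopology \<Omega> (dm m)) \<Omega> (orb m)"
proof (induction m)
  case 0
  then show ?case by (simp add: id_def[symmetric])
next
  case (Suc m)
  have sub: "dm m \<subseteq> topspace \<Omega>" by (auto simp: dm_def)
  have "openin (subtopology \<Omega> (dm m)) {x \<in> topspace (subtopology \<Omega> (dm m)). orb m x \<in> U}"
    by (rule openin_continuous_map_preimage) (use Suc U in auto)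
  then have 1: "openin \<Omega> (dm (Suc m))"
    using Suc sub by (simp add: dm_Suc openin_open_subtopology Int_absorb1)
  have "continuous_map (subtopology \<Omega> (dm (Suc m))) \<Omega> (orb m)"
    using Suc by (auto intro: continuous_map_from_subtopology_mono simp: dm_Suc)
  then have "continuous_map (subtopology \<Omega> (dm (Suc m))) (subtopology \<Omega> U) (orb m)"
    by (auto simp: continuous_map_in_subtopology dm_Suc)
  then have "continuous_map (subtopology \<Omega> (dm (Suc m))) \<Omega> (\<sigma> \<circ> (orb m))"
    using \<sigma>_continuous by (rule continuous_map_compose)
  then show ?case using 1 by (simp add: o_def)
qed

lemma dm_topspace: "x \<in> dm m \<Longrightarrow> orb m x \<in> topspace \<Omega>"
  using continuous_map_image_subset_topspace[OF dm_open_continuous[of m, THEN conjunct2]]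
  by (auto simp: dm_def)

lemma dm_add: "x \<in> dm (m + n) \<longleftrightarrow> x \<in> dm n \<and> orb n x \<in> dm m"
  using dm_topspace[of x n] by (induction m) (auto simp: dm_Suc funpow_add)

lemma C0_compose_mult:
  assumes "f \<in> C0 \<Omega>" "G \<in> C0 \<Omega>" "\<And>x. x \<notin> dm m \<Longrightarrow> G x = 0"
  shows "(\<lambda>x. f (orb m x) * G x) \<in> C0 \<Omega>"
proof -
  obtain M where M: "\<And>x. cmod (f x) \<le> M" using C0_bounded[OF assms(1)] by blast
  have "continuous_map (subtopology \<Omega> (dm m)) euclidean (f \<circ> (orb m))"
    using dm_open_continuous C0_D(1)[OF assms(1)] continuous_map_compose by blast
  then show ?thesis
    using C0_mult_extend[OF Hd, of "dm m" G "\<lambda>x. f (orb m x)" M] dm_open_continuous[of m] assms M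
    by (simp add: o_def)
qed

lemma C0U_lact:
  assumes "f \<in> C0 \<Omega>" "F \<in> C0_U"
  shows "(\<lambda>x. f (\<sigma> x) * F x) \<in> C0_U"
proof -
  obtain M where M: "\<And>x. cmod (f x) \<le> M" using C0_bounded[OF assms(1)] by blast
  have "continuous_map (subtopology \<Omega> U) euclidean (f \<circ> \<sigma>)"
    using \<sigma>_continuous C0_D(1)[OF assms(1)] continuous_map_compose by blast
  then show ?thesis
    using C0_mult_continuous[of "subtopology \<Omega> U" F "\<lambda>x. f (\<sigma> x)" M] assms M Hd
    by (simp add: o_def Hausdorff_space_subtopology)
qed

lemma C0U_ract:
  assumes "f \<in> C0 \<Omega>" "F \<in> C0_U"
  shows "(\<lambda>x. F x * f x) \<in> C0_U"
proof -
  obtain M where M: "\<And>x. cmod (f x) \<le> M" using C0_bounded[OF assms(1)] by blast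
  have "continuous_map (subtopology \<Omega> U) euclidean f"
    using C0_D(1)[OF assms(1)] by (rule continuous_map_from_subtopology)
  then show ?thesis
    using C0_mult_continuous[of "subtopology \<Omega> U" F f M] assms M Hd
    by (simp add: Hausdorff_space_subtopology mult.commute)
qed

text \<open>Right linearity is not among the axioms of a Toeplitz representation but follows from
  them: all four products of the adjoint of \<open>a\<close> or \<open>t ?G\<close> with
  \<open>a\<close> or \<open>t ?G\<close> agree, so the C*-identity gives the difference of
  \<open>a\<close> and \<open>t ?G\<close> the norm 0.\<close>

lemma t_pi:
  assumes f: "f \<in> C0 \<Omega>" and F: "F \<in> C0_U"
  shows "t F \<otimes> \<pi> f = t (\<lambda>x. F x * f x)"
proof -
  let ?G = "\<lambda>x. F x * f x"
  have G: "?G \<in> C0_U" by (rule C0U_ract[OF f F])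
  note FG = C0U(1)[OF F] C0U(1)[OF G] f
  define a where "a = t F \<otimes> \<pi> f"
  have a: "a \<in> carrier B" using f F by (simp add: a_def)
  have 1: "adj B a \<otimes> a = \<pi> (\<lambda>x. cnj (?G x) * ?G x)"
  proof -
    have "adj B a \<otimes> a = adj B (\<pi> f) \<otimes> (adj B (t F) \<otimes> t F) \<otimes> \<pi> f"
      using f F by (simp add: a_def adj_mult mult_assoc)
    also have "\<dots> = \<pi> (\<lambda>x. cnj (f x) * (cnj (F x) * F x) * f x)"
      using FG F by (simp add: adj_t_t pi_adj[symmetric] pi_mult[symmetric])
    finally show ?thesis by (simp add: mult_ac)
  qed
  have 2: "adj B a \<otimes> t ?G = \<pi> (\<lambda>x. cnj (?G x) * ?G x)"
  proof -
    have "adj B a \<otimes> t ?G = adj B (\<pi> f) \<otimes> (adj B (t F) \<otimes> t ?G)"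
      using f F G by (simp add: a_def adj_mult mult_assoc)
    also have "\<dots> = \<pi> (\<lambda>x. cnj (f x) * (cnj (F x) * ?G x))"
      using FG F G by (simp add: adj_t_t pi_adj[symmetric] pi_mult[symmetric])
    finally show ?thesis by (simp add: mult_ac)
  qed
  have 3: "adj B (t ?G) \<otimes> a = \<pi> (\<lambda>x. cnj (?G x) * ?G x)"
  proof -
    have "adj B (t ?G) \<otimes> a = (adj B (t ?G) \<otimes> t F) \<otimes> \<pi> f"
      using f F G by (simp add: a_def mult_assoc)
    also have "\<dots> = \<pi> (\<lambda>x. cnj (?G x) * F x * f x)"
      using FG F G by (simp add: adj_t_t pi_mult[symmetric] del: complex_cnj_mult)
    finally show ?thesis by (simp add: mult_ac)
  qed
  have 4: "adj B (t ?G) \<otimes> t ?G = \<pi> (\<lambda>x. cnj (?G x) * ?G x)" by (rule adj_t_t[OF G G])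
  let ?p = "\<pi> (\<lambda>x. cnj (?G x) * ?G x)"
  have p: "?p \<in> carrier B" using FG by (intro pi_closed C0m C0_cnj)
  have "adj B (a \<ominus> t ?G) \<otimes> (a \<ominus> t ?G) = (?p \<oplus> (-1) \<odot> ?p) \<oplus> ((-1) \<odot> ?p \<oplus> ?p)"
    using a G 1 2 3 4 p
    by (simp add: minus_eq adj_add adj_smult mult_l_distr mult_r_distr smult_mult_left
        smult_mult_right smult_smult smult_add_right M.a_ac del: complex_cnj_mult)
  also have "\<dots> = \<zero>" using p smult_add_left[of ?p 1 "-1"] smult_add_left[of ?p "-1" 1] by simp
  finally have "(nrm B (a \<ominus> t ?G))\<^sup>2 = 0" using cstar_identity[of "a \<ominus> t ?G"] a G by simp
  then show ?thesis using eq_of_nrm_minus[of a "t ?G"] a G by (simp add: a_def)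
qed

text \<open>Here \<open>hom m \<xi> F\<close> says that \<open>\<xi>\<close> is a sum of products of \<open>m\<close> vectors; multiplied out in the
  \<open>m\<close>-fold tensor power of the correspondence, it is the function \<open>F\<close> on \<open>dm m\<close>.\<close>

inductive hom :: "nat \<Rightarrow> 'b \<Rightarrow> ('o \<Rightarrow> complex) \<Rightarrow> bool" where
  pi: "f \<in> C0 \<Omega> \<Longrightarrow> hom 0 (\<pi> f) f"
| t: "F \<in> C0_U \<Longrightarrow> hom (Suc 0) (t F) F"
| t_mult: "F \<in> C0_U \<Longrightarrow> hom m \<xi> G \<Longrightarrow> hom (Suc m) (t F \<otimes> \<xi>) (\<lambda>x. F (orb m x) * G x)"
| add: "hom m \<xi> F \<Longrightarrow> hom m \<eta> G \<Longrightarrow> hom m (\<xi> \<oplus> \<eta>) (\<lambda>x. F x + G x)"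
| scale: "hom m \<xi> F \<Longrightarrow> hom m (c \<odot> \<xi>) (\<lambda>x. c * F x)"

lemma hom_D: "hom m \<xi> F \<Longrightarrow> \<xi> \<in> carrier B \<and> F \<in> C0 \<Omega> \<and> (\<forall>x. x \<notin> dm m \<longrightarrow> F x = 0)"
proof (induction rule: hom.induct)
  case (pi f)
  then show ?case using C0_D(3)[of f \<Omega>] by auto
next
  case (t F)
  then show ?case using C0U[OF t] U_subset by (auto simp: dm_def)
next
  case (t_mult F m \<xi> G)
  then show ?case using C0_compose_mult[of F G m] C0U[OF t_mult(1)] by (auto simp: dm_Suc)
qed auto

lemma hom_closed [simp]: "hom m \<xi> F \<Longrightarrow> \<xi> \<in> carrier B"
  and hom_C0: "hom m \<xi> F \<Longrightarrow> F \<in> C0 \<Omega>"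
  and hom_dm: "hom m \<xi> F \<Longrightarrow> F x \<noteq> 0 \<Longrightarrow> x \<in> dm m"
  using hom_D by blast+

lemma hom_zero: "hom m \<zero> (\<lambda>x. 0)"
proof (induction m)
  case 0
  show ?case using hom.scale[OF hom.pi[OF C0_zero], of 0] by simp
next
  case (Suc m)
  show ?case using hom.t_mult[OF C0_zero Suc] by (simp add: C0_zero)
qed

lemma hom_pi_mult: "hom m \<xi> F \<Longrightarrow> f \<in> C0 \<Omega> \<Longrightarrow> hom m (\<pi> f \<otimes> \<xi>) (\<lambda>x. f (orb m x) * F x)"
proof (induction arbitrary: f rule: hom.induct)
  case (pi g)
  then show ?case using hom.pi[of "\<lambda>x. f x * g x"] by (simp add: pi_mult)
next
  case (t F)
  then show ?case using hom.t[of "\<lambda>x. f (\<sigma> x) * F x"] by (simp add: pi_t C0U_lact)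
next
  case (t_mult F m \<xi> G)
  then have "hom (Suc m) (t (\<lambda>x. f (\<sigma> x) * F x) \<otimes> \<xi>) (\<lambda>x. f (\<sigma> (orb m x)) * F (orb m x) * G x)"
    by (intro hom.t_mult) (auto intro: C0U_lact)
  then show ?case using t_mult by (simp add: pi_t[symmetric] mult_assoc mult.assoc)
next
  case (add m \<xi> F \<eta> G)
  have "hom m (\<pi> f \<otimes> \<xi> \<oplus> \<pi> f \<otimes> \<eta>) (\<lambda>x. f (orb m x) * F x + f (orb m x) * G x)"
    using add by (intro hom.add) auto
  then show ?case using add by (simp add: mult_r_distr distrib_left)
next
  case (scale m \<xi> F c)
  have "hom m (c \<odot> (\<pi> f \<otimes> \<xi>)) (\<lambda>x. c * (f (orb m x) * F x))"
    using scale by (intro hom.scale) auto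
  then show ?case using scale by (simp add: smult_mult_right mult_ac)
qed

lemma hom_mult_pi: "hom m \<xi> F \<Longrightarrow> f \<in> C0 \<Omega> \<Longrightarrow> hom m (\<xi> \<otimes> \<pi> f) (\<lambda>x. F x * f x)"
proof (induction arbitrary: f rule: hom.induct)
  case (pi g)
  then show ?case using hom.pi[of "\<lambda>x. g x * f x"] by (simp add: pi_mult)
next
  case (t F)
  then show ?case using hom.t[of "\<lambda>x. F x * f x"] by (simp add: t_pi C0U_ract)
next
  case (t_mult F m \<xi> G)
  then have "hom (Suc m) (t F \<otimes> (\<xi> \<otimes> \<pi> f)) (\<lambda>x. F (orb m x) * (G x * f x))"
    by (intro hom.t_mult) auto
  then show ?case using t_mult by (simp add: mult_assoc mult.assoc)
next
  case (add m \<xi> F \<eta> G)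
  have "hom m (\<xi> \<otimes> \<pi> f \<oplus> \<eta> \<otimes> \<pi> f) (\<lambda>x. F x * f x + G x * f x)"
    using add by (intro hom.add) auto
  then show ?case using add by (simp add: mult_l_distr distrib_right)
next
  case (scale m \<xi> F c)
  have "hom m (c \<odot> (\<xi> \<otimes> \<pi> f)) (\<lambda>x. c * (F x * f x))"
    using scale by (intro hom.scale) auto
  then show ?case using scale by (simp add: smult_mult_left mult_ac)
qed

lemma hom_mult:
  assumes "hom m \<xi> F" "hom n \<eta> G"
  shows "hom (m + n) (\<xi> \<otimes> \<eta>) (\<lambda>x. F (orb n x) * G x)"
  using assms
proof (induction rule: hom.induct)
  case (pi f)
  then show ?case using hom_pi_mult[of n \<eta> G f] by simp
next
  case (t F)
  then show ?case using hom.t_mult[of F n \<eta> G] by simp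
next
  case (t_mult F m \<xi> F')
  have "hom (Suc (m + n)) (t F \<otimes> (\<xi> \<otimes> \<eta>)) (\<lambda>x. F (orb (m + n) x) * (F' (orb n x) * G x))"
    using t_mult by (intro hom.t_mult) auto
  then show ?case using t_mult by (simp add: mult_assoc mult.assoc funpow_add)
next
  case (add m \<xi> F \<xi>' F')
  have "hom (m + n) (\<xi> \<otimes> \<eta> \<oplus> \<xi>' \<otimes> \<eta>) (\<lambda>x. F (orb n x) * G x + F' (orb n x) * G x)"
    using add by (intro hom.add) auto
  then show ?case using add by (simp add: mult_l_distr distrib_right)
next
  case (scale m \<xi> F c)
  have "hom (m + n) (c \<odot> (\<xi> \<otimes> \<eta>)) (\<lambda>x. c * (F (orb n x) * G x))"
    using scale by (intro hom.scale) auto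
  then show ?case using scale by (simp add: smult_mult_left mult_ac)
qed

lemma hom_0_eq: "hom m \<xi> F \<Longrightarrow> m = 0 \<Longrightarrow> \<xi> = \<pi> F"
  by (induction rule: hom.induct) (auto simp: pi_add pi_scale hom_C0)

text \<open>Multiplication by the adjoint of a vector lowers the degree by one; in this form the
  Toeplitz relation can be iterated.\<close>

lemma hom_adj_t_mult:
  "hom k \<eta> G \<Longrightarrow> k = Suc m \<Longrightarrow> F \<in> C0_U
    \<Longrightarrow> hom m (adj B (t F) \<otimes> \<eta>) (\<lambda>x. cnj (F (orb m x)) * G x)"
proof (induction rule: hom.induct)
  case (t G)
  then show ?case
    using hom.pi[of "\<lambda>x. cnj (F x) * G x"] C0U(1) by (simp add: adj_t_t)
next
  case (t_mult G m' \<xi> H)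
  have "hom m (\<pi> (\<lambda>x. cnj (F x) * G x) \<otimes> \<xi>) (\<lambda>x. cnj (F (orb m x)) * G (orb m x) * H x)"
    using t_mult C0U(1) by (intro hom_pi_mult[where f = "\<lambda>x. cnj (F x) * G x"]) auto
  then show ?case using t_mult by (simp add: adj_t_t[symmetric] mult_assoc mult.assoc)
next
  case (add k \<xi> G \<eta> H)
  have "hom m (adj B (t F) \<otimes> \<xi> \<oplus> adj B (t F) \<otimes> \<eta>)
      (\<lambda>x. cnj (F (orb m x)) * G x + cnj (F (orb m x)) * H x)"
    using add by (intro hom.add) auto
  then show ?case using add by (simp add: mult_r_distr distrib_left)
next
  case (scale k \<xi> G c)
  have "hom m (c \<odot> (adj B (t F) \<otimes> \<xi>)) (\<lambda>x. c * (cnj (F (orb m x)) * G x))"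
    using scale by (intro hom.scale) auto
  then show ?case using scale by (simp add: smult_mult_right mult_ac)
qed auto

text \<open>Vectors are stripped from the left of \<open>\<xi>\<close> one at a time, each lowering
  the degree of \<open>\<eta>\<close>. With the C*-identity this makes the norm of a homogeneous
  element depend on its function alone.\<close>

lemma adj_hom_mult: "hom m \<xi> F \<Longrightarrow> hom m \<eta> G \<Longrightarrow> adj B \<xi> \<otimes> \<eta> = \<pi> (\<lambda>x. cnj (F x) * G x)"
proof (induction arbitrary: \<eta> G rule: hom.induct)
  case (pi f)
  have "adj B (\<pi> f) \<otimes> \<eta> = \<pi> (\<lambda>x. cnj (f x)) \<otimes> \<pi> G"
    using pi hom_0_eq[of 0 \<eta> G] by (simp add: pi_adj)
  also have "\<dots> = \<pi> (\<lambda>x. cnj (f x) * G x)" using pi hom_C0[OF pi(2)] by (intro pi_mult[symmetric]) auto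
  finally show ?case .
next
  case (t F)
  then show ?case using hom_0_eq[OF hom_adj_t_mult[OF t(2) refl t(1)]] by simp
next
  case (t_mult F m \<xi> H)
  have "adj B (t F \<otimes> \<xi>) \<otimes> \<eta> = adj B \<xi> \<otimes> (adj B (t F) \<otimes> \<eta>)"
    using t_mult by (simp add: adj_mult mult_assoc)
  also have "\<dots> = \<pi> (\<lambda>x. cnj (H x) * (cnj (F (orb m x)) * G x))"
    using t_mult hom_adj_t_mult by blast
  finally show ?case by (simp add: mult_ac)
next
  case (add m \<xi> F \<xi>' F')
  have "adj B (\<xi> \<oplus> \<xi>') \<otimes> \<eta> = \<pi> (\<lambda>x. cnj (F x) * G x) \<oplus> \<pi> (\<lambda>x. cnj (F' x) * G x)"
    using add by (simp add: adj_add mult_l_distr)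
  also have "\<dots> = \<pi> (\<lambda>x. cnj (F x) * G x + cnj (F' x) * G x)"
    using add hom_C0 by (intro pi_add[symmetric] C0m C0_cnj) blast+
  finally show ?case by (simp add: distrib_right)
next
  case (scale m \<xi> F c)
  have "adj B (c \<odot> \<xi>) \<otimes> \<eta> = cnj c \<odot> \<pi> (\<lambda>x. cnj (F x) * G x)"
    using scale by (simp add: adj_smult smult_mult_left)
  also have "\<dots> = \<pi> (\<lambda>x. cnj c * (cnj (F x) * G x))"
    using scale hom_C0 by (intro pi_scale[symmetric] C0m C0_cnj) blast+
  finally show ?case by (simp add: mult_ac)
qed

lemma hom_nrm: "hom m \<xi> F \<Longrightarrow> (nrm B \<xi>)\<^sup>2 = nrm B (\<pi> (\<lambda>x. cnj (F x) * F x))"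
  using adj_hom_mult[of m \<xi> F \<xi> F] cstar_identity[of \<xi>] by simp

end

section \<open>The support of the coefficient representation\<close>

context partial_homeo_toeplitz
begin

lemma pi_zero [simp]: "\<pi> (\<lambda>x. 0) = \<zero>"
  using pi_scale[OF C0_zero, of 0] by simp

lemma t_zero [simp]: "t (\<lambda>x. 0) = \<zero>"
  using t_scale[OF C0_zero, of 0] by (simp add: C0_zero)

text \<open>The square root required by \<open>nrm_le_2_of_sqrt\<close> is explicit for functions:
  with h = (|f| / M)^2 take s = 1 - sqrt (1 - h^2).\<close>

lemma pi_bound:
  assumes f: "f \<in> C0 \<Omega>" and M: "M > 0" "\<And>x. cmod (f x) \<le> M"
  shows "nrm B (\<pi> f) \<le> 2 * M"
proof -
  define h where "h x = complex_of_real ((cmod (f x) / M)\<^sup>2)" for x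
  define s where "s x = complex_of_real (1 - sqrt (1 - (cmod (f x) / M) ^ 4))" for x
  have h: "h \<in> C0 \<Omega>"
    unfolding h_def by (rule C0_compose[OF f, of "\<lambda>w. complex_of_real ((cmod w / M)\<^sup>2)"])
      (use M in \<open>auto intro!: continuous_intros\<close>)
  have s: "s \<in> C0 \<Omega>"
    unfolding s_def by (rule C0_compose[OF f, of "\<lambda>w. complex_of_real (1 - sqrt (1 - (cmod w / M) ^ 4))"])
      (use M in \<open>auto intro!: continuous_intros\<close>)
  have eq: "s x + s x = h x * h x + s x * s x" for x
  proof -
    define r where "r = sqrt (1 - (cmod (f x) / M) ^ 4)"
    have "(cmod (f x) / M) ^ 4 \<le> 1" using M by (intro power_le_one) auto
    then have "r * r = 1 - (cmod (f x) / M) ^ 4" by (simp add: r_def)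
    moreover have "(cmod (f x) / M)\<^sup>2 * (cmod (f x) / M)\<^sup>2 = (cmod (f x) / M) ^ 4"
      by (simp flip: power_add)
    ultimately have "(1 - r) + (1 - r) = (cmod (f x) / M)\<^sup>2 * (cmod (f x) / M)\<^sup>2 + (1 - r) * (1 - r)"
      by (simp only:) (simp add: algebra_simps)
    then show ?thesis unfolding h_def s_def r_def[symmetric]
      by (simp only: of_real_add[symmetric] of_real_mult[symmetric])
  qed
  have "nrm B (\<pi> h) \<le> 2"
  proof (rule nrm_le_2_of_sqrt)
    show "adj B (\<pi> h) = \<pi> h" "adj B (\<pi> s) = \<pi> s"
    proof -
      have "(\<lambda>x. cnj (h x)) = h" "(\<lambda>x. cnj (s x)) = s" by (simp_all add: fun_eq_iff h_def s_def)
      then show "adj B (\<pi> h) = \<pi> h" "adj B (\<pi> s) = \<pi> s"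
        using pi_adj[OF h] pi_adj[OF s] by simp_all
    qed
    show "\<pi> h \<otimes> \<pi> s = \<pi> s \<otimes> \<pi> h"
      using h s by (simp add: pi_mult[symmetric] mult.commute)
    have "\<pi> s \<oplus> \<pi> s = \<pi> (\<lambda>x. s x + s x)" by (rule pi_add[OF s s, symmetric])
    also have "\<dots> = \<pi> (\<lambda>x. h x * h x + s x * s x)" by (simp only: eq)
    also have "\<dots> = \<pi> h \<otimes> \<pi> h \<oplus> \<pi> s \<otimes> \<pi> s"
      using h s by (simp add: pi_mult[symmetric] pi_add[symmetric])
    finally show "\<pi> s \<oplus> \<pi> s = \<pi> h \<otimes> \<pi> h \<oplus> \<pi> s \<otimes> \<pi> s" .
  qed (use h s in auto)
  moreover have "adj B (\<pi> f) \<otimes> \<pi> f = of_real (M\<^sup>2) \<odot> \<pi> h"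
  proof -
    have "cnj (f x) * f x = of_real (M\<^sup>2) * h x" for x
      using M(1) complex_norm_square[of "f x"] by (simp add: h_def power_divide mult.commute)
    then have "\<pi> (\<lambda>x. cnj (f x) * f x) = of_real (M\<^sup>2) \<odot> \<pi> h"
      using pi_scale[OF h, of "of_real (M\<^sup>2)"] by simp
    then show ?thesis using f by (simp add: pi_adj[symmetric] pi_mult[symmetric])
  qed
  ultimately have "(nrm B (\<pi> f))\<^sup>2 \<le> M\<^sup>2 * 2"
    using cstar_identity[of "\<pi> f"] f h M(1) mult_left_mono[of "nrm B (\<pi> h)" 2 "M\<^sup>2"]
    by (simp add: nrm_smult norm_power)
  also have "\<dots> \<le> (2 * M)\<^sup>2" by (simp add: power_mult_distrib)
  finally show ?thesis by (rule power2_le_imp_le) (use M in simp)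
qed

text \<open>The hull of the ideal of functions annihilated by \<open>\<pi>\<close>, in other words
  the spectrum of the commutative algebra of all \<open>\<pi> f\<close>.\<close>

definition supp :: "'o set" where
  "supp = {y \<in> topspace \<Omega>. \<forall>f\<in>C0 \<Omega>. \<pi> f = \<zero> \<longrightarrow> f y = 0}"

lemma supp_topspace: "y \<in> supp \<Longrightarrow> y \<in> topspace \<Omega>"
  by (simp add: supp_def)

text \<open>If \<open>nrm B (\<pi> f) < c < cmod (f y)\<close>, then a function supported where \<open>cmod f \<ge> c\<close> can be
  divided by every power of \<open>f\<close>, which forces it into the kernel of \<open>\<pi>\<close>.\<close>

lemma cmod_le_nrm_pi:
  assumes y: "y \<in> supp" and f: "f \<in> C0 \<Omega>"
  shows "cmod (f y) \<le> nrm B (\<pi> f)"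
proof (rule ccontr)
  assume "\<not> ?thesis"
  then obtain c where c: "nrm B (\<pi> f) < c" "c < cmod (f y)"
    using dense[of "nrm B (\<pi> f)" "cmod (f y)"] by auto
  have c0: "c > 0" using c nrm_nonneg[of "\<pi> f"] f by simp
  define k where "k x = complex_of_real (max (cmod (f x) - c) 0)" for x
  \<comment> \<open>Where |f| >= c the base of the power is 1 / f, so \<open>q n\<close> is
    \<open>k\<close> divided by f^n. Replacing |f| by its maximum with \<open>c\<close> keeps the
    base continuous and of modulus at most 1 / c; where |f| < c it is not 1 / f, but there
    \<open>k\<close> vanishes.\<close>
  define q where "q n x = k x * (cnj (f x) / of_real ((max (cmod (f x)) c)\<^sup>2)) ^ n" for n x
  have k: "k \<in> C0 \<Omega>"
    unfolding k_def by (rule C0_compose[OF f, of "\<lambda>w. complex_of_real (max (cmod w - c) 0)"])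
      (use c0 in \<open>auto intro!: continuous_intros\<close>)
  have m0: "max (cmod w) c \<noteq> 0" for w using c0 by (auto simp: max_def)
  have q: "q n \<in> C0 \<Omega>" for n
    unfolding q_def k_def
    by (rule C0_compose[OF f, of "\<lambda>w. complex_of_real (max (cmod w - c) 0)
          * (cnj w / of_real ((max (cmod w) c)\<^sup>2)) ^ n"])
      (use c0 m0 in \<open>auto intro!: continuous_intros\<close>)
  obtain M where M: "M > 0" "\<And>x. cmod (k x) \<le> M" using C0_bounded[OF k] by blast
  have small: "cmod (cnj (f x) / of_real ((max (cmod (f x)) c)\<^sup>2)) \<le> 1 / c" for x
  proof -
    let ?m = "max (cmod (f x)) c"
    have m: "?m > 0" "cmod (f x) \<le> ?m" "c \<le> ?m" using c0 by auto
    have "cmod (f x) / ?m\<^sup>2 \<le> ?m / ?m\<^sup>2" by (rule divide_right_mono) (use m in auto)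
    also have "\<dots> = 1 / ?m" by (simp add: power2_eq_square)
    also have "\<dots> \<le> 1 / c" using c0 m by (intro divide_left_mono) auto
    finally show ?thesis using m(1) by (simp add: norm_divide norm_power)
  qed
  have qM: "cmod (q n x) \<le> M * (1 / c) ^ n" for n x
    unfolding q_def norm_mult norm_power
    by (intro mult_mono M power_mono small) (use M(1) in auto)
  have bound: "nrm B (\<pi> (\<lambda>x. g x * f x ^ n)) \<le> nrm B (\<pi> g) * nrm B (\<pi> f) ^ n \<and> (\<lambda>x. g x * f x ^ n) \<in> C0 \<Omega>"
    if g: "g \<in> C0 \<Omega>" for g n
  proof (induction n)
    case 0
    then show ?case using g by simp
  next
    case (Suc n)
    have "(\<lambda>x. g x * f x ^ Suc n) = (\<lambda>x. (g x * f x ^ n) * f x)" by (simp add: mult_ac)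
    moreover have "nrm B (\<pi> (\<lambda>x. (g x * f x ^ n) * f x)) \<le> nrm B (\<pi> (\<lambda>x. g x * f x ^ n)) * nrm B (\<pi> f)"
      using Suc f pi_mult[of "\<lambda>x. g x * f x ^ n" f] nrm_mult by auto
    moreover have "\<dots> \<le> nrm B (\<pi> g) * nrm B (\<pi> f) ^ n * nrm B (\<pi> f)"
      using Suc f by (intro mult_right_mono nrm_nonneg) auto
    ultimately show ?case using Suc f by (simp add: mult_ac)
  qed
  have kq: "k x = q n x * f x ^ n" for n x
  proof (cases "cmod (f x) \<le> c")
    case True
    then show ?thesis by (simp add: q_def k_def)
  next
    case False
    then have "max (cmod (f x)) c = cmod (f x)" "f x \<noteq> 0" using c0 by auto
    then have "cnj (f x) / of_real ((max (cmod (f x)) c)\<^sup>2) * f x = 1"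
      using complex_norm_square[of "f x"] by (simp add: mult.commute)
    then show ?thesis by (simp add: q_def power_mult_distrib[symmetric] mult.assoc)
  qed
  have "nrm B (\<pi> k) \<le> 2 * M * (nrm B (\<pi> f) / c) ^ n" for n
  proof -
    have "nrm B (\<pi> k) \<le> nrm B (\<pi> (q n)) * nrm B (\<pi> f) ^ n"
      using bound[OF q, of n n] by (simp add: kq[of _ n, symmetric])
    also have "\<dots> \<le> 2 * (M * (1 / c) ^ n) * nrm B (\<pi> f) ^ n"
      using pi_bound[OF q _ qM] M c0 f nrm_nonneg[of "\<pi> f"] by (intro mult_right_mono) auto
    finally show ?thesis by (simp add: power_divide mult_ac)
  qed
  moreover have "(\<lambda>n. 2 * M * (nrm B (\<pi> f) / c) ^ n) \<longlonglongrightarrow> 2 * M * 0"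
    using c c0 f nrm_nonneg[of "\<pi> f"] by (intro Limits.tendsto_mult tendsto_const LIMSEQ_realpow_zero) auto
  ultimately have "nrm B (\<pi> k) \<le> 0" by (intro LIMSEQ_le_const) auto
  then have "\<pi> k = \<zero>" using nrm_nonneg[of "\<pi> k"] nrm_eq_0_iff[of "\<pi> k"] k by auto
  then have "k y = 0" using y k by (simp add: supp_def)
  then show False using c by (simp add: k_def)
qed

text \<open>The cut-off \<open>\<phi>\<close> keeps only the part of \<open>f\<close> where its
  modulus exceeds 2 e, which lives on a compact set disjoint from \<open>supp\<close>. On that set
  finitely many functions from the kernel of \<open>\<pi>\<close> have a sum of squares
  \<open>G\<close> without zeros, so this part is a multiple of \<open>G\<close> and is annihilated.
  The remainder has modulus at most 2 e.\<close>

lemma nrm_pi_le: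
  assumes f: "f \<in> C0 \<Omega>" and e: "e > 0" "\<And>y. y \<in> supp \<Longrightarrow> cmod (f y) \<le> e"
  shows "nrm B (\<pi> f) \<le> 4 * e"
proof -
  define \<phi> where "\<phi> w = w * complex_of_real (1 - 2 * e / max (cmod w) (2 * e))" for w
  have \<phi>c: "continuous_on UNIV \<phi>"
  proof -
    have "max (cmod w) (2 * e) \<noteq> 0" for w using e(1) by (auto simp: max_def)
    then show ?thesis unfolding \<phi>_def by (auto intro!: continuous_intros)
  qed
  have \<phi>0: "\<phi> w = 0" if "cmod w \<le> 2 * e" for w using that e by (simp add: \<phi>_def max_def)
  have \<phi>d: "cmod (w - \<phi> w) \<le> 2 * e" for w
  proof -
    have "w - \<phi> w = w * of_real (2 * e / max (cmod w) (2 * e))" by (simp add: \<phi>_def algebra_simps)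
    then have "cmod (w - \<phi> w) = cmod w * (2 * e / max (cmod w) (2 * e))"
      using e by (simp add: norm_mult norm_divide)
    also have "\<dots> \<le> max (cmod w) (2 * e) * (2 * e / max (cmod w) (2 * e))"
      using e by (intro mult_right_mono) auto
    also have "\<dots> = 2 * e" using e(1) by (cases "w = 0") (auto simp: max_def)
    finally show ?thesis .
  qed
  have k: "(\<lambda>x. \<phi> (f x)) \<in> C0 \<Omega>" using C0_compose[OF f \<phi>c] \<phi>0[of 0] e by simp
  have d: "(\<lambda>x. f x - \<phi> (f x)) \<in> C0 \<Omega>"
    using C0_add[OF f C0_scale[OF k, of "-1"]] by simp
  define K where "K = {x \<in> topspace \<Omega>. 2 * e \<le> cmod (f x)}"
  have K: "compactin \<Omega> K" unfolding K_def using C0_D(2)[OF f] e by simp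
  define Z where "Z = {g \<in> C0 \<Omega>. \<pi> g = \<zero>}"
  let ?O = "\<lambda>g. {x \<in> topspace \<Omega>. g x \<in> - {0 :: complex}}"
  have "K \<subseteq> \<Union>(?O ` Z)"
  proof
    fix x assume x: "x \<in> K"
    then have "x \<notin> supp" using e(2)[of x] e(1) by (auto simp: K_def)
    then show "x \<in> \<Union>(?O ` Z)" using x by (auto simp: supp_def K_def Z_def)
  qed
  moreover have "openin \<Omega> (?O g)" if "g \<in> Z" for g
    using that C0_D(1)[of g \<Omega>] by (intro openin_continuous_map_preimage) (auto simp: Z_def)
  ultimately obtain \<F> where \<F>: "finite \<F>" "\<F> \<subseteq> ?O ` Z" "K \<subseteq> \<Union>\<F>"
    using K unfolding compactin_def by (metis (no_types, lifting) imageE)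
  then obtain N where N: "finite N" "N \<subseteq> Z" "\<F> = ?O ` N"
    by (meson finite_subset_image)
  define G where "G x = (\<Sum>g\<in>N. cnj (g x) * g x)" for x
  have G: "G \<in> C0 \<Omega> \<and> \<pi> G = \<zero>"
    unfolding G_def using N(1,2)
  proof (induction N)
    case (insert g N)
    have g: "g \<in> C0 \<Omega>" "\<pi> g = \<zero>" using insert by (auto simp: Z_def)
    have "\<pi> (\<lambda>x. cnj (g x) * g x) = \<zero>" using g by (simp add: pi_mult)
    then show ?case using insert g pi_add[of "\<lambda>x. cnj (g x) * g x" "\<lambda>x. (\<Sum>g\<in>N. cnj (g x) * g x)"] by simp
  qed simp
  have G_real: "G x = of_real (\<Sum>g\<in>N. (cmod (g x))\<^sup>2)" for x
    unfolding G_def of_real_sum by (intro sum.cong refl) (use complex_norm_square in \<open>simp add: mult.commute\<close>)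
  have Gpos: "G x \<noteq> 0" if xK: "x \<in> K" for x
  proof -
    obtain g where g: "g \<in> N" "g x \<noteq> 0" using subsetD[OF \<F>(3) xK] N(3) by auto
    have "(cmod (g x))\<^sup>2 \<le> (\<Sum>g\<in>N. (cmod (g x))\<^sup>2)" using g N(1) by (intro member_le_sum) auto
    then have "(\<Sum>g\<in>N. (cmod (g x))\<^sup>2) > 0" by (rule less_le_trans[rotated]) (use g(2) in simp)
    then show ?thesis unfolding G_real by (metis less_irrefl of_real_eq_0_iff)
  qed
  have "\<exists>c>0. \<forall>x\<in>K. c \<le> cmod (G x)"
  proof (cases "K = {}")
    case True
    then show ?thesis by (auto intro: exI[of _ 1])
  next
    case False
    have "compact (G ` K)" using image_compactin[OF K C0_D(1)[of G]] G by simp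
    then have "compact (cmod ` G ` K)" by (intro compact_continuous_image continuous_intros)
    then obtain r where r: "r \<in> cmod ` G ` K" "\<forall>s\<in>cmod ` G ` K. r \<le> s"
      using compact_attains_inf False by (metis image_is_empty)
    then show ?thesis using Gpos by (intro exI[of _ r]) auto
  qed
  then obtain c where c: "c > 0" "\<And>x. x \<in> K \<Longrightarrow> c \<le> cmod (G x)" by blast
  define q where "q x = inverse (complex_of_real (max (cmod (G x)) c)) * \<phi> (f x)" for x
  have q: "q \<in> C0 \<Omega>"
    unfolding q_def
  proof (rule C0_mult_continuous[OF Hd k])
    show "continuous_map \<Omega> euclidean (\<lambda>x. inverse (complex_of_real (max (cmod (G x)) c)))"
    proof (rule continuous_map_compose_complex[where \<phi> = "\<lambda>w. inverse (complex_of_real (max (cmod w) c))"])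
      have "max (cmod w) c \<noteq> 0" for w using c(1) by (auto simp: max_def)
      then show "continuous_on UNIV (\<lambda>w. inverse (complex_of_real (max (cmod w) c)))"
        by (auto intro!: continuous_intros)
    qed (use G C0_D(1) in blast)
    show "cmod (inverse (complex_of_real (max (cmod (G x)) c))) \<le> inverse c" for x
      using c(1) by (simp add: norm_inverse le_imp_inverse_le)
  qed
  have "\<phi> (f x) = \<phi> (f x) * of_real (cmod (G x)) * inverse (complex_of_real (max (cmod (G x)) c))" for x
  proof (cases "x \<in> K")
    case True
    then have "max (cmod (G x)) c = cmod (G x)" using c(2) by auto
    then show ?thesis using Gpos[OF True] by simp
  next
    case False
    have "f x = 0" if "x \<notin> topspace \<Omega>" using C0_D(3)[OF f that] .
    then have "\<phi> (f x) = 0" using False \<phi>0[of "f x"] e(1) by (cases "x \<in> topspace \<Omega>") (auto simp: K_def)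
    then show ?thesis by simp
  qed
  moreover have "complex_of_real (cmod (G x)) = G x" for x
  proof -
    obtain r where r: "r = (\<Sum>g\<in>N. (cmod (g x))\<^sup>2)" by blast
    have "G x = of_real r" unfolding r by (rule G_real)
    moreover have "r \<ge> 0" unfolding r by (intro sum_nonneg) simp
    ultimately show ?thesis by simp
  qed
  ultimately have "\<phi> (f x) = G x * q x" for x
    by (simp add: q_def mult_ac)
  then have "\<pi> (\<lambda>x. \<phi> (f x)) = \<pi> G \<otimes> \<pi> q" using pi_mult[of G q] G q by simp
  then have 0: "\<pi> (\<lambda>x. \<phi> (f x)) = \<zero>" using G q by simp
  have "\<pi> f = \<pi> (\<lambda>x. f x - \<phi> (f x))"
    using pi_add[OF k d] 0 d by simp
  then show ?thesis using pi_bound[OF d _ \<phi>d] e by simp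
qed

lemma hom_lower: "hom m \<xi> F \<Longrightarrow> y \<in> supp \<Longrightarrow> cmod (F y) \<le> nrm B \<xi>"
proof -
  assume h: "hom m \<xi> F" and y: "y \<in> supp"
  have "(cmod (F y))\<^sup>2 = cmod (cnj (F y) * F y)" by (simp add: norm_mult power2_eq_square)
  also have "\<dots> \<le> (nrm B \<xi>)\<^sup>2"
    unfolding hom_nrm[OF h] using hom_C0[OF h] by (intro cmod_le_nrm_pi[OF y]) auto
  finally show ?thesis by (rule power2_le_imp_le) (use nrm_nonneg hom_closed[OF h] in auto)
qed

text \<open>The converse of \<open>hom_lower\<close> up to the factor 2: the norm of a homogeneous
  element is equivalent to the supremum of its function over \<open>supp\<close>.\<close>

lemma hom_upper:
  assumes h: "hom m \<xi> F" and e: "e > 0" "\<And>y. y \<in> supp \<Longrightarrow> cmod (F y) \<le> e"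
  shows "nrm B \<xi> \<le> 2 * e"
proof -
  have "cmod (cnj (F y) * F y) \<le> e\<^sup>2" if "y \<in> supp" for y
    using e(2)[OF that] mult_mono[of "cmod (F y)" e "cmod (F y)" e] e(1)
    by (simp add: norm_mult power2_eq_square)
  then have "(nrm B \<xi>)\<^sup>2 \<le> 4 * e\<^sup>2"
    unfolding hom_nrm[OF h] using hom_C0[OF h] e(1) by (intro nrm_pi_le) auto
  then have "(nrm B \<xi>)\<^sup>2 \<le> (2 * e)\<^sup>2" by (simp add: power_mult_distrib)
  then show ?thesis by (rule power2_le_imp_le) (use e in simp)
qed

text \<open>If \<open>\<pi> f\<close> is zero, so is its product with \<open>t F\<close> for a bump
  \<open>F\<close> at \<open>y\<close>. The function of this product has the value f(\<sigma> y) at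
  \<open>y\<close>, and \<open>hom_lower\<close> forces it to vanish.\<close>

lemma supp_\<sigma>:
  assumes y: "y \<in> supp" "y \<in> U"
  shows "\<sigma> y \<in> supp"
  unfolding supp_def
proof (intro CollectI conjI ballI impI)
  show "\<sigma> y \<in> topspace \<Omega>" using \<sigma>_topspace y by blast
  fix f assume f: "f \<in> C0 \<Omega>" "\<pi> f = \<zero>"
  obtain F where F: "F \<in> C0_U" "F y = 1"
    using C0_bump_subtopology[OF Hd lc U y(2)] by blast
  have "hom 1 (t (\<lambda>x. f (\<sigma> x) * F x)) (\<lambda>x. f (\<sigma> x) * F x)"
    using hom.t[OF C0U_lact[OF f(1) F(1)]] by simp
  moreover have "t (\<lambda>x. f (\<sigma> x) * F x) = \<zero>"
    using pi_t[OF f(1) F(1)] f(2) F(1) by simp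
  ultimately show "f (\<sigma> y) = 0" using hom_lower[of 1 _ _ y] y(1) F(2) by fastforce
qed

lemma supp_funpow: "y \<in> supp \<Longrightarrow> y \<in> dm m \<Longrightarrow> orb m y \<in> supp"
  by (induction m) (auto simp: dm_Suc intro: supp_\<sigma>)

lemma ex_hom_nonzero:
  assumes "y \<in> supp" "y \<in> dm m"
  shows "\<exists>\<xi> F. hom m \<xi> F \<and> F y \<noteq> 0"
  using assms(2)
proof (induction m)
  case 0
  then show ?case using C0_bump[OF Hd lc, of y] hom.pi by (metis dm_0 zero_neq_one)
next
  case (Suc m)
  then obtain \<xi> F where F: "hom m \<xi> F" "F y \<noteq> 0" by (auto simp: dm_Suc)
  have "orb m y \<in> U" using Suc.prems by (simp add: dm_Suc)
  then obtain H where H: "H \<in> C0_U" "H (orb m y) = 1"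
    using C0_bump_subtopology[OF Hd lc U] by blast
  show ?case using hom.t_mult[OF H(1) F(1)] H(2) F(2) by fastforce
qed

lemma C0_bump_avoiding:
  assumes y: "y \<in> topspace \<Omega>" "y \<notin> Z" "finite Z"
  shows "\<exists>f\<in>C0 \<Omega>. f y = 1 \<and> (\<forall>z\<in>Z. f z = 0)"
proof -
  have "closedin \<Omega> {z}" if "z \<in> topspace \<Omega>" for z
    using Hd that by (simp add: closedin_Hausdorff_singleton)
  then have "closedin \<Omega> (\<Union>z\<in>Z \<inter> topspace \<Omega>. {z})" using y(3) by (intro closedin_Union) auto
  then have "openin \<Omega> (topspace \<Omega> - Z)"
    by (simp add: openin_closedin_eq Diff_Diff_Int Int_commute)
  then obtain f where f: "f \<in> C0 (subtopology \<Omega> (topspace \<Omega> - Z))" "f y = 1"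
    using C0_bump_subtopology[OF Hd lc, of "topspace \<Omega> - Z" y] y by blast
  then show ?thesis using C0_subtopology[OF Hd \<open>openin \<Omega> (topspace \<Omega> - Z)\<close> f(1)] by blast
qed

lemma hom_bump:
  assumes "y \<in> supp" "y \<in> dm m" "y \<notin> Z" "finite Z"
  shows "\<exists>\<xi> F. hom m \<xi> F \<and> F y = c \<and> (\<forall>z\<in>Z. F z = 0)"
proof -
  obtain \<xi> F where F: "hom m \<xi> F" "F y \<noteq> 0" using ex_hom_nonzero assms(1,2) by blast
  obtain f where f: "f \<in> C0 \<Omega>" "f y = 1" "\<forall>z\<in>Z. f z = 0"
    using C0_bump_avoiding[OF supp_topspace] assms by blast
  show ?thesis
  proof (intro exI conjI)
    show "hom m ((c / F y) \<odot> (\<xi> \<otimes> \<pi> f)) (\<lambda>x. (c / F y) * (F x * f x))"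
      by (rule hom.scale[OF hom_mult_pi[OF F(1) f(1)]])
  qed (use F(2) f(2,3) in auto)
qed

text \<open>The function of \<open>\<xi>\<close> is small near \<open>y\<close>, and a homogeneous
  element is as small as its function, so cutting off near \<open>y\<close> is enough. The radius e
  / 2 absorbs the factor 2 of \<open>hom_upper\<close>.\<close>

lemma hom_localize:
  assumes h: "hom m \<xi> F" "F y = 0" and y: "y \<in> supp" and e: "e > 0"
  shows "\<exists>f\<in>C0 \<Omega>. f y = 1 \<and> nrm B (\<xi> \<otimes> \<pi> f) \<le> e"
proof -
  let ?W = "{x \<in> topspace \<Omega>. F x \<in> ball 0 (e/2)}"
  have W: "openin \<Omega> ?W" using C0_D(1)[OF hom_C0[OF h(1)]] by (intro openin_continuous_map_preimage) auto
  obtain f where f: "f \<in> C0 (subtopology \<Omega> ?W)" "f y = 1" "\<And>x. cmod (f x) \<le> 1"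
    using C0_bump_subtopology[OF Hd lc W, of y] h(2) e supp_topspace[OF y] by auto
  note f' = C0_subtopology[OF Hd W f(1)]
  have "cmod (F x * f x) \<le> e/2" for x
  proof (cases "x \<in> ?W")
    case True
    then have "cmod (F x) \<le> e / 2" by auto
    then show ?thesis using mult_mono[of "cmod (F x)" "e/2" "cmod (f x)" 1] f(3)[of x] e by (simp add: norm_mult)
  next
    case False
    then show ?thesis using f'(2)[of x] e by auto
  qed
  then have "nrm B (\<xi> \<otimes> \<pi> f) \<le> 2 * (e/2)"
    by (intro hom_upper[OF hom_mult_pi[OF h(1) f'(1)]]) (use e in auto)
  then show ?thesis using f' f by auto
qed

end

section \<open>Fourier coefficients\<close>

lemma sum_roots_of_unity_power:
  assumes "j < N"
  shows "(\<Sum>k<N. cis (2 * pi * real k / real N) ^ j) = (if j = 0 then of_nat N else 0)"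
proof (cases "j = 0")
  case False
  define r where "r = cis (2 * pi * real j / real N)"
  have N: "N > 0" using assms by simp
  have "cis (2 * pi * real k / real N) ^ j = r ^ k" for k
    by (simp only: r_def Complex.DeMoivre) (rule arg_cong[where f = cis], simp)
  then have "(\<Sum>k<N. cis (2 * pi * real k / real N) ^ j) = (\<Sum>k<N. r ^ k)" by simp
  moreover have "r \<noteq> 1"
  proof
    assume "r = 1"
    then have "cis (2 * pi * real j / real N) = cis (2 * pi * real 0 / real N)" by (simp add: r_def)
    then show False
      using Complex.bij_betw_roots_unity[OF N] assms False N
      by (metis bij_betw_imp_inj_on inj_onD lessThan_iff)
  qed
  moreover have "r ^ N = 1"
    using N cis_multiple_2pi[of "real j"] by (simp add: r_def Complex.DeMoivre)
  ultimately show ?thesis using False by (simp add: geometric_sum)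
qed simp

lemma sum_roots_of_unity_power_cnj:
  assumes "i < N" "j < N"
  shows "(\<Sum>k<N. cis (2 * pi * real k / real N) ^ i * cnj (cis (2 * pi * real k / real N)) ^ j)
    = (if i = j then of_nat N else 0)"
proof -
  have 1: "z ^ i * cnj z ^ j = (if j \<le> i then z ^ (i - j) else cnj (z ^ (j - i)))" if "cmod z = 1" for z
  proof -
    have zz: "z * cnj z = 1" using that complex_norm_square[of z] by simp
    show ?thesis
    proof (cases "j \<le> i")
      case True
      then have "z ^ i * cnj z ^ j = z ^ (i - j) * (z * cnj z) ^ j"
        by (simp add: power_mult_distrib flip: power_add mult.assoc)
      then show ?thesis using True zz by simp
    next
      case False
      then have "z ^ i * cnj z ^ j = cnj z ^ (j - i) * (z * cnj z) ^ i"
        by (simp add: power_mult_distrib mult_ac flip: power_add)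
      then show ?thesis using False zz by simp
    qed
  qed
  have "(\<Sum>k<N. cis (2 * pi * real k / real N) ^ i * cnj (cis (2 * pi * real k / real N)) ^ j)
      = (if j \<le> i then (\<Sum>k<N. cis (2 * pi * real k / real N) ^ (i - j))
         else cnj (\<Sum>k<N. cis (2 * pi * real k / real N) ^ (j - i)))"
    by (subst 1) (auto simp del: complex_cnj_power)
  then show ?thesis
    using sum_roots_of_unity_power[of "i - j" N] sum_roots_of_unity_power[of "j - i" N] assms
    by (auto split: if_splits)
qed

context complex_banach_algebra
begin

primrec bsum :: "nat \<Rightarrow> (nat \<Rightarrow> 'a) \<Rightarrow> 'a" where
  "bsum 0 f = \<zero>"
| "bsum (Suc n) f = bsum n f \<oplus> f n"

lemma bsum_closed [simp, intro]: "(\<And>k. f k \<in> carrier B) \<Longrightarrow> bsum n f \<in> carrier B"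
  by (induction n) auto

lemma bsum_add:
  assumes "\<And>k. f k \<in> carrier B" "\<And>k. g k \<in> carrier B"
  shows "bsum n (\<lambda>k. f k \<oplus> g k) = bsum n f \<oplus> bsum n g"
  using assms by (induction n) (simp_all add: M.a_ac)

lemma bsum_smult:
  assumes "x \<in> carrier B"
  shows "bsum n (\<lambda>k. c k \<odot> x) = (\<Sum>k<n. c k) \<odot> x"
  using assms by (induction n) (simp_all add: smult_add_left)

lemma nrm_bsum_le:
  assumes "\<And>k. f k \<in> carrier B" "\<And>k. k < n \<Longrightarrow> nrm B (f k) \<le> g k"
  shows "nrm B (bsum n f) \<le> (\<Sum>k<n. g k)"
  using assms(2)
proof (induction n)
  case (Suc n)
  then have "nrm B (bsum n f) \<le> (\<Sum>k<n. g k)" "nrm B (f n) \<le> g n" by simp_all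
  then show ?case using nrm_triangle[of "bsum n f" "f n"] assms(1) by simp
qed simp

end

context partial_homeo_toeplitz
begin

section \<open>The gauge action of the circle\<close>

lemma ex_gauge:
  assumes z: "cmod z = 1"
  shows "\<exists>\<Phi>. star_hom B B \<Phi> \<and> (\<forall>f\<in>C0 \<Omega>. \<Phi> (\<pi> f) = \<pi> f) \<and>
    (\<forall>F\<in>C0_U. \<Phi> (t F) = z \<odot> t F)"
proof -
  have zz: "cnj z * z = 1" "z * cnj z = 1"
    using z complex_norm_square[of z] by (simp_all add: mult.commute)
  have "toeplitz_representation (C0_alg \<Omega>) corr B \<pi> (\<lambda>F. z \<odot> t F)"
    unfolding toeplitz_representation_def
  proof (intro conjI ballI)
    show "star_hom (C0_alg \<Omega>) B \<pi>" using rep by (simp add: toeplitz_representation_def)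
    show "linear_map corr B (\<lambda>F. z \<odot> t F)"
      by (simp add: linear_map_def partial_homeo_corr_def t_add t_scale smult_add_right smult_smult mult.commute)
  next
    fix f F assume "f \<in> carrier (C0_alg \<Omega>)" "F \<in> carrier corr"
    then show "\<pi> f \<otimes> (z \<odot> t F) = z \<odot> t (lact corr f F)"
      by (simp add: partial_homeo_corr_def C0_alg_def smult_mult_right pi_t)
  next
    fix F G assume "F \<in> carrier corr" "G \<in> carrier corr"
    then have FG: "F \<in> C0_U" "G \<in> C0_U"
      by (auto simp: partial_homeo_corr_def)
    then have "adj B (t F) \<otimes> t G \<in> carrier B" by auto
    then show "adj B (z \<odot> t F) \<otimes> (z \<odot> t G) = \<pi> (ip corr F G)"
      using FG zz by (simp add: partial_homeo_corr_def adj_smult smult_mult_left smult_mult_right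
          smult_smult adj_t_t[symmetric])
  qed
  from universal_property[OF univ cstar_algebra_axioms this] show ?thesis
    by (simp add: C0_alg_def partial_homeo_corr_def)
qed

definition gauge :: "complex \<Rightarrow> 'b \<Rightarrow> 'b" where
  "gauge z = (SOME \<Phi>. star_hom B B \<Phi> \<and> (\<forall>f\<in>C0 \<Omega>. \<Phi> (\<pi> f) = \<pi> f) \<and>
    (\<forall>F\<in>C0_U. \<Phi> (t F) = z \<odot> t F))"

lemma gauge:
  assumes "cmod z = 1"
  shows "star_hom B B (gauge z)" "f \<in> C0 \<Omega> \<Longrightarrow> gauge z (\<pi> f) = \<pi> f"
    "F \<in> C0_U \<Longrightarrow> gauge z (t F) = z \<odot> t F"
  using someI_ex[OF ex_gauge[OF assms]] unfolding gauge_def by blast+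

lemma gauge_hom_simps:
  assumes "cmod z = 1" "x \<in> carrier B"
  shows "gauge z x \<in> carrier B" "nrm B (gauge z x) \<le> 2 * nrm B x"
    "y \<in> carrier B \<Longrightarrow> gauge z (x \<oplus> y) = gauge z x \<oplus> gauge z y"
    "y \<in> carrier B \<Longrightarrow> gauge z (x \<otimes> y) = gauge z x \<otimes> gauge z y"
    "gauge z (c \<odot> x) = c \<odot> gauge z x"
  using gauge(1)[OF assms(1)] assms(2)
    star_hom_bounded[OF cstar_algebra_axioms cstar_algebra_axioms gauge(1)[OF assms(1)] assms(2)]
  by (auto simp: star_hom_def linear_map_def)

lemma gauge_hom:
  assumes z: "cmod z = 1"
  shows "hom m \<xi> F \<Longrightarrow> gauge z \<xi> = z ^ m \<odot> \<xi>"
proof (induction rule: hom.induct)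
  case (t_mult F m \<xi> G)
  then show ?case
    by (simp add: gauge_hom_simps[OF z] gauge[OF z] smult_mult_left smult_mult_right smult_smult
        mult.commute)
qed (simp_all add: gauge_hom_simps[OF z] gauge[OF z] smult_add_right smult_smult mult.commute)

text \<open>The coefficient functions are a second argument because they are not known to be
  determined by the element; \<open>spn_coeff_bound\<close>, applied to differences, shows that
  their values on \<open>supp\<close> are.\<close>

inductive spn :: "'b \<Rightarrow> (nat \<Rightarrow> 'o \<Rightarrow> complex) \<Rightarrow> bool" where
  hom: "hom m \<xi> F \<Longrightarrow> spn \<xi> (\<lambda>n x. if n = m then F x else 0)"
| add: "spn p c \<Longrightarrow> spn q d \<Longrightarrow> spn (p \<oplus> q) (\<lambda>n x. c n x + d n x)"

lemma spn_closed [simp]: "spn p c \<Longrightarrow> p \<in> carrier B"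
  by (induction rule: spn.induct) auto

lemma spn_scale: "spn p c \<Longrightarrow> spn (k \<odot> p) (\<lambda>n x. k * c n x)"
proof (induction rule: spn.induct)
  case (hom m \<xi> F)
  have "spn (k \<odot> \<xi>) (\<lambda>n x. if n = m then k * F x else 0)"
    by (rule spn.hom[OF hom.scale[OF hom]])
  then show ?case by (simp add: if_distrib cong: if_cong)
next
  case (add p c q d)
  have "spn (k \<odot> p \<oplus> k \<odot> q) (\<lambda>n x. k * c n x + k * d n x)" by (rule spn.add) fact+
  then show ?case using add by (simp add: smult_add_right distrib_left)
qed

lemma spn_diff: "spn p c \<Longrightarrow> spn q d \<Longrightarrow> spn (p \<ominus> q) (\<lambda>n x. c n x - d n x)"
  using spn.add[OF _ spn_scale[of q d "-1"], of p c] by (simp add: minus_eq)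

lemma ex_spn_mult:
  assumes "spn p c" "spn q d"
  shows "\<exists>e. spn (p \<otimes> q) e"
  using assms
proof (induction arbitrary: q d rule: spn.induct)
  case (hom m \<xi> F)
  show ?case using hom(2)
  proof (induction rule: spn.induct)
    case (hom n \<eta> G)
    then show ?case using spn.hom[OF hom_mult[OF \<open>hom m \<xi> F\<close> hom]] by blast
  next
    case (add q d q' d')
    then show ?case using spn.add \<open>hom m \<xi> F\<close> by (fastforce simp: mult_r_distr)
  qed
next
  case (add p c p' c')
  then obtain e e' where "spn (p \<otimes> q) e" "spn (p' \<otimes> q) e'" by blast
  then show ?case using spn.add add by (fastforce simp: mult_l_distr)
qed

section \<open>Weighted averages of the gauge action over roots of unity\<close>

definition root :: "nat \<Rightarrow> nat \<Rightarrow> complex" where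
  "root N k = cis (2 * pi * real k / real N)"

lemma cmod_root [simp]: "cmod (root N k) = 1"
  by (simp add: root_def)

text \<open>A discrete form of the integral of the gauge action against a kernel on the circle. With
  the two kernels below it acts on a fixed sum of homogeneous elements as the integral would, once
  \<open>N\<close> is large.\<close>

definition avg :: "nat \<Rightarrow> (nat \<Rightarrow> complex) \<Rightarrow> 'b \<Rightarrow> 'b" where
  "avg N w p = bsum N (\<lambda>k. w k \<odot> gauge (root N k) p)"

lemma avg_closed [simp]: "p \<in> carrier B \<Longrightarrow> avg N w p \<in> carrier B"
  by (auto simp: avg_def gauge_hom_simps)

lemma avg_add: "p \<in> carrier B \<Longrightarrow> q \<in> carrier B \<Longrightarrow> avg N w (p \<oplus> q) = avg N w p \<oplus> avg N w q"
  by (simp add: avg_def gauge_hom_simps smult_add_right bsum_add)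

lemma avg_minus:
  assumes "p \<in> carrier B" "q \<in> carrier B"
  shows "avg N w (p \<ominus> q) = avg N w p \<ominus> avg N w q"
proof -
  have "(p \<ominus> q) \<oplus> q = p"
    using assms by (simp add: minus_eq M.a_assoc smult_add_left[of q "-1" 1, simplified, symmetric])
  then have "avg N w p = avg N w (p \<ominus> q) \<oplus> avg N w q" using assms avg_add[of "p \<ominus> q" q] by simp
  then show ?thesis
    using assms by (simp add: minus_eq M.a_assoc smult_add_left[of "avg N w q" 1 "-1", simplified, symmetric])
qed

lemma nrm_avg_le:
  assumes "p \<in> carrier B"
  shows "nrm B (avg N w p) \<le> (\<Sum>k<N. cmod (w k)) * (2 * nrm B p)"
  unfolding avg_def sum_distrib_right
  by (rule nrm_bsum_le)
    (use assms in \<open>auto simp: gauge_hom_simps nrm_smult intro!: mult_left_mono\<close>)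

lemma avg_hom: "hom m \<xi> F \<Longrightarrow> avg N w \<xi> = (\<Sum>k<N. w k * root N k ^ m) \<odot> \<xi>"
  by (simp add: avg_def gauge_hom smult_smult bsum_smult)

definition wcoeff :: "nat \<Rightarrow> nat \<Rightarrow> nat \<Rightarrow> complex" where
  "wcoeff n N k = cnj (root N k) ^ n / of_nat N"

lemma wcoeff_sum: "n < N \<Longrightarrow> m < N \<Longrightarrow> (\<Sum>k<N. wcoeff n N k * root N k ^ m) = (if m = n then 1 else 0)"
  using sum_roots_of_unity_power_cnj[of m N n, folded root_def]
  by (simp add: wcoeff_def mult.commute flip: sum_divide_distrib)

lemma nrm_avg_wcoeff: "p \<in> carrier B \<Longrightarrow> N > 0 \<Longrightarrow> nrm B (avg N (wcoeff n N) p) \<le> 2 * nrm B p"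
  using nrm_avg_le[of p N "wcoeff n N"] by (simp add: wcoeff_def norm_divide norm_power)

text \<open>Once \<open>N\<close> exceeds \<open>n\<close> and all degrees in \<open>p\<close>,
  distinct degrees are not congruent modulo \<open>N\<close>, and the average extracts exactly one
  of them.\<close>

lemma avg_wcoeff:
  assumes "spn p c"
  shows "\<exists>L. \<forall>N\<ge>L. hom n (avg N (wcoeff n N) p) (c n)"
  using assms
proof (induction rule: spn.induct)
  case (hom m \<xi> F)
  show ?case
  proof (intro exI[of _ "Suc (max m n)"] allI impI)
    fix N assume N: "Suc (max m n) \<le> N"
    then have "avg N (wcoeff n N) \<xi> = (if m = n then 1 else 0) \<odot> \<xi>"
      using avg_hom[OF hom] wcoeff_sum[of n N m] by simp
    then show "hom n (avg N (wcoeff n N) \<xi>) (\<lambda>x. if n = m then F x else 0)"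
      using hom hom_zero by auto
  qed
next
  case (add p c q d)
  then obtain L L' where "\<forall>N\<ge>L. hom n (avg N (wcoeff n N) p) (c n)" "\<forall>N\<ge>L'. hom n (avg N (wcoeff n N) q) (d n)" by blast
  then show ?case using add by (intro exI[of _ "max L L'"]) (auto simp: avg_add intro: hom.add)
qed

lemma spn_coeff_bound:
  assumes "spn p c" "y \<in> supp"
  shows "cmod (c n y) \<le> 2 * nrm B p"
proof -
  obtain L where L: "\<And>N. N \<ge> L \<Longrightarrow> hom n (avg N (wcoeff n N) p) (c n)" using avg_wcoeff[OF assms(1)] by blast
  have "cmod (c n y) \<le> nrm B (avg (Suc L) (wcoeff n (Suc L)) p)"
    using hom_lower[OF L assms(2)] by simp
  also have "\<dots> \<le> 2 * nrm B p" using assms(1) by (intro nrm_avg_wcoeff) auto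
  finally show ?thesis .
qed

text \<open>The Fejer kernel of order \<open>n\<close>, sampled at the roots of unity. The form as a
  squared modulus shows positivity; together with total mass 1 it bounds the means independently of
  \<open>n\<close>.\<close>

definition wfejer :: "nat \<Rightarrow> nat \<Rightarrow> nat \<Rightarrow> complex" where
  "wfejer n N k = of_real ((cmod (\<Sum>j<n. root N k ^ j))\<^sup>2 / (real n * real N))"

text \<open>Expanding the square counts the pairs (i, j) below \<open>n\<close> with j = i + m.
  There are n - m of them and none if m >= n, as truncated subtraction has it. The condition on
  \<open>N\<close> keeps i + m below \<open>N\<close>, so no further pair is congruent modulo
  \<open>N\<close>.\<close>

lemma wfejer_sum:
  assumes n: "n > 0" and N: "m + n \<le> N"
  shows "(\<Sum>k<N. wfejer n N k * root N k ^ m) = of_real (real (n - m) / real n)"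
proof -
  have N0: "N > 0" using n N by simp
  have "of_nat n * of_nat N * wfejer n N k * root N k ^ m
      = (\<Sum>i<n. \<Sum>j<n. root N k ^ (i + m) * cnj (root N k) ^ j)" for k
  proof -
    have "of_nat n * of_nat N * wfejer n N k = (\<Sum>i<n. root N k ^ i) * cnj (\<Sum>j<n. root N k ^ j)"
      using n N0 complex_norm_square[of "\<Sum>i<n. root N k ^ i"] by (simp add: wfejer_def)
    then have "of_nat n * of_nat N * wfejer n N k * root N k ^ m
       = (\<Sum>i<n. root N k ^ i) * (\<Sum>j<n. cnj (root N k) ^ j) * root N k ^ m"
      by simp
    also have "\<dots> = (\<Sum>i<n. \<Sum>j<n. root N k ^ (i + m) * cnj (root N k) ^ j)"
      by (simp only: sum_product) (simp add: sum_distrib_left power_add mult_ac)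
    finally show ?thesis .
  qed
  then have "of_nat n * of_nat N * (\<Sum>k<N. wfejer n N k * root N k ^ m)
      = (\<Sum>k<N. \<Sum>i<n. \<Sum>j<n. root N k ^ (i + m) * cnj (root N k) ^ j)"
    by (simp add: sum_distrib_left mult.assoc)
  also have "\<dots> = (\<Sum>i<n. \<Sum>j<n. \<Sum>k<N. root N k ^ (i + m) * cnj (root N k) ^ j)"
    by (subst sum.swap, rule sum.cong[OF refl], subst sum.swap, simp)
  also have "\<dots> = (\<Sum>i<n. \<Sum>j<n. if j = i + m then of_nat N else 0)"
    by (intro sum.cong refl) (use sum_roots_of_unity_power_cnj N in \<open>auto simp: root_def\<close>)
  also have "\<dots> = (\<Sum>i<n. if i < n - m then of_nat N else 0)"
    by (intro sum.cong refl) auto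
  also have "\<dots> = (\<Sum>i<n - m. of_nat N)"
    by (rule sum.mono_neutral_cong_right) auto
  finally show ?thesis using n N0 by (simp add: field_simps)
qed

lemma nrm_avg_wfejer:
  assumes "p \<in> carrier B" "n > 0" "n \<le> N"
  shows "nrm B (avg N (wfejer n N) p) \<le> 2 * nrm B p"
proof -
  have "complex_of_real (\<Sum>k<N. cmod (wfejer n N k)) = (\<Sum>k<N. wfejer n N k * root N k ^ 0)"
    by (simp add: wfejer_def norm_divide norm_mult norm_power)
  also have "\<dots> = 1" using wfejer_sum[of n 0 N] assms by simp
  finally have "(\<Sum>k<N. cmod (wfejer n N k)) = 1" by (metis of_real_eq_1_iff)
  then show ?thesis using nrm_avg_le[OF assms(1), of N "wfejer n N"] by simp
qed

lemma avg_wfejer_eq: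
  assumes "spn p c" "n > 0"
  shows "\<exists>L. \<forall>N\<ge>L. avg N (wfejer n N) p = bsum n (\<lambda>m. of_real (real (n - m) / real n) \<odot> avg N (wcoeff m N) p)"
  using assms(1)
proof (induction rule: spn.induct)
  case (hom m \<xi> F)
  show ?case
  proof (intro exI[of _ "m + n + 1"] allI impI)
    fix N assume N: "m + n + 1 \<le> N"
    have "bsum n (\<lambda>l. of_real (real (n - l) / real n) \<odot> avg N (wcoeff l N) \<xi>)
        = bsum n (\<lambda>l. (of_real (real (n - l) / real n) * (\<Sum>k<N. wcoeff l N k * root N k ^ m)) \<odot> \<xi>)"
      using avg_hom[OF hom, of N] hom by (simp add: smult_smult)
    also have "\<dots> = (\<Sum>l<n. of_real (real (n - l) / real n) * (\<Sum>k<N. wcoeff l N k * root N k ^ m)) \<odot> \<xi>"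
      using hom by (intro bsum_smult) auto
    also have "(\<Sum>l<n. of_real (real (n - l) / real n) * (\<Sum>k<N. wcoeff l N k * root N k ^ m))
       = (\<Sum>l<n. if l = m then complex_of_real (real (n - m) / real n) else 0)"
      by (intro sum.cong refl) (use N wcoeff_sum in auto)
    also have "\<dots> = of_real (real (n - m) / real n)" by auto
    also have "\<dots> \<odot> \<xi> = avg N (wfejer n N) \<xi>"
      using avg_hom[OF hom, of N] wfejer_sum[of n m N] N assms(2) by simp
    finally show "avg N (wfejer n N) \<xi> = bsum n (\<lambda>l. of_real (real (n - l) / real n) \<odot> avg N (wcoeff l N) \<xi>)" ..
  qed
next
  case (add p c q d)
  then obtain L L' where
    "\<forall>N\<ge>L. avg N (wfejer n N) p = bsum n (\<lambda>m. of_real (real (n - m) / real n) \<odot> avg N (wcoeff m N) p)"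
    "\<forall>N\<ge>L'. avg N (wfejer n N) q = bsum n (\<lambda>m. of_real (real (n - m) / real n) \<odot> avg N (wcoeff m N) q)"
    by blast
  then show ?case using add
    by (intro exI[of _ "max L L'"]) (simp add: avg_add smult_add_right bsum_add)
qed

text \<open>A Fejer mean of order \<open>n\<close> combines \<open>n\<close> coefficients with
  weights at most 1, so uniformly small coefficients make it small up to a factor proportional to
  \<open>n\<close>.\<close>

lemma avg_wfejer_small:
  assumes p: "spn p c" and n: "n > 0" and e: "e > 0" "\<And>m y. y \<in> supp \<Longrightarrow> cmod (c m y) \<le> e"
  shows "\<exists>L. \<forall>N\<ge>L. nrm B (avg N (wfejer n N) p) \<le> real n * (2 * e)"
proof -
  obtain L where L: "\<And>N. N \<ge> L \<Longrightarrow> avg N (wfejer n N) p = bsum n (\<lambda>m. of_real (real (n - m) / real n) \<odot> avg N (wcoeff m N) p)"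
    using avg_wfejer_eq[OF p n] by blast
  have "\<forall>m. \<exists>L. \<forall>N\<ge>L. hom m (avg N (wcoeff m N) p) (c m)" using avg_wcoeff[OF p] by blast
  then obtain L' where L': "\<And>m N. N \<ge> L' m \<Longrightarrow> hom m (avg N (wcoeff m N) p) (c m)" by metis
  \<comment> \<open>The sum is a common upper bound for the finitely many thresholds
    \<open>L' m\<close>.\<close>
  define M where "M = max L (\<Sum>m<n. L' m)"
  show ?thesis
  proof (intro exI[of _ M] allI impI)
    fix N assume N: "N \<ge> M"
    have "nrm B (bsum n (\<lambda>m. of_real (real (n - m) / real n) \<odot> avg N (wcoeff m N) p)) \<le> (\<Sum>m<n. 2 * e)"
    proof (rule nrm_bsum_le)
      fix m assume m: "m < n"
      have "L' m \<le> (\<Sum>m<n. L' m)" using m by (intro member_le_sum) auto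
      then have "hom m (avg N (wcoeff m N) p) (c m)" using N by (intro L') (simp add: M_def)
      then have 1: "nrm B (avg N (wcoeff m N) p) \<le> 2 * e" using e by (intro hom_upper) auto
      have "real (n - m) / real n \<le> 1" using n by simp
      then have "nrm B (of_real (real (n - m) / real n) \<odot> avg N (wcoeff m N) p) \<le> 1 * nrm B (avg N (wcoeff m N) p)"
        using p n by (simp only: nrm_smult avg_closed spn_closed norm_of_real) (intro mult_right_mono nrm_nonneg, auto)
      then show "nrm B (of_real (real (n - m) / real n) \<odot> avg N (wcoeff m N) p) \<le> 2 * e" using 1 by simp
    qed (use p in auto)
    then show "nrm B (avg N (wfejer n N) p) \<le> real n * (2 * e)" using L[of N] N by (simp add: M_def)
  qed
qed

text \<open>On degree \<open>m\<close> the mean multiplies by (n - m) / n, which leaves a relative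
  error m / n.\<close>

lemma avg_wfejer_tendsto:
  assumes "spn p c" "e > 0"
  shows "\<exists>n0>0. \<forall>n\<ge>n0. \<exists>L. \<forall>N\<ge>L. nrm B (avg N (wfejer n N) p \<ominus> p) < e"
  using assms
proof (induction arbitrary: e rule: spn.induct)
  case (hom m \<xi> F)
  obtain n1 where n1: "real m * nrm B \<xi> < real n1 * e"
    using reals_Archimedean3[OF hom(2)] by blast
  have \<xi>: "\<xi> \<in> carrier B" using hom by simp
  show ?case
  proof (rule exI[of _ "Suc (max m n1)"], intro conjI allI impI)
    fix n assume n: "Suc (max m n1) \<le> n"
    show "\<exists>L. \<forall>N\<ge>L. nrm B (avg N (wfejer n N) \<xi> \<ominus> \<xi>) < e"
    proof (intro exI[of _ "m + n"] allI impI)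
      fix N assume "m + n \<le> N"
      then have "avg N (wfejer n N) \<xi> = of_real (real (n - m) / real n) \<odot> \<xi>"
        using avg_hom[OF hom(1), of N] wfejer_sum[of n m N] n by simp
      then have "avg N (wfejer n N) \<xi> \<ominus> \<xi> = (of_real (real (n - m) / real n) - 1) \<odot> \<xi>"
        using \<xi> smult_add_left[of \<xi> "of_real (real (n - m) / real n)" "-1"] by (simp add: minus_eq)
      moreover have "complex_of_real (real (n - m) / real n) - 1 = of_real (- (real m / real n))"
        using n by (simp add: of_nat_diff field_simps)
      ultimately have "nrm B (avg N (wfejer n N) \<xi> \<ominus> \<xi>) = real m / real n * nrm B \<xi>"
        using \<xi> by (simp only: nrm_smult norm_of_real) simp
      also have "\<dots> < e"
      proof -
        have "real n1 * e \<le> real n * e" using n hom(2) by (intro mult_right_mono) auto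
        then show ?thesis using n1 n by (simp add: field_simps)
      qed
      finally show "nrm B (avg N (wfejer n N) \<xi> \<ominus> \<xi>) < e" .
    qed
  qed simp
next
  case (add p c q d)
  have "e / 2 > 0" using add.prems by simp
  from add.IH(1)[OF this] add.IH(2)[OF this] obtain n0 n0'
    where *: "n0 > 0" "\<And>n. n \<ge> n0 \<Longrightarrow> \<exists>L. \<forall>N\<ge>L. nrm B (avg N (wfejer n N) p \<ominus> p) < e / 2"
     "n0' > 0" "\<And>n. n \<ge> n0' \<Longrightarrow> \<exists>L. \<forall>N\<ge>L. nrm B (avg N (wfejer n N) q \<ominus> q) < e / 2" by blast
  show ?case
  proof (rule exI[of _ "max n0 n0'"], intro conjI allI impI)
    fix n assume "max n0 n0' \<le> n"
    then obtain L L' where L: "\<And>N. N \<ge> L \<Longrightarrow> nrm B (avg N (wfejer n N) p \<ominus> p) < e / 2"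
       "\<And>N. N \<ge> L' \<Longrightarrow> nrm B (avg N (wfejer n N) q \<ominus> q) < e / 2" using *(2)[of n] *(4)[of n] by auto
    show "\<exists>L. \<forall>N\<ge>L. nrm B (avg N (wfejer n N) (p \<oplus> q) \<ominus> (p \<oplus> q)) < e"
    proof (intro exI[of _ "max L L'"] allI impI)
      fix N assume "max L L' \<le> N"
      then show "nrm B (avg N (wfejer n N) (p \<oplus> q) \<ominus> (p \<oplus> q)) < e"
        using L(1)[of N] L(2)[of N] add.hyps
          nrm_triangle[of "avg N (wfejer n N) p \<ominus> p" "avg N (wfejer n N) q \<ominus> q"]
        by (simp add: avg_add add_minus_add)
    qed
  qed (use * in auto)
qed

section \<open>The tensor algebra as the closure of the sums of homogeneous elements\<close>

definition Aplus :: "'b set" where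
  "Aplus = closed_subalgebra B hull (\<pi> ` C0 \<Omega> \<union> t ` C0_U)"

lemma closed_subalgebra_Aplus: "closed_subalgebra B Aplus"
  unfolding Aplus_def by (rule closed_subalgebra_hull) auto

lemma Aplus_closed [simp]: "x \<in> Aplus \<Longrightarrow> x \<in> carrier B"
  using closed_subalgebra_Aplus by (auto simp: closed_subalgebra_def)

lemma Aplus_ops [simp, intro]:
  "\<zero> \<in> Aplus" "x \<in> Aplus \<Longrightarrow> y \<in> Aplus \<Longrightarrow> x \<oplus> y \<in> Aplus"
  "x \<in> Aplus \<Longrightarrow> y \<in> Aplus \<Longrightarrow> x \<otimes> y \<in> Aplus" "x \<in> Aplus \<Longrightarrow> c \<odot> x \<in> Aplus"
  using closed_subalgebra_Aplus by (auto simp: closed_subalgebra_def)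

lemma Aplus_minus [simp, intro]: "x \<in> Aplus \<Longrightarrow> y \<in> Aplus \<Longrightarrow> x \<ominus> y \<in> Aplus"
  by (simp add: minus_eq)

lemma Aplus_gen [simp]: "f \<in> C0 \<Omega> \<Longrightarrow> \<pi> f \<in> Aplus" "F \<in> C0_U \<Longrightarrow> t F \<in> Aplus"
  using hull_subset[of "\<pi> ` C0 \<Omega> \<union> t ` C0_U" "closed_subalgebra B"]
  by (auto simp: Aplus_def)

lemma hom_Aplus [simp]: "hom m \<xi> F \<Longrightarrow> \<xi> \<in> Aplus"
  by (induction rule: hom.induct) auto

lemma spn_Aplus [simp]: "spn p c \<Longrightarrow> p \<in> Aplus"
  by (induction rule: spn.induct) auto

lemma spn_approx_seq:
  assumes "a \<in> carrier B" "\<And>e. e > 0 \<Longrightarrow> \<exists>p c. spn p c \<and> nrm B (p \<ominus> a) < e"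
  shows "\<exists>p c. (\<forall>n. spn (p n) (c n)) \<and> (\<lambda>n. nrm B (p n \<ominus> a)) \<longlonglongrightarrow> 0"
proof -
  have "\<forall>n. \<exists>p c. spn p c \<and> nrm B (p \<ominus> a) < inverse (real (Suc n))" using assms(2) by simp
  then obtain p c where pc: "\<And>n. spn (p n) (c n)" "\<And>n. nrm B (p n \<ominus> a) < inverse (real (Suc n))" by metis
  have "(\<lambda>n. nrm B (p n \<ominus> a)) \<longlonglongrightarrow> 0"
    by (rule tendsto_dist_squeeze[OF _ _ _ LIMSEQ_inverse_real_of_nat])
      (use pc(2) spn_closed[OF pc(1)] assms(1) in \<open>auto simp: less_imp_le\<close>)
  then show ?thesis using pc by blast
qed

lemma Aplus_approx:
  assumes "a \<in> Aplus" "e > 0"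
  shows "\<exists>p c. spn p c \<and> nrm B (p \<ominus> a) < e"
proof -
  define L where "L = {a \<in> carrier B. \<forall>e>0. \<exists>p c. spn p c \<and> nrm B (p \<ominus> a) < e}"
  have spnL: "p \<in> L" if "spn p c" for p c
    using that by (auto simp: L_def dist_self intro!: exI[of _ p])
  have seq: "\<exists>p c. (\<forall>n. spn (p n) (c n)) \<and> (\<lambda>n. nrm B (p n \<ominus> a)) \<longlonglongrightarrow> 0" if "a \<in> L" for a
    using that by (intro spn_approx_seq) (auto simp: L_def)
  have LI: "a \<in> L" if "\<And>n. \<exists>c. spn (p n) c" "(\<lambda>n::nat. nrm B (p n \<ominus> a)) \<longlonglongrightarrow> 0" "a \<in> carrier B" for a p
    unfolding L_def
  proof (intro CollectI conjI allI impI that(3))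
    fix e :: real assume "e > 0"
    then have "\<forall>\<^sub>F n in sequentially. nrm B (p n \<ominus> a) < e" using that(2) by (intro order_tendstoD)
    then obtain n where "nrm B (p n \<ominus> a) < e" by (auto simp: eventually_sequentially)
    then show "\<exists>p c. spn p c \<and> nrm B (p \<ominus> a) < e" using that(1)[of n] by blast
  qed
  have "closed_subalgebra B L"
    unfolding closed_subalgebra_def
  proof (intro conjI ballI allI impI)
    show "L \<subseteq> carrier B" by (auto simp: L_def)
    show "\<zero> \<in> L" using spnL[OF spn.hom[OF hom_zero]] .
  next
    fix x y assume xy: "x \<in> L" "y \<in> L"
    obtain p c q d where pq: "\<And>n. spn (p n) (c n)" "(\<lambda>n. nrm B (p n \<ominus> x)) \<longlonglongrightarrow> 0"
        "\<And>n. spn (q n) (d n)" "(\<lambda>n. nrm B (q n \<ominus> y)) \<longlonglongrightarrow> 0"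
      using seq[OF xy(1)] seq[OF xy(2)] by blast
    have xy': "x \<in> carrier B" "y \<in> carrier B" using xy by (auto simp: L_def)
    have pq': "\<And>n. p n \<in> carrier B" "\<And>n. q n \<in> carrier B"
      using spn_closed[OF pq(1)] spn_closed[OF pq(3)] by blast+
    show "x \<oplus> y \<in> L"
      by (rule LI[OF _ tendsto_add[OF pq'(1) xy'(1) pq'(2) xy'(2) pq(2,4)]])
        (use pq xy' spn.add in blast)+
    show "x \<otimes> y \<in> L"
      by (rule LI[OF _ tendsto_mult[OF pq'(1) xy'(1) pq'(2) xy'(2) pq(2,4)]])
        (use pq xy' ex_spn_mult in blast)+
  next
    fix c x assume x: "x \<in> L"
    obtain p d where p: "\<And>n. spn (p n) (d n)" "(\<lambda>n. nrm B (p n \<ominus> x)) \<longlonglongrightarrow> 0" using seq[OF x] by blast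
    have x': "x \<in> carrier B" using x by (simp add: L_def)
    have p': "\<And>n. p n \<in> carrier B" using spn_closed[OF p(1)] .
    show "c \<odot> x \<in> L"
      by (rule LI[OF _ tendsto_smult[OF p' x' p(2), of c]]) (use p x' spn_scale in blast)+
  next
    fix f l assume l: "l \<in> carrier B" and f: "(\<forall>n. f n \<in> L) \<and> (\<lambda>n::nat. nrm B (f n \<ominus> l)) \<longlonglongrightarrow> 0"
    show "l \<in> L" unfolding L_def
    proof (intro CollectI conjI allI impI l)
      fix e :: real assume "e > 0"
      then have "\<forall>\<^sub>F n in sequentially. nrm B (f n \<ominus> l) < e / 2" using f by (intro order_tendstoD) auto
      then obtain n where n: "nrm B (f n \<ominus> l) < e / 2" by (auto simp: eventually_sequentially)
      have fn: "f n \<in> L" using f by blast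
      then obtain p c where p: "spn p c" "nrm B (p \<ominus> f n) < e / 2" using \<open>e > 0\<close> by (auto simp: L_def dest: spec[of _ "e / 2"])
      have "nrm B (p \<ominus> l) \<le> nrm B (p \<ominus> f n) + nrm B (f n \<ominus> l)"
        using fn l p by (intro nrm_dist_triangle) (auto simp: L_def)
      then show "\<exists>p c. spn p c \<and> nrm B (p \<ominus> l) < e" using p n by fastforce
    qed
  qed
  moreover have "\<pi> ` C0 \<Omega> \<union> t ` C0_U \<subseteq> L"
    using spnL spn.hom hom.pi hom.t by blast
  ultimately have "Aplus \<subseteq> L" unfolding Aplus_def by (rule hull_minimal[rotated])
  then show ?thesis using assms by (auto simp: L_def)
qed

lemma Aplus_approx_seq:
  "a \<in> Aplus \<Longrightarrow> \<exists>p c. (\<forall>n. spn (p n) (c n)) \<and> (\<lambda>n. nrm B (p n \<ominus> a)) \<longlonglongrightarrow> 0"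
  using spn_approx_seq Aplus_approx by simp

text \<open>On sums of homogeneous elements the coefficients are Lipschitz with constant 2, hence
  they extend to the closure. Demanding the estimate for every approximating \<open>p\<close> makes
  the value unique, so the choice made in \<open>coef\<close> is harmless.\<close>

lemma ex_coef:
  assumes a: "a \<in> Aplus" and y: "y \<in> supp"
  shows "\<exists>z. \<forall>p c. spn p c \<longrightarrow> cmod (z - c n y) \<le> 2 * nrm B (p \<ominus> a)"
proof -
  obtain q d where q: "\<And>k::nat. spn (q k) (d k)" and lim: "(\<lambda>k. nrm B (q k \<ominus> a)) \<longlonglongrightarrow> 0"
    using Aplus_approx_seq[OF a] by blast
  have diff: "cmod (d k n y - c n y) \<le> 2 * (nrm B (q k \<ominus> a) + nrm B (p \<ominus> a))" if p: "spn p c" for k p c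
  proof -
    have 1: "cmod (d k n y - c n y) \<le> 2 * nrm B (q k \<ominus> p)" using spn_coeff_bound[OF spn_diff[OF q p] y] .
    have "nrm B (q k \<ominus> p) \<le> nrm B (q k \<ominus> a) + nrm B (p \<ominus> a)"
      using nrm_dist_triangle[of "q k" a p] nrm_minus_commute[of a p] a spn_closed[OF q] p by simp
    then show ?thesis by (intro order_trans[OF 1] mult_left_mono) auto
  qed
  have "Cauchy (\<lambda>k. d k n y)"
  proof (rule metric_CauchyI)
    fix e :: real assume "e > 0"
    then have "\<forall>\<^sub>F k in sequentially. nrm B (q k \<ominus> a) < e / 4" by (intro order_tendstoD(2)[OF lim]) simp
    then obtain K where K: "\<And>k. k \<ge> K \<Longrightarrow> nrm B (q k \<ominus> a) < e / 4" by (auto simp: eventually_sequentially)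
    have "dist (d k n y) (d j n y) < e" if "k \<ge> K" "j \<ge> K" for k j
    proof -
      have "2 * (nrm B (q k \<ominus> a) + nrm B (q j \<ominus> a)) < 2 * (e / 4 + e / 4)"
        using K[OF that(1)] K[OF that(2)] by (intro mult_strict_left_mono add_strict_mono) auto
      then show ?thesis using le_less_trans[OF diff[OF q[of j], of k]] by (simp add: dist_norm)
    qed
    then show "\<exists>M. \<forall>k\<ge>M. \<forall>j\<ge>M. dist (d k n y) (d j n y) < e" by blast
  qed
  then obtain z where z: "(\<lambda>k. d k n y) \<longlonglongrightarrow> z" by (auto simp: Cauchy_convergent_iff convergent_def)
  have "cmod (z - c n y) \<le> 2 * nrm B (p \<ominus> a)" if p: "spn p c" for p c
  proof (rule LIMSEQ_le)
    show "(\<lambda>k. cmod (d k n y - c n y)) \<longlonglongrightarrow> cmod (z - c n y)" by (intro tendsto_intros z)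
    have "(\<lambda>k. 2 * (nrm B (q k \<ominus> a) + nrm B (p \<ominus> a))) \<longlonglongrightarrow> 2 * (0 + nrm B (p \<ominus> a))"
      by (intro tendsto_intros lim)
    then show "(\<lambda>k. 2 * (nrm B (q k \<ominus> a) + nrm B (p \<ominus> a))) \<longlonglongrightarrow> 2 * nrm B (p \<ominus> a)" by simp
  qed (use diff[OF p] in auto)
  then show ?thesis by blast
qed

text \<open>The default 0 off \<open>supp\<close> lets linearity and the norm bound hold at every
  point without a side condition.\<close>

definition coef :: "nat \<Rightarrow> 'o \<Rightarrow> 'b \<Rightarrow> complex" where
  "coef n y a = (if y \<in> supp then SOME z. \<forall>p c. spn p c \<longrightarrow> cmod (z - c n y) \<le> 2 * nrm B (p \<ominus> a) else 0)"

lemma coef_approx: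
  assumes "a \<in> Aplus" "y \<in> supp" "spn p c"
  shows "cmod (coef n y a - c n y) \<le> 2 * nrm B (p \<ominus> a)"
  using someI_ex[OF ex_coef[OF assms(1,2), of n]] assms(2,3) by (auto simp: coef_def)

lemma coef_spn: "spn p c \<Longrightarrow> y \<in> supp \<Longrightarrow> coef n y p = c n y"
  using coef_approx[of p y p c n] by (simp add: dist_self)

lemma coef_hom: "hom m \<xi> F \<Longrightarrow> y \<in> supp \<Longrightarrow> coef n y \<xi> = (if n = m then F y else 0)"
  using coef_spn[OF spn.hom] .

lemma coef_bound:
  assumes a: "a \<in> Aplus"
  shows "cmod (coef n y a) \<le> 2 * nrm B a"
proof (cases "y \<in> supp")
  case True
  have "spn \<zero> (\<lambda>n x. if n = 0 then 0 else 0)" by (rule spn.hom[OF hom_zero])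
  from coef_approx[OF a True this, of n] show ?thesis
    using nrm_minus_commute[of \<zero> a] a by simp
qed (use nrm_nonneg a in \<open>simp add: coef_def\<close>)

lemma coef_tendsto:
  fixes p :: "nat \<Rightarrow> 'b"
  assumes "a \<in> Aplus" "y \<in> supp" "\<And>k. spn (p k) (c k)" and lim: "(\<lambda>k. nrm B (p k \<ominus> a)) \<longlonglongrightarrow> 0"
  shows "(\<lambda>k. c k n y) \<longlonglongrightarrow> coef n y a"
proof -
  have "(\<lambda>k. coef n y a - c k n y) \<longlonglongrightarrow> 0"
    by (rule Lim_null_comparison[OF always_eventually[OF allI[OF coef_approx[OF assms(1-3)]]]])
      (use tendsto_mult_left[OF lim, of 2] in simp)
  from tendsto_diff[OF tendsto_const[of "coef n y a"] this] show ?thesis by simp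
qed

lemma coef_add:
  assumes "a \<in> Aplus" "b \<in> Aplus"
  shows "coef n y (a \<oplus> b) = coef n y a + coef n y b"
proof (cases "y \<in> supp")
  case y: True
  obtain p c q d where p: "\<And>k::nat. spn (p k) (c k)" "(\<lambda>k. nrm B (p k \<ominus> a)) \<longlonglongrightarrow> 0"
    and q: "\<And>k::nat. spn (q k) (d k)" "(\<lambda>k. nrm B (q k \<ominus> b)) \<longlonglongrightarrow> 0"
    using Aplus_approx_seq assms by metis
  have "(\<lambda>k. nrm B (p k \<oplus> q k \<ominus> (a \<oplus> b))) \<longlonglongrightarrow> 0"
    using assms by (intro tendsto_add p(2) q(2)) (auto intro: spn_closed p(1) q(1))
  then have "(\<lambda>k. c k n y + d k n y) \<longlonglongrightarrow> coef n y (a \<oplus> b)"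
    using coef_tendsto[OF _ y spn.add[OF p(1) q(1)]] assms by simp
  moreover have "(\<lambda>k. c k n y + d k n y) \<longlonglongrightarrow> coef n y a + coef n y b"
    by (intro tendsto_intros coef_tendsto[OF _ y p] coef_tendsto[OF _ y q] assms)
  ultimately show ?thesis by (rule LIMSEQ_unique)
qed (simp add: coef_def)

lemma coef_smult:
  assumes "a \<in> Aplus"
  shows "coef n y (k \<odot> a) = k * coef n y a"
proof (cases "y \<in> supp")
  case y: True
  obtain p c where p: "\<And>i::nat. spn (p i) (c i)" "(\<lambda>i. nrm B (p i \<ominus> a)) \<longlonglongrightarrow> 0"
    using Aplus_approx_seq assms by metis
  have "(\<lambda>i. nrm B (k \<odot> p i \<ominus> k \<odot> a)) \<longlonglongrightarrow> 0"
    using assms by (intro tendsto_smult p(2)) (auto intro: spn_closed p(1))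
  then have "(\<lambda>i. k * c i n y) \<longlonglongrightarrow> coef n y (k \<odot> a)"
    using coef_tendsto[OF _ y spn_scale[OF p(1)]] assms by simp
  moreover have "(\<lambda>i. k * c i n y) \<longlonglongrightarrow> k * coef n y a"
    by (intro tendsto_intros coef_tendsto[OF assms y p])
  ultimately show ?thesis by (rule LIMSEQ_unique)
qed (simp add: coef_def)

text \<open>Two approximations of \<open>a\<close> are used. The first, \<open>q\<close>, fixes an
  order \<open>n\<close> at which its Fejer mean is close to it. The second, \<open>p\<close>, is
  then taken within e / n, because its small coefficients bound its Fejer mean only up to a factor
  \<open>n\<close>. The bound on the means, uniform in \<open>n\<close>, compares the two.\<close>

lemma eq_zero_if_coef_zero:
  assumes a: "a \<in> Aplus" and zero: "\<And>n y. y \<in> supp \<Longrightarrow> coef n y a = 0"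
  shows "a = \<zero>"
proof -
  have a': "a \<in> carrier B" using a by simp
  have "nrm B a \<le> 0 + \<eta>" if "\<eta> > 0" for \<eta>
  proof -
    define e where "e = \<eta> / 12"
    have e: "e > 0" using that by (simp add: e_def)
    obtain q d where q: "spn q d" "nrm B (q \<ominus> a) < e" using Aplus_approx[OF a e] by blast
    obtain n where n: "n > 0" and "\<exists>L. \<forall>N\<ge>L. nrm B (avg N (wfejer n N) q \<ominus> q) < e"
      using avg_wfejer_tendsto[OF q(1) e] by blast
    then obtain L where L: "\<And>N. N \<ge> L \<Longrightarrow> nrm B (avg N (wfejer n N) q \<ominus> q) < e" by blast
    have en: "e / real n > 0" "e / real n \<le> e" using e n by (auto simp: field_simps)
    obtain p c where p: "spn p c" "nrm B (p \<ominus> a) < e / real n" using Aplus_approx[OF a en(1)] by blast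
    have "cmod (c m y) \<le> 2 * (e / real n)" if "y \<in> supp" for m y
      using coef_approx[OF a that p(1), of m] zero[OF that, of m] p(2) by simp
    then obtain L' where L': "\<And>N. N \<ge> L' \<Longrightarrow> nrm B (avg N (wfejer n N) p) \<le> real n * (2 * (2 * (e / real n)))"
      using avg_wfejer_small[OF p(1) n, of "2 * (e / real n)"] en by auto
    define N where "N = max n (max L L')"
    let ?T = "avg N (wfejer n N)"
    have T: "nrm B (?T q \<ominus> q) < e" "nrm B (?T p) \<le> 4 * e"
      using L[of N] L'[of N] n by (auto simp: N_def)
    have pq: "p \<in> carrier B" "q \<in> carrier B" using p q by auto
    have "nrm B (q \<ominus> p) \<le> nrm B (q \<ominus> a) + nrm B (p \<ominus> a)"
      using nrm_dist_triangle[of q a p] nrm_minus_commute[of a p] pq a' by simp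
    then have "nrm B (?T q \<ominus> ?T p) \<le> 4 * e"
      using nrm_avg_wfejer[of "q \<ominus> p" n N] pq n q(2) p(2) en by (simp add: avg_minus N_def)
    moreover have "nrm B a \<le> nrm B (q \<ominus> a) + nrm B q"
      using nrm_le_dist[of a q] nrm_minus_commute[of a q] a' pq by simp
    moreover have "nrm B q \<le> nrm B (?T q \<ominus> q) + nrm B (?T q)"
      using nrm_le_dist[of q "?T q"] nrm_minus_commute[of q "?T q"] pq by simp
    moreover have "nrm B (?T q) \<le> nrm B (?T q \<ominus> ?T p) + nrm B (?T p)"
      using nrm_le_dist[of "?T q" "?T p"] pq by simp
    ultimately have "nrm B a \<le> 12 * e" using T q(2) e by linarith
    then show ?thesis by (simp add: e_def)
  qed
  then have "nrm B a \<le> 0" by (rule field_le_epsilon)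
  then show ?thesis using nrm_nonneg[OF a'] nrm_eq_0_iff[OF a'] by simp
qed

text \<open>Additivity carries the vanishing to sums of homogeneous elements, and these are dense.
  Multiplicativity of the matrix representations and the invariance of kernels in the free case are
  reduced to homogeneous elements in this way.\<close>

lemma functional_eq_zero:
  fixes h :: "'b \<Rightarrow> complex"
  assumes a: "a \<in> Aplus"
    and add: "\<And>x y. x \<in> Aplus \<Longrightarrow> y \<in> Aplus \<Longrightarrow> h (x \<oplus> y) = h x + h y"
    and bounded: "\<And>x. x \<in> Aplus \<Longrightarrow> cmod (h x) \<le> C * nrm B x"
    and hom: "\<And>m \<xi> F. hom m \<xi> F \<Longrightarrow> h \<xi> = 0"
  shows "h a = 0"
proof -
  have spn0: "h p = 0" if "spn p c" for p c
    using that by (induction rule: spn.induct) (auto simp: hom add)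
  have "cmod (h a) \<le> 0 + e" if e: "e > 0" for e
  proof -
    define C' where "C' = \<bar>C\<bar> + 1"
    have C': "C' > 0" "C \<le> C'" by (auto simp: C'_def)
    obtain p c where p: "spn p c" "nrm B (p \<ominus> a) < e / C'"
      using Aplus_approx[OF a, of "e / C'"] e C' by auto
    have "a = p \<oplus> (a \<ominus> p)"
      using p a by (simp add: minus_eq M.a_lcomm smult_add_left[of p 1 "-1", simplified, symmetric])
    then have "h a = h p + h (a \<ominus> p)" using add[of p "a \<ominus> p"] p a by simp
    then have "cmod (h a) \<le> C * nrm B (a \<ominus> p)" using bounded[of "a \<ominus> p"] spn0[OF p(1)] a p by simp
    also have "\<dots> \<le> C' * nrm B (p \<ominus> a)"
      using C' nrm_minus_commute[of a p] a p nrm_nonneg[of "p \<ominus> a"] by (simp add: mult_right_mono)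
    also have "\<dots> \<le> C' * (e / C')" using p(2) C' by (intro mult_left_mono) auto
    finally show ?thesis using C' by simp
  qed
  then have "cmod (h a) \<le> 0" by (rule field_le_epsilon)
  then show ?thesis by simp
qed

lemma coef_eq_zero_outside_dm:
  assumes "a \<in> Aplus" "y \<notin> dm n"
  shows "coef n y a = 0"
proof (rule functional_eq_zero[OF assms(1), of _ 2])
  fix m \<xi> F assume "hom m \<xi> F"
  then show "coef n y \<xi> = 0" using coef_hom[of m \<xi> F y n] hom_dm[of m \<xi> F y] assms(2)
    by (cases "y \<in> supp") (auto simp: coef_def)
qed (auto simp: coef_add coef_bound)

end

section \<open>Matrix representations on orbits\<close>

text \<open>The zeros are real and accumulate at 0. By induction the lower coefficients vanish;
  dividing by l^n and letting \<open>l\<close> tend to 0 gives the next one.\<close>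

lemma power_series_zero:
  fixes b :: "nat \<Rightarrow> complex"
  assumes M: "\<And>m. cmod (b m) \<le> M"
    and zero: "\<And>l. 0 < l \<Longrightarrow> l < 1 \<Longrightarrow> (\<Sum>m. b m * of_real l ^ m) = 0"
  shows "b n = 0"
proof (induction n rule: less_induct)
  case (less n)
  have M0: "M \<ge> 0" using M[of 0] norm_ge_zero order_trans by blast
  have sm: "summable (\<lambda>m. b m * of_real l ^ m)" if l: "0 < l" "l < 1" for l
  proof (rule summable_comparison_test'[of "\<lambda>m. M * l ^ m" 0])
    show "summable (\<lambda>m. M * l ^ m)" using l by (intro summable_mult summable_geometric) simp
  qed (use M l in \<open>auto simp: norm_mult norm_power intro!: mult_right_mono\<close>)
  have bound: "cmod (b n) \<le> M * (l / (1 - l))" if l: "0 < l" "l < 1" for l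
  proof -
    let ?f = "\<lambda>m. b m * of_real l ^ m"
    let ?g = "\<lambda>m. b (m + Suc n) * of_real l ^ m"
    have "(\<Sum>m. ?f m) = (\<Sum>m. ?f (m + Suc n)) + (\<Sum>m<Suc n. ?f m)"
      by (rule suminf_split_initial_segment[OF sm[OF l]])
    also have "(\<Sum>m<Suc n. ?f m) = b n * of_real l ^ n" using less by simp
    finally have 1: "b n * of_real l ^ n = - (\<Sum>m. ?f (m + Suc n))" using zero[OF l] by (simp add: eq_neg_iff_add_eq_0 add.commute)
    have gs: "summable (\<lambda>m. M * l ^ Suc n * l ^ m)"
      using l by (intro summable_mult summable_geometric) simp
    have nb: "cmod (?f (m + Suc n)) \<le> M * l ^ Suc n * l ^ m" for m
      using mult_right_mono[OF M[of "m + Suc n"], of "l ^ Suc n * l ^ m"] l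
      by (simp add: norm_mult norm_power power_add mult_ac)
    have "cmod (\<Sum>m. ?f (m + Suc n)) \<le> (\<Sum>m. M * l ^ Suc n * l ^ m)"
      by (rule norm_suminf_le[OF nb gs])
    also have "\<dots> = M * l ^ Suc n * (1 / (1 - l))"
      using l by (subst suminf_mult) (auto intro!: summable_geometric simp: suminf_geometric)
    finally have "cmod (b n) * l ^ n \<le> (M * (l / (1 - l))) * l ^ n"
      using arg_cong[OF 1, of cmod] l by (simp add: norm_mult norm_power mult_ac)
    then show ?thesis by (rule mult_right_le_imp_le) (use l in simp)
  qed
  have "cmod (b n) \<le> 0 + e" if "e > 0" for e
  proof -
    \<comment> \<open>This makes l / (1 - l) equal to e / (M + e), so \<open>M\<close> times it is
      at most \<open>e\<close>; the summand 2 e keeps \<open>l\<close> below 1 even if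
      \<open>M\<close> is 0.\<close>
    define l where "l = e / (M + 2 * e)"
    have l: "0 < l" "l < 1" using that M0 by (auto simp: l_def add_nonneg_pos)
    have "1 - l = (M + e) / (M + 2 * e)" using that M0 by (simp add: l_def field_simps)
    then have eq: "l / (1 - l) = e / (M + e)" using that M0 by (simp add: l_def)
    have "M * (e / (M + e)) \<le> e" using that M0 by (simp add: field_simps)
    then have "M * (l / (1 - l)) \<le> e" by (simp only: eq)
    then show ?thesis using bound[OF l] by linarith
  qed
  then have "cmod (b n) \<le> 0" by (rule field_le_epsilon)
  then show ?case by simp
qed

context partial_homeo_toeplitz
begin

text \<open>On an aperiodic orbit at most one degree contributes. On a periodic one a whole residue
  class modulo the period does, and since the coefficients are merely bounded, the weight makes the
  series converge.\<close>

definition ent :: "real \<Rightarrow> 'o \<Rightarrow> 'o \<Rightarrow> 'b \<Rightarrow> complex" where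
  "ent l z y a = (\<Sum>m. (if orb m y = z then coef m y a else 0) * of_real l ^ m)"

text \<open>The last condition, that an orbit returning to \<open>I\<close> has not left \<open>I\<close> in between, makes the
  compression to \<open>I\<close> multiplicative.\<close>

definition admissible :: "'o set \<Rightarrow> real \<Rightarrow> bool" where
  "admissible I l \<longleftrightarrow> finite I \<and> I \<subseteq> supp \<and> 0 < l \<and> l < 1 \<and>
     (\<forall>y\<in>I. \<forall>m n. y \<in> dm (m + n) \<longrightarrow> orb (m + n) y \<in> I \<longrightarrow> orb n y \<in> I)"

definition mrep :: "'o set \<Rightarrow> real \<Rightarrow> 'b \<Rightarrow> 'o cend" where
  "mrep I l a = matr I (\<lambda>z y. ent l z y a)"

lemma norm_term_le:
  assumes "0 < l" "a \<in> Aplus"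
  shows "cmod ((if orb m y = z then coef m y a else 0) * of_real l ^ m) \<le> 2 * nrm B a * l ^ m"
proof -
  have "cmod (if orb m y = z then coef m y a else 0) \<le> 2 * nrm B a"
    using coef_bound[OF assms(2)] nrm_nonneg assms(2) by auto
  then show ?thesis using assms(1) by (auto simp: norm_mult norm_power intro!: mult_right_mono)
qed

lemma summable_bound:
  assumes "0 < l" "l < 1"
  shows "summable (\<lambda>m. 2 * nrm B a * l ^ m)" "(\<Sum>m. 2 * nrm B a * l ^ m) = 2 / (1 - l) * nrm B a"
  using assms by (auto intro!: summable_geometric summable_mult simp: suminf_mult suminf_geometric)

lemma summable_ent:
  assumes "0 < l" "l < 1" "a \<in> Aplus"
  shows "summable (\<lambda>m. (if orb m y = z then coef m y a else 0) * of_real l ^ m)"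
  by (rule summable_comparison_test'[OF summable_bound(1)[OF assms(1,2)], of 0])
    (rule norm_term_le[OF assms(1,3)])

lemma ent_bound:
  assumes "0 < l" "l < 1" "a \<in> Aplus"
  shows "cmod (ent l z y a) \<le> 2 / (1 - l) * nrm B a"
  unfolding ent_def summable_bound(2)[OF assms(1,2), symmetric]
  by (rule norm_suminf_le[OF norm_term_le[OF assms(1,3)] summable_bound(1)[OF assms(1,2)]])

lemma ent_add:
  assumes "0 < l" "l < 1" "a \<in> Aplus" "b \<in> Aplus"
  shows "ent l z y (a \<oplus> b) = ent l z y a + ent l z y b"
  unfolding ent_def
  by (subst suminf_add[OF summable_ent[OF assms(1,2,3)] summable_ent[OF assms(1,2,4)]])
    (auto simp: coef_add assms algebra_simps intro!: suminf_cong)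

lemma ent_smult:
  assumes "0 < l" "l < 1" "a \<in> Aplus"
  shows "ent l z y (c \<odot> a) = c * ent l z y a"
  unfolding ent_def
  by (subst suminf_mult[OF summable_ent[OF assms], symmetric])
    (auto simp: coef_smult assms algebra_simps intro!: suminf_cong)

lemma ent_minus:
  assumes "0 < l" "l < 1" "a \<in> Aplus" "b \<in> Aplus"
  shows "ent l z y (a \<ominus> b) = ent l z y a - ent l z y b"
  using assms by (simp add: minus_eq ent_add ent_smult)

lemma ent_hom:
  assumes "hom m \<xi> F" "y \<in> supp"
  shows "ent l z y \<xi> = (if orb m y = z then F y * of_real l ^ m else 0)"
proof -
  have "ent l z y \<xi> = (\<Sum>k. if k = m then (if orb m y = z then F y * of_real l ^ m else 0) else 0)"
    unfolding ent_def by (rule suminf_cong) (use coef_hom[OF assms] in auto)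
  also have "\<dots> = (\<Sum>k\<in>{m}. if k = m then (if orb m y = z then F y * of_real l ^ m else 0) else 0)"
    by (rule suminf_finite) auto
  finally show ?thesis by simp
qed

context
  fixes I :: "'o set" and l :: real
  assumes adm: "admissible I l"
begin

lemma adm_finite: "finite I" and adm_supp: "y \<in> I \<Longrightarrow> y \<in> supp" and adm_weight: "0 < l" "l < 1"
  and adm_convex: "y \<in> I \<Longrightarrow> y \<in> dm (m + n) \<Longrightarrow> orb (m + n) y \<in> I \<Longrightarrow> orb n y \<in> I"
  using adm unfolding admissible_def by blast+

text \<open>In the matrix product only the intermediate index \<open>orb n y\<close> can contribute.
  If both functions are nonzero along the way and the end point is \<open>z\<close>, convexity of
  \<open>I\<close> along orbits puts this index into \<open>I\<close>, so the compression loses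
  nothing.\<close>

lemma ent_mult_hom_hom:
  assumes h: "hom m \<xi> F" "hom n \<eta> G" and zy: "z \<in> I" "y \<in> I"
  shows "ent l z y (\<xi> \<otimes> \<eta>) = (\<Sum>k\<in>I. ent l z k \<xi> * ent l k y \<eta>)"
proof -
  let ?x = "orb n y"
  let ?t = "(if orb m ?x = z then F ?x * of_real l ^ m else 0) * (G y * of_real l ^ n)"
  have "(\<Sum>k\<in>I. ent l z k \<xi> * ent l k y \<eta>) = (\<Sum>k\<in>I. if k = ?x then ?t else 0)"
    by (rule sum.cong) (auto simp: ent_hom[OF h(1)] ent_hom[OF h(2)] adm_supp zy)
  also have "\<dots> = (if ?x \<in> I then ?t else 0)" using adm_finite by simp
  also have "\<dots> = ?t"
  proof (cases "?x \<in> I \<or> ?t = 0")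
    case False
    then have "F ?x \<noteq> 0" "G y \<noteq> 0" "orb m ?x = z" by (auto split: if_splits)
    then have "y \<in> dm (m + n)" "orb (m + n) y \<in> I"
      using hom_dm[OF h(1)] hom_dm[OF h(2)] zy by (auto simp: dm_add funpow_add)
    then show ?thesis using adm_convex zy(2) False by blast
  qed auto
  also have "\<dots> = ent l z y (\<xi> \<otimes> \<eta>)"
    by (simp add: ent_hom[OF hom_mult[OF h]] adm_supp zy funpow_add power_add)
  finally show ?thesis ..
qed

lemma sum_ent_bound:
  assumes "a \<in> Aplus" "b \<in> Aplus"
  shows "cmod (\<Sum>k\<in>I. ent l z k a * ent l k y b)
    \<le> real (card I) * ((2 / (1 - l) * nrm B a) * (2 / (1 - l) * nrm B b))"
proof -
  have "cmod (ent l z k a * ent l k y b) \<le> (2 / (1 - l) * nrm B a) * (2 / (1 - l) * nrm B b)" for k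
    unfolding norm_mult using adm_weight assms
    by (intro mult_mono ent_bound) (auto intro!: mult_nonneg_nonneg divide_nonneg_pos nrm_nonneg)
  then show ?thesis by (rule sum_norm_bound)
qed

text \<open>Both sides are bounded and additive in each factor, so \<open>functional_eq_zero\<close>
  extends the homogeneous case, first in the left factor and then in the right.\<close>

lemma ent_mult:
  assumes a: "a \<in> Aplus" and b: "b \<in> Aplus" and zy: "z \<in> I" "y \<in> I"
  shows "ent l z y (a \<otimes> b) = (\<Sum>k\<in>I. ent l z k a * ent l k y b)"
proof -
  let ?E = "2 / (1 - l)"
  have E: "?E \<ge> 0" using adm_weight by simp
  have bound: "cmod (ent l z y (x \<otimes> w) - (\<Sum>k\<in>I. ent l z k x * ent l k y w))
      \<le> (?E + real (card I) * (?E * ?E)) * (nrm B x * nrm B w)"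
    if "x \<in> Aplus" "w \<in> Aplus" for x w
  proof -
    have "cmod (ent l z y (x \<otimes> w)) \<le> ?E * (nrm B x * nrm B w)"
      using that by (intro order_trans[OF ent_bound[OF adm_weight] mult_left_mono[OF nrm_mult E]]) auto
    then show ?thesis
      using norm_triangle_ineq4[of "ent l z y (x \<otimes> w)" "\<Sum>k\<in>I. ent l z k x * ent l k y w"]
        sum_ent_bound[OF that, of z y] by (simp add: algebra_simps)
  qed
  have 1: "ent l z y (x \<otimes> \<eta>) - (\<Sum>k\<in>I. ent l z k x * ent l k y \<eta>) = 0"
    if \<eta>: "hom n \<eta> G" and x: "x \<in> Aplus" for x \<eta> n G
  proof (rule functional_eq_zero[OF x])
    fix m \<xi> F assume "hom m \<xi> F"
    then show "ent l z y (\<xi> \<otimes> \<eta>) - (\<Sum>k\<in>I. ent l z k \<xi> * ent l k y \<eta>) = 0"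
      using ent_mult_hom_hom[OF _ \<eta> zy] by simp
  next
    fix x assume x: "x \<in> Aplus"
    show "cmod (ent l z y (x \<otimes> \<eta>) - (\<Sum>k\<in>I. ent l z k x * ent l k y \<eta>))
      \<le> ((?E + real (card I) * (?E * ?E)) * nrm B \<eta>) * nrm B x"
      using bound[OF x, of \<eta>] \<eta> by (simp add: mult_ac)
  next
    fix x w assume "x \<in> Aplus" "w \<in> Aplus"
    then show "ent l z y ((x \<oplus> w) \<otimes> \<eta>) - (\<Sum>k\<in>I. ent l z k (x \<oplus> w) * ent l k y \<eta>)
      = ent l z y (x \<otimes> \<eta>) - (\<Sum>k\<in>I. ent l z k x * ent l k y \<eta>)
      + (ent l z y (w \<otimes> \<eta>) - (\<Sum>k\<in>I. ent l z k w * ent l k y \<eta>))"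
      using \<eta> adm_weight by (simp add: mult_l_distr ent_add sum.distrib distrib_right)
  qed
  have "ent l z y (a \<otimes> b) - (\<Sum>k\<in>I. ent l z k a * ent l k y b) = 0"
  proof (rule functional_eq_zero[OF b])
    fix m \<xi> F assume "hom m \<xi> F"
    then show "ent l z y (a \<otimes> \<xi>) - (\<Sum>k\<in>I. ent l z k a * ent l k y \<xi>) = 0" using 1 a by blast
  next
    fix x assume x: "x \<in> Aplus"
    show "cmod (ent l z y (a \<otimes> x) - (\<Sum>k\<in>I. ent l z k a * ent l k y x))
      \<le> ((?E + real (card I) * (?E * ?E)) * nrm B a) * nrm B x"
      using bound[OF a x] by (simp add: mult_ac)
  next
    fix x w assume "x \<in> Aplus" "w \<in> Aplus"
    then show "ent l z y (a \<otimes> (x \<oplus> w)) - (\<Sum>k\<in>I. ent l z k a * ent l k y (x \<oplus> w))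
      = ent l z y (a \<otimes> x) - (\<Sum>k\<in>I. ent l z k a * ent l k y x)
      + (ent l z y (a \<otimes> w) - (\<Sum>k\<in>I. ent l z k a * ent l k y w))"
      using a adm_weight by (simp add: mult_r_distr ent_add sum.distrib distrib_left)
  qed
  then show ?thesis by simp
qed

lemma mrep_mult: "a \<in> Aplus \<Longrightarrow> b \<in> Aplus \<Longrightarrow> mrep I l (a \<otimes> b) = mrep I l a * mrep I l b"
  unfolding mrep_def matr_mult[OF adm_finite] by (rule matr_eqI) (rule ent_mult)

lemma mrep_add: "a \<in> Aplus \<Longrightarrow> b \<in> Aplus \<Longrightarrow> mrep I l (a \<oplus> b) = mrep I l a + mrep I l b"
  by (simp add: mrep_def matr_add ent_add adm_weight)

lemma mrep_smult: "a \<in> Aplus \<Longrightarrow> mrep I l (c \<odot> a) = scal c * mrep I l a"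
  by (simp add: mrep_def matr_scal ent_smult adm_weight)

lemma mrep_minus: "a \<in> Aplus \<Longrightarrow> b \<in> Aplus \<Longrightarrow> mrep I l (a \<ominus> b) = mrep I l a - mrep I l b"
  by (simp add: minus_eq mrep_add mrep_smult scal_minus)

lemma entry_mrep: "entry (mrep I l a) z y = (if z \<in> I \<and> y \<in> I then ent l z y a else 0)"
  by (simp add: mrep_def entry_matr adm_finite)

lemma mrep_eq_0_iff: "mrep I l a = 0 \<longleftrightarrow> (\<forall>z\<in>I. \<forall>y\<in>I. ent l z y a = 0)"
proof
  assume "mrep I l a = 0"
  then show "\<forall>z\<in>I. \<forall>y\<in>I. ent l z y a = 0" using entry_mrep[of a] by (metis entry_simps(1))
qed (simp add: mrep_def matr_def)

text \<open>A bump at \<open>y\<close> that vanishes at the other points of \<open>I\<close>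
  isolates the column, and its value 1 / l^m cancels the weight. The function is part of the
  conclusion because \<open>kernel_invariant_of_free\<close> subtracts such elements within one
  degree.\<close>

lemma ex_mrep_munit:
  assumes "y \<in> I" "y \<in> dm m" "orb m y \<in> I"
  shows "\<exists>\<xi> F. hom m \<xi> F \<and> mrep I l \<xi> = munit (orb m y) y \<and> (\<forall>z\<in>I - {y}. F z = 0) \<and> F y * of_real l ^ m = 1"
proof -
  obtain \<xi> F where F: "hom m \<xi> F" "F y = 1 / of_real l ^ m" "\<forall>z\<in>I - {y}. F z = 0"
    using hom_bump[OF adm_supp[OF assms(1)] assms(2), of "I - {y}" "1 / of_real l ^ m"] adm_finite by blast
  have "mrep I l \<xi> = matr I (\<lambda>z y'. if z = orb m y \<and> y' = y then 1 else 0)"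
    unfolding mrep_def by (rule matr_eqI) (use F adm_weight in \<open>auto simp: ent_hom[OF F(1)] adm_supp\<close>)
  then have "mrep I l \<xi> = munit (orb m y) y" using matr_munit[OF adm_finite assms(3,1), of 1] by simp
  moreover have "F y * of_real l ^ m = 1" using F(2) adm_weight by simp
  ultimately show ?thesis using F(1,3) by blast
qed

lemma tendsto_mrep_zero:
  fixes f :: "nat \<Rightarrow> 'b"
  assumes "\<And>k. f k \<in> Aplus" "\<And>k. mrep I l (f k) = 0" "x \<in> Aplus" "(\<lambda>k. nrm B (f k \<ominus> x)) \<longlonglongrightarrow> 0"
  shows "mrep I l x = 0"
  unfolding mrep_eq_0_iff
proof (intro ballI)
  fix z y assume zy: "z \<in> I" "y \<in> I"
  have "cmod (ent l z y x) \<le> 2 / (1 - l) * nrm B (f k \<ominus> x)" for k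
  proof -
    have "ent l z y (f k) = 0" using assms(2)[of k] zy by (simp add: mrep_eq_0_iff)
    then have "ent l z y (f k \<ominus> x) = - ent l z y x" using assms adm_weight by (simp add: ent_minus)
    then show ?thesis using ent_bound[OF adm_weight, of "f k \<ominus> x" z y] assms by simp
  qed
  moreover have "(\<lambda>k. 2 / (1 - l) * nrm B (f k \<ominus> x)) \<longlonglongrightarrow> 2 / (1 - l) * 0"
    by (intro Limits.tendsto_mult tendsto_const assms(4))
  ultimately have "cmod (ent l z y x) \<le> 0" by (intro LIMSEQ_le_const) auto
  then show "ent l z y x = 0" by simp
qed

lemma ent_eq_zero_of_unreachable:
  assumes "a \<in> Aplus" "\<And>m. y \<in> dm m \<Longrightarrow> orb m y \<noteq> z"
  shows "ent l z y a = 0"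
proof -
  have "(if orb m y = z then coef m y a else 0) * of_real l ^ m = 0" for m
    using assms coef_eq_zero_outside_dm[OF assms(1), of y m] by (cases "y \<in> dm m") auto
  then show ?thesis unfolding ent_def by (simp only: suminf_zero)
qed

end

end

section \<open>Derivations and the kernels of the matrix representations\<close>

lemma sum_choose_Suc:
  fixes g :: "nat \<Rightarrow> 'r::ring_1"
  shows "(\<Sum>k\<le>Suc n. of_nat (Suc n choose k) * g k)
    = (\<Sum>k\<le>n. of_nat (n choose k) * g (Suc k)) + (\<Sum>k\<le>n. of_nat (n choose k) * g k)"
proof -
  have "(\<Sum>k\<le>Suc n. of_nat (n choose k) * g k) = g 0 + (\<Sum>k\<le>n. of_nat (n choose Suc k) * g (Suc k))"
    by (subst sum.atMost_Suc_shift) simp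
  moreover have "(\<Sum>k\<le>Suc n. of_nat (n choose k) * g k) = (\<Sum>k\<le>n. of_nat (n choose k) * g k)"
    by (simp add: binomial_eq_0[of n "Suc n"])
  moreover have "(\<Sum>k\<le>Suc n. of_nat (Suc n choose k) * g k)
     = g 0 + (\<Sum>k\<le>n. of_nat (n choose k) * g (Suc k)) + (\<Sum>k\<le>n. of_nat (n choose Suc k) * g (Suc k))"
    by (subst sum.atMost_Suc_shift) (simp add: distrib_right sum.distrib add.assoc)
  ultimately show ?thesis by (simp add: algebra_simps)
qed

context partial_homeo_toeplitz
begin

section \<open>The tensor algebra as a normed algebra on its own carrier, and its bounded linear
  maps\<close>

definition TA :: "'b normed_alg" where
  "TA = tensor_algebra (C0_alg \<Omega>) corr B \<pi> t"

lemma TA_simps [simp]: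
  "carrier TA = Aplus" "x \<otimes>\<^bsub>TA\<^esub> y = x \<otimes> y" "x \<oplus>\<^bsub>TA\<^esub> y = x \<oplus> y" "\<zero>\<^bsub>TA\<^esub> = \<zero>"
  "c \<odot>\<^bsub>TA\<^esub> x = c \<odot> x" "nrm TA x = nrm B x"
  by (simp_all add: TA_def tensor_algebra_def normed_alg.truncate_def Aplus_def C0_alg_def partial_homeo_corr_def)

text \<open>Subtraction refers to inverses within the carrier, so it has to be checked that passing
  to the smaller carrier does not change it.\<close>

lemma TA_minus: "x \<in> Aplus \<Longrightarrow> y \<in> Aplus \<Longrightarrow> x \<ominus>\<^bsub>TA\<^esub> y = x \<ominus> y"
proof -
  assume xy: "x \<in> Aplus" "y \<in> Aplus"
  have neg: "(-1) \<odot> z \<oplus> z = \<zero>" if "z \<in> carrier B" for z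
    using smult_add_left[OF that, of "-1" 1] that by simp
  interpret TA: abelian_group TA
  proof (rule abelian_groupI)
    fix z assume "z \<in> carrier TA"
    then show "\<exists>w\<in>carrier TA. w \<oplus>\<^bsub>TA\<^esub> z = \<zero>\<^bsub>TA\<^esub>"
      using neg by (intro bexI[of _ "(-1) \<odot> z"]) auto
  qed (auto simp: M.a_ac)
  have "\<ominus>\<^bsub>TA\<^esub> y = (-1) \<odot> y" using xy neg by (intro TA.minus_equality) auto
  then show ?thesis using xy by (simp add: a_minus_def[of TA] minus_eq)
qed

lemma bounded_linear_map_TA:
  assumes "bounded_linear_map TA TA D"
  shows "x \<in> Aplus \<Longrightarrow> D x \<in> Aplus" "x \<in> Aplus \<Longrightarrow> y \<in> Aplus \<Longrightarrow> D (x \<oplus> y) = D x \<oplus> D y"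
    "x \<in> Aplus \<Longrightarrow> D (c \<odot> x) = c \<odot> D x" "x \<in> Aplus \<Longrightarrow> y \<in> Aplus \<Longrightarrow> D (x \<ominus> y) = D x \<ominus> D y"
    "\<exists>K\<ge>0. \<forall>x\<in>Aplus. nrm B (D x) \<le> K * nrm B x"
proof -
  have lin: "linear_map TA TA D" and bd: "\<exists>K. \<forall>x\<in>Aplus. nrm B (D x) \<le> K * nrm B x"
    using assms by (auto simp: bounded_linear_map_def)
  show 1: "D x \<in> Aplus" if "x \<in> Aplus" for x using lin that by (auto simp: linear_map_def)
  show 2: "D (x \<oplus> y) = D x \<oplus> D y" if "x \<in> Aplus" "y \<in> Aplus" for x y
    using lin that by (auto simp: linear_map_def)
  show 3: "D (c \<odot> x) = c \<odot> D x" if "x \<in> Aplus" for x c using lin that by (auto simp: linear_map_def)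
  show "D (x \<ominus> y) = D x \<ominus> D y" if "x \<in> Aplus" "y \<in> Aplus" for x y
    using that by (simp add: minus_eq 1 2 3)
  obtain K where "\<forall>x\<in>Aplus. nrm B (D x) \<le> K * nrm B x" using bd by blast
  then have "nrm B (D x) \<le> max K 0 * nrm B x" if "x \<in> Aplus" for x
    using mult_right_mono[of K "max K 0" "nrm B x"] nrm_nonneg[of x] that by fastforce
  then show "\<exists>K\<ge>0. \<forall>x\<in>Aplus. nrm B (D x) \<le> K * nrm B x" by (intro exI[of _ "max K 0"]) auto
qed

lemma derivation_TA:
  "derivation TA D \<longleftrightarrow> bounded_linear_map TA TA D \<and>
    (\<forall>x\<in>Aplus. \<forall>y\<in>Aplus. D (x \<otimes> y) = D x \<otimes> y \<oplus> x \<otimes> D y)"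
  by (simp add: derivation_def)

context
  fixes D assumes D: "derivation TA D"
begin

lemma D_lin: "bounded_linear_map TA TA D"
  and D_mult: "x \<in> Aplus \<Longrightarrow> y \<in> Aplus \<Longrightarrow> D (x \<otimes> y) = D x \<otimes> y \<oplus> x \<otimes> D y"
  using D by (auto simp: derivation_TA)

lemmas D_closed [simp] = bounded_linear_map_TA(1)[OF D_lin]
lemmas D_add = bounded_linear_map_TA(2)[OF D_lin]
lemmas D_smult = bounded_linear_map_TA(3)[OF D_lin]
lemmas D_minus = bounded_linear_map_TA(4)[OF D_lin]
lemmas D_bounded = bounded_linear_map_TA(5)[OF D_lin]

lemma D_funpow_closed [simp]: "x \<in> Aplus \<Longrightarrow> (D ^^ k) x \<in> Aplus"
  by (induction k) auto

lemma D_funpow_add: "x \<in> Aplus \<Longrightarrow> y \<in> Aplus \<Longrightarrow> (D ^^ k) (x \<oplus> y) = (D ^^ k) x \<oplus> (D ^^ k) y"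
  by (induction k) (auto simp: D_add)

context
  fixes I l assumes adm: "admissible I l"
begin

text \<open>The rule is stated after applying \<open>mrep\<close>, because the ring of endomorphisms
  provides finite sums and binomial coefficients.\<close>

lemma mrep_leibniz:
  assumes "x \<in> Aplus" "y \<in> Aplus"
  shows "mrep I l ((D ^^ n) (x \<otimes> y))
    = (\<Sum>k\<le>n. of_nat (n choose k) * (mrep I l ((D ^^ k) x) * mrep I l ((D ^^ (n - k)) y)))"
  using assms
proof (induction n arbitrary: x y)
  case 0
  then show ?case by (simp add: mrep_mult[OF adm])
next
  case (Suc n)
  define g where "g k = mrep I l ((D ^^ k) x) * mrep I l ((D ^^ (Suc n - k)) y)" for k
  have "mrep I l ((D ^^ Suc n) (x \<otimes> y)) = mrep I l ((D ^^ n) (D x \<otimes> y)) + mrep I l ((D ^^ n) (x \<otimes> D y))"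
    using Suc.prems by (simp add: funpow_swap1 D_mult D_funpow_add mrep_add[OF adm])
  also have "\<dots> = (\<Sum>k\<le>n. of_nat (n choose k) * g (Suc k)) + (\<Sum>k\<le>n. of_nat (n choose k) * g k)"
  proof -
    have "(D ^^ k) (D w) = (D ^^ Suc k) w" for k w by (simp add: funpow_swap1)
    then show ?thesis using Suc by (simp add: g_def Suc_diff_le del: funpow.simps)
  qed
  also have "\<dots> = (\<Sum>k\<le>Suc n. of_nat (Suc n choose k) * g k)" by (rule sum_choose_Suc[symmetric])
  finally show ?case by (simp only: g_def)
qed

text \<open>The power \<open>x ^ (n + 1)\<close>, as there is no unit.\<close>

primrec pw :: "'b \<Rightarrow> nat \<Rightarrow> 'b" where
  "pw x 0 = x"
| "pw x (Suc n) = x \<otimes> pw x n"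

lemma pw_closed [simp]: "x \<in> Aplus \<Longrightarrow> pw x n \<in> Aplus"
  by (induction n) auto

lemma nrm_pw: "x \<in> Aplus \<Longrightarrow> nrm B (pw x n) \<le> nrm B x ^ Suc n"
proof (induction n)
  case (Suc n)
  then have "nrm B (x \<otimes> pw x n) \<le> nrm B x * nrm B (pw x n)" by (intro nrm_mult) auto
  also have "\<dots> \<le> nrm B x * nrm B x ^ Suc n" using Suc by (intro mult_left_mono nrm_nonneg) auto
  finally show ?case by simp
qed simp

text \<open>In the Leibniz expansion for the product of \<open>x\<close> and \<open>pw x n\<close>,
  the term with k = 0 vanishes because \<open>x\<close> is in the kernel, and terms leaving at most
  \<open>n\<close> derivatives for \<open>pw x n\<close> vanish by induction. With n + 2 derivatives
  only k = 1 survives, and its binomial coefficient builds up the factorial.\<close>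

lemma mrep_derivation_pw:
  assumes x: "x \<in> Aplus" "mrep I l x = 0"
  shows "(\<forall>k\<le>n. mrep I l ((D ^^ k) (pw x n)) = 0) \<and>
    mrep I l ((D ^^ Suc n) (pw x n)) = of_nat (fact (Suc n)) * mrep I l (D x) ^ Suc n"
proof (induction n)
  case 0
  then show ?case using x by simp
next
  case (Suc n)
  have step: "mrep I l ((D ^^ j) (pw x (Suc n))) =
      (\<Sum>k\<le>j. of_nat (j choose k) * (mrep I l ((D ^^ k) x) * mrep I l ((D ^^ (j - k)) (pw x n))))" for j
    using mrep_leibniz[of x "pw x n" j] x by simp
  have small: "mrep I l ((D ^^ k) x) * mrep I l ((D ^^ (j - k)) (pw x n)) = 0"
    if "k = 0 \<or> j - k \<le> n" for j k
    using that Suc x by auto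
  have "mrep I l ((D ^^ j) (pw x (Suc n))) = 0" if "j \<le> Suc n" for j
  proof -
    have "k = 0 \<or> j - k \<le> n" for k using that by auto
    then show ?thesis unfolding step using small by (intro sum.neutral) simp
  qed
  moreover have "mrep I l ((D ^^ Suc (Suc n)) (pw x (Suc n)))
     = of_nat (fact (Suc (Suc n))) * mrep I l (D x) ^ Suc (Suc n)"
  proof -
    have "mrep I l ((D ^^ Suc (Suc n)) (pw x (Suc n)))
       = (\<Sum>k\<le>Suc (Suc n). if k = 1 then of_nat (Suc (Suc n)) * (mrep I l (D x) * mrep I l ((D ^^ Suc n) (pw x n))) else 0)"
      unfolding step
    proof (rule sum.cong[OF refl])
      fix k
      show "of_nat (Suc (Suc n) choose k) * (mrep I l ((D ^^ k) x) * mrep I l ((D ^^ (Suc (Suc n) - k)) (pw x n)))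
        = (if k = 1 then of_nat (Suc (Suc n)) * (mrep I l (D x) * mrep I l ((D ^^ Suc n) (pw x n))) else 0)"
      proof (cases "k = 1")
        case False
        then have "k = 0 \<or> Suc (Suc n) - k \<le> n" by auto
        then show ?thesis using small[of k "Suc (Suc n)"] False by (simp del: funpow.simps)
      qed simp
    qed
    also have "\<dots> = of_nat (Suc (Suc n)) * (mrep I l (D x) * mrep I l ((D ^^ Suc n) (pw x n)))"
      by (subst sum.delta) auto
    also have "\<dots> = of_nat (Suc (Suc n)) * (of_nat (fact (Suc n)) * (mrep I l (D x) * mrep I l (D x) ^ Suc n))"
    proof -
      have comm: "S * (of_nat j * T) = of_nat j * (S * T)" for S T :: "'o cend" and j
        by (metis mult.assoc mult_of_nat_commute)
      show ?thesis by (simp only: Suc[THEN conjunct2] comm[of "mrep I l (D x)"])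
    qed
    finally show ?thesis by (simp only: fact_Suc[of "Suc n"] of_nat_mult of_nat_id power_Suc mult.assoc)
  qed
  ultimately show ?case by blast
qed

lemma entry_of_nat_mult [simp]: "entry (of_nat n * T) z y = of_nat n * entry T z y"
  by (induction n) (simp_all add: distrib_right)

text \<open>Sinclair's argument: a bounded derivation maps the kernel to quasinilpotents modulo the
  kernel, and a nonzero ideal of a full matrix algebra contains a nonzero idempotent.\<close>

lemma kernel_invariant_of_full:
  assumes full: "\<And>z y. z \<in> I \<Longrightarrow> y \<in> I \<Longrightarrow> \<exists>m. y \<in> dm m \<and> orb m y = z"
    and a: "a \<in> Aplus" "mrep I l a = 0"
  shows "mrep I l (D a) = 0"
  unfolding mrep_eq_0_iff[OF adm]
proof (intro ballI, rule ccontr)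
  fix i j assume ij: "i \<in> I" "j \<in> I" and nz: "ent l i j (D a) \<noteq> 0"
  note l = adm_weight[OF adm] and fin = adm_finite[OF adm]
  obtain m where m: "i \<in> dm m" "orb m i = j" using full[OF ij(2,1)] by blast
  obtain e F where e: "hom m e F" "mrep I l e = munit j i"
    using ex_mrep_munit[OF adm ij(1) m(1)] m(2) ij by auto
  have e': "e \<in> Aplus" using e by simp
  \<comment> \<open>As \<open>a\<close> is in the kernel, D(e a) agrees with e D(a) modulo it.
    Multiplying by \<open>e\<close> moves row \<open>i\<close> of the image of \<open>D a\<close> to
    row \<open>j\<close>, and the scalar makes the entry at (j, j) equal to 1. A matrix with this
    single row is idempotent.\<close>
  define x where "x = (1 / ent l i j (D a)) \<odot> (e \<otimes> a)"
  have x: "x \<in> Aplus" using e' a by (simp add: x_def)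
  have x0: "mrep I l x = 0" using e' a by (simp add: x_def mrep_smult[OF adm] mrep_mult[OF adm])
  have Dx: "mrep I l (D x) = scal (1 / ent l i j (D a)) * (munit j i * mrep I l (D a))"
    using e' a e by (simp add: x_def D_smult D_mult mrep_smult[OF adm] mrep_mult[OF adm] mrep_add[OF adm])
  have row: "munit j i * matr I m' = (\<Sum>y\<in>I. scal (m' i y) * munit j y)" for m'
  proof -
    have "munit j i * matr I m' = (\<Sum>z\<in>I. if z = i then \<Sum>y\<in>I. scal (m' i y) * munit j y else 0)"
      unfolding matr_def sum_distrib_left
      by (rule sum.cong[OF refl]) (auto simp: scal_left_commute munit_mult)
    then show ?thesis using fin ij by simp
  qed
  define T where "T = mrep I l (D x)"
  have T: "T = (\<Sum>y\<in>I. scal (ent l i y (D a) / ent l i j (D a)) * munit j y)"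
    unfolding T_def Dx unfolding mrep_def row sum_distrib_left
    by (simp add: scal_mult[symmetric] mult.assoc[symmetric])
  have TT: "T * T = T"
  proof -
    have "T * munit j y = munit j y" for y
    proof -
      have "T * munit j y = (\<Sum>y'\<in>I. if y' = j then munit j y else 0)"
        unfolding T sum_distrib_right
        by (rule sum.cong[OF refl]) (use nz in \<open>auto simp: mult.assoc munit_mult\<close>)
      then show ?thesis using fin ij by simp
    qed
    then have "T * (\<Sum>y\<in>I. scal (c y) * munit j y) = (\<Sum>y\<in>I. scal (c y) * munit j y)" for c
      unfolding sum_distrib_left by (intro sum.cong refl) (simp add: scal_left_commute)
    then show ?thesis using T by simp
  qed
  have Tn: "T ^ Suc n = T" for n by (induction n) (simp_all add: TT)
  have Tjj: "entry T j j = 1"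
  proof -
    have "entry T j j = (\<Sum>y\<in>I. if y = j then 1 else 0)"
      unfolding T entry_sum by (rule sum.cong[OF refl]) (use nz in auto)
    then show ?thesis using fin ij by simp
  qed
  obtain K where K: "K \<ge> 0" "\<And>x. x \<in> Aplus \<Longrightarrow> nrm B (D x) \<le> K * nrm B x" using D_bounded by blast
  have Kn: "nrm B ((D ^^ n) w) \<le> K ^ n * nrm B w" if "w \<in> Aplus" for n w
  proof (induction n)
    case (Suc n)
    have "nrm B ((D ^^ Suc n) w) \<le> K * nrm B ((D ^^ n) w)" using K(2) that by simp
    also have "\<dots> \<le> K * (K ^ n * nrm B w)" using Suc K(1) by (rule mult_left_mono)
    finally show ?case by simp
  qed simp
  define r where "r = K * nrm B x"
  \<comment> \<open>All powers of the idempotent \<open>T\<close> have entry 1 at (j, j), so the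
    factorial is bounded by a constant times a power of \<open>r\<close>, against the convergence of
    the exponential series.\<close>
  have fact_le: "fact (Suc n) \<le> 2 / (1 - l) * r ^ Suc n" for n
  proof -
    have "entry (mrep I l ((D ^^ Suc n) (pw x n))) j j = of_nat (fact (Suc n)) * entry (T ^ Suc n) j j"
      using mrep_derivation_pw[OF x x0, of n] by (simp only: T_def entry_of_nat_mult)
    then have "ent l j j ((D ^^ Suc n) (pw x n)) = fact (Suc n)"
      by (simp only: Tn Tjj entry_mrep[OF adm] of_nat_fact mult_1_right ij simp_thms if_True)
    then have "fact (Suc n) \<le> 2 / (1 - l) * nrm B ((D ^^ Suc n) (pw x n))"
      using ent_bound[OF l, of "(D ^^ Suc n) (pw x n)" j j] x
      by (simp only: D_funpow_closed pw_closed norm_fact)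
    also have "\<dots> \<le> 2 / (1 - l) * (K ^ Suc n * nrm B x ^ Suc n)"
    proof (rule mult_left_mono)
      have "nrm B ((D ^^ Suc n) (pw x n)) \<le> K ^ Suc n * nrm B (pw x n)" using Kn x by (simp only: pw_closed)
      also have "\<dots> \<le> K ^ Suc n * nrm B x ^ Suc n" using nrm_pw[OF x] K(1) by (intro mult_left_mono) auto
      finally show "nrm B ((D ^^ Suc n) (pw x n)) \<le> K ^ Suc n * nrm B x ^ Suc n" .
    qed (use l in simp)
    finally show ?thesis by (simp only: r_def power_mult_distrib)
  qed
  have "(\<lambda>n. inverse (fact n) * r ^ n) \<longlonglongrightarrow> 0" by (rule summable_LIMSEQ_zero[OF summable_exp])
  then have "(\<lambda>n. 2 / (1 - l) * (inverse (fact (Suc n)) * r ^ Suc n)) \<longlonglongrightarrow> 2 / (1 - l) * 0"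
    by (intro Limits.tendsto_mult tendsto_const LIMSEQ_Suc)
  moreover have "1 \<le> 2 / (1 - l) * (inverse (fact (Suc n)) * r ^ Suc n)" for n
  proof -
    have "(1::real) = inverse (fact (Suc n)) * fact (Suc n)" by (simp del: fact_Suc)
    also have "\<dots> \<le> inverse (fact (Suc n)) * (2 / (1 - l) * r ^ Suc n)"
      using fact_le[of n] by (intro mult_left_mono) auto
    finally show ?thesis by (simp only: mult_ac)
  qed
  ultimately have "(1::real) \<le> 0" by (intro LIMSEQ_le_const[of _ _ 1]) auto
  then show False by simp
qed

text \<open>If the function of an element vanishes at \<open>y\<close>, \<open>hom_localize\<close>
  makes its product with some \<open>\<pi> f\<close>, f(y) = 1, arbitrarily small, while column
  \<open>y\<close> of the image of the derivative stays the same; since \<open>D\<close> is bounded,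
  this column is zero. Otherwise \<open>orb m y\<close> lies outside \<open>I\<close>, and
  multiplying on the left by a function with value 1 at \<open>z\<close> and 0 at
  \<open>orb m y\<close> leads back to the first case.\<close>

lemma derivation_homogeneous_kernel:
  assumes h: "hom m \<xi> F" and ker: "mrep I l \<xi> = 0"
  shows "mrep I l (D \<xi>) = 0"
proof -
  note l = adm_weight[OF adm] and fin = adm_finite[OF adm]
  have vanish: "ent l z y (D \<eta>) = 0"
    if \<eta>: "hom m \<eta> G" "mrep I l \<eta> = 0" "G y = 0" and zy: "z \<in> I" "y \<in> I" for \<eta> G z y
  proof -
    obtain K where K: "K \<ge> 0" "\<And>x. x \<in> Aplus \<Longrightarrow> nrm B (D x) \<le> K * nrm B x" using D_bounded by blast
    have "cmod (ent l z y (D \<eta>)) \<le> 0 + e" if e: "e > 0" for e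
    proof -
      define e' where "e' = e / (2 / (1 - l) * (K + 1))"
      have c: "2 / (1 - l) * (K + 1) > 0" using l K(1) by simp
      have e': "e' > 0" unfolding e'_def by (rule divide_pos_pos[OF e c])
      obtain f where f: "f \<in> C0 \<Omega>" "f y = 1" "nrm B (\<eta> \<otimes> \<pi> f) \<le> e'"
        using hom_localize[OF \<eta>(1,3) adm_supp[OF adm zy(2)] e'] by blast
      have A: "\<eta> \<in> Aplus" "\<pi> f \<in> Aplus" using \<eta> f by auto
      have "ent l z y (D (\<eta> \<otimes> \<pi> f)) = ent l z y (D \<eta> \<otimes> \<pi> f) + ent l z y (\<eta> \<otimes> D (\<pi> f))"
        using A l by (simp add: D_mult ent_add)
      also have "ent l z y (\<eta> \<otimes> D (\<pi> f)) = 0"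
        using \<eta>(2) zy A by (simp add: ent_mult[OF adm] mrep_eq_0_iff[OF adm])
      also have "ent l z y (D \<eta> \<otimes> \<pi> f) = (\<Sum>k\<in>I. if k = y then ent l z y (D \<eta>) else 0)"
        using A zy f(2) by (simp add: ent_mult[OF adm])
          (auto simp: ent_hom[OF hom.pi[OF f(1)]] adm_supp[OF adm] intro!: sum.cong)
      also have "\<dots> = ent l z y (D \<eta>)" using fin zy by simp
      finally have "cmod (ent l z y (D \<eta>)) \<le> 2 / (1 - l) * nrm B (D (\<eta> \<otimes> \<pi> f))"
        using ent_bound[OF l, of "D (\<eta> \<otimes> \<pi> f)" z y] A by simp
      also have "\<dots> \<le> 2 / (1 - l) * ((K + 1) * e')"
      proof (rule mult_left_mono)
        have "nrm B (D (\<eta> \<otimes> \<pi> f)) \<le> K * nrm B (\<eta> \<otimes> \<pi> f)" using K A by simp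
        also have "\<dots> \<le> (K + 1) * e'" using K(1) f(3) A by (intro mult_mono nrm_nonneg) auto
        finally show "nrm B (D (\<eta> \<otimes> \<pi> f)) \<le> (K + 1) * e'" .
      qed (use l in simp)
      also have "\<dots> = (2 / (1 - l) * (K + 1)) * e'" by (simp only: mult.assoc)
      also have "\<dots> = e"
        unfolding e'_def times_divide_eq_right
        by (rule nonzero_mult_div_cancel_left[OF less_imp_neq[OF c, symmetric]])
      finally show ?thesis by simp
    qed
    then have "cmod (ent l z y (D \<eta>)) \<le> 0" by (rule field_le_epsilon)
    then show ?thesis by simp
  qed
  show ?thesis unfolding mrep_eq_0_iff[OF adm]
  proof (intro ballI)
    fix z y assume zy: "z \<in> I" "y \<in> I"
    show "ent l z y (D \<xi>) = 0"
    proof (cases "F y = 0")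
      case True
      then show ?thesis using vanish[OF h ker _ zy] by blast
    next
      case False
      let ?x = "orb m y"
      have "?x \<notin> I"
      proof
        assume x: "?x \<in> I"
        then have "ent l ?x y \<xi> = 0" using ker zy by (simp add: mrep_eq_0_iff[OF adm])
        then show False using False l ent_hom[OF h adm_supp[OF adm zy(2)], of l ?x] by simp
      qed
      then have "z \<notin> {?x}" using zy by auto
      then obtain f where f: "f \<in> C0 \<Omega>" "f z = 1" "f ?x = 0"
        using C0_bump_avoiding[OF supp_topspace[OF adm_supp[OF adm zy(1)]], of "{?x}"] by auto
      have A: "\<xi> \<in> Aplus" "\<pi> f \<in> Aplus" using h f by auto
      have "ent l z y (D (\<pi> f \<otimes> \<xi>)) = 0"
        by (rule vanish[OF hom_pi_mult[OF h f(1)] _ _ zy])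
          (use A ker f in \<open>simp_all add: mrep_mult[OF adm]\<close>)
      moreover have "ent l z y (D (\<pi> f \<otimes> \<xi>)) = ent l z y (D (\<pi> f) \<otimes> \<xi>) + ent l z y (\<pi> f \<otimes> D \<xi>)"
        using A l by (simp add: D_mult ent_add)
      moreover have "ent l z y (D (\<pi> f) \<otimes> \<xi>) = 0"
        using ker zy A by (simp add: ent_mult[OF adm] mrep_eq_0_iff[OF adm])
      moreover have "ent l z y (\<pi> f \<otimes> D \<xi>) = (\<Sum>k\<in>I. if k = z then ent l z y (D \<xi>) else 0)"
        using A zy f(2) by (simp add: ent_mult[OF adm])
          (auto simp: ent_hom[OF hom.pi[OF f(1)]] adm_supp[OF adm] intro!: sum.cong)
      ultimately show ?thesis using fin zy by simp
    qed
  qed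
qed

text \<open>By freeness a matrix position determines the degree. A homogeneous element is therefore,
  modulo homogeneous elements of the kernel, a combination of those \<open>E p\<close> that have its
  own degree. Over a cycle \<open>E p\<close> could have another degree, and the difference would
  not be homogeneous.\<close>

lemma kernel_invariant_of_free:
  assumes free: "\<And>y m m'. y \<in> I \<Longrightarrow> y \<in> dm m \<Longrightarrow> y \<in> dm m' \<Longrightarrow> orb m y = orb m' y \<Longrightarrow> orb m y \<in> I \<Longrightarrow> m = m'"
    and a: "a \<in> Aplus" "mrep I l a = 0"
  shows "mrep I l (D a) = 0"
proof -
  note l = adm_weight[OF adm] and fin = adm_finite[OF adm]
  define R where "R = {(z, y). z \<in> I \<and> y \<in> I \<and> (\<exists>m. y \<in> dm m \<and> orb m y = z)}"
  have "R \<subseteq> I \<times> I" by (auto simp: R_def)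
  then have finR: "finite R" using fin finite_subset by blast
  have "\<forall>p\<in>R. \<exists>\<xi> F. \<exists>m. snd p \<in> dm m \<and> orb m (snd p) = fst p \<and> hom m \<xi> F \<and> mrep I l \<xi> = munit (fst p) (snd p) \<and>
      (\<forall>z\<in>I - {snd p}. F z = 0) \<and> F (snd p) * of_real l ^ m = 1"
    using ex_mrep_munit[OF adm] unfolding R_def by fastforce
  then obtain E F M where E: "\<And>p. p \<in> R \<Longrightarrow> snd p \<in> dm (M p) \<and> orb (M p) (snd p) = fst p \<and> hom (M p) (E p) (F p) \<and>
      mrep I l (E p) = munit (fst p) (snd p) \<and> (\<forall>z\<in>I - {snd p}. F p z = 0) \<and> F p (snd p) * of_real l ^ M p = 1"
    by metis
  have EA: "E p \<in> Aplus" if "p \<in> R" for p using E[OF that] by (meson hom_Aplus)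
  have entE: "ent l z y (E p) = (if p = (z, y) then 1 else 0)" if "p \<in> R" "z \<in> I" "y \<in> I" for p z y
  proof -
    have "ent l z y (E p) = entry (munit (fst p) (snd p)) z y"
      using E[OF that(1)] entry_mrep[OF adm, of "E p" z y] that by simp
    then show ?thesis by (cases p) auto
  qed
  have "ent l w v (D a) = 0" if wv: "w \<in> I" "v \<in> I" for w v
  proof -
    \<comment> \<open>This measures how far the entry (w, v) of \<open>D x\<close> is from being a
      function of the image of \<open>x\<close>. It vanishes on homogeneous elements, hence
      everywhere; at \<open>a\<close>, whose image is zero, that is the claim.\<close>
    define h where "h x = ent l w v (D x) - (\<Sum>p\<in>R. ent l (fst p) (snd p) x * ent l w v (D (E p)))" for x
    have hadd: "h (x \<oplus> y) = h x + h y" if "x \<in> Aplus" "y \<in> Aplus" for x y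
      using that l by (simp add: h_def D_add ent_add sum.distrib distrib_right)
    have hsm: "h (c \<odot> x) = c * h x" if "x \<in> Aplus" for x c
      using that l by (simp add: h_def D_smult ent_smult sum_distrib_left right_diff_distrib mult.assoc)
    have hE: "h (E q) = 0" if q: "q \<in> R" for q
    proof -
      have "(\<Sum>p\<in>R. ent l (fst p) (snd p) (E q) * ent l w v (D (E p))) = (\<Sum>p\<in>R. if p = q then ent l w v (D (E q)) else 0)"
      proof (rule sum.cong[OF refl])
        fix p assume "p \<in> R"
        then have "fst p \<in> I" "snd p \<in> I" by (auto simp: R_def)
        then show "ent l (fst p) (snd p) (E q) * ent l w v (D (E p)) = (if p = q then ent l w v (D (E q)) else 0)"
          using entE[OF q, of "fst p" "snd p"] by auto
      qed
      then show ?thesis using finR q by (simp add: h_def)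
    qed
    have hhom: "h \<xi> = 0" if "hom m \<xi> G" for m \<xi> G
      using that
    \<comment> \<open>Induction on the number of nonzero entries in the image of
      \<open>\<xi>\<close>: subtracting a multiple of one \<open>E p\<close> removes exactly one of
      them.\<close>
    proof (induction "card {y \<in> I. G y \<noteq> 0 \<and> orb m y \<in> I}" arbitrary: \<xi> G)
      case 0
      then have none: "\<And>y. y \<in> I \<Longrightarrow> G y = 0 \<or> orb m y \<notin> I" using fin by auto
      have "mrep I l \<xi> = 0"
        unfolding mrep_eq_0_iff[OF adm] using none ent_hom[OF 0(2)] adm_supp[OF adm] by fastforce
      then have "mrep I l (D \<xi>) = 0" "\<And>z y. z \<in> I \<Longrightarrow> y \<in> I \<Longrightarrow> ent l z y \<xi> = 0"
        using derivation_homogeneous_kernel[OF 0(2)] by (auto simp: mrep_eq_0_iff[OF adm])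
      then show ?case using wv by (auto simp: h_def mrep_eq_0_iff[OF adm] R_def intro!: sum.neutral)
    next
      case (Suc n)
      then have "{y \<in> I. G y \<noteq> 0 \<and> orb m y \<in> I} \<noteq> {}" by (metis card.empty nat.distinct(1))
      then obtain y where y: "y \<in> I" "G y \<noteq> 0" "orb m y \<in> I" by blast
      let ?p = "(orb m y, y)"
      have ym: "y \<in> dm m" by (rule hom_dm[OF Suc(3) y(2)])
      have p: "?p \<in> R" using y ym by (auto simp: R_def)
      have Mp: "M ?p = m" using free[of y "M ?p" m] E[OF p] y ym by simp
      define k where "k = - G y * of_real l ^ m"
      have hE': "hom m (E ?p) (F ?p)" using E[OF p] Mp by simp
      have h': "hom m (\<xi> \<oplus> k \<odot> E ?p) (\<lambda>x. G x + k * F ?p x)"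
        by (rule hom.add[OF Suc(3) hom.scale[OF hE']])
      have F1: "F ?p y * of_real l ^ m = 1" "\<And>z. z \<in> I \<Longrightarrow> z \<noteq> y \<Longrightarrow> F ?p z = 0"
        using E[OF p] Mp by auto
      have "G y + k * F ?p y = G y * (1 - F ?p y * of_real l ^ m)"
        by (simp add: k_def algebra_simps)
      then have Gy: "G y + k * F ?p y = 0" using F1(1) by simp
      have "{x \<in> I. G x + k * F ?p x \<noteq> 0 \<and> orb m x \<in> I} = {x \<in> I. G x \<noteq> 0 \<and> orb m x \<in> I} - {y}"
      proof (rule Set.set_eqI)
        fix x
        show "x \<in> {x \<in> I. G x + k * F ?p x \<noteq> 0 \<and> orb m x \<in> I}
          \<longleftrightarrow> x \<in> {x \<in> I. G x \<noteq> 0 \<and> orb m x \<in> I} - {y}"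
          by (cases "x = y"; cases "x \<in> I") (simp_all add: Gy F1(2))
      qed
      then have "n = card {x \<in> I. G x + k * F ?p x \<noteq> 0 \<and> orb m x \<in> I}"
        using Suc(2) y fin by simp
      then have "h (\<xi> \<oplus> k \<odot> E ?p) = 0" using Suc(1)[OF _ h'] by blast
      then show ?case using hadd[of \<xi> "k \<odot> E ?p"] hsm[of "E ?p" k] hE[OF p] EA[OF p] Suc(3) by simp
    qed
    obtain K where K: "K \<ge> 0" "\<And>x. x \<in> Aplus \<Longrightarrow> nrm B (D x) \<le> K * nrm B x" using D_bounded by blast
    have "h a = 0"
    proof (rule functional_eq_zero[OF a(1) hadd _ hhom])
      fix x assume x: "x \<in> Aplus"
      have E0: "2 / (1 - l) \<ge> 0" using l by simp
      have "cmod (h x) \<le> cmod (ent l w v (D x)) + cmod (\<Sum>p\<in>R. ent l (fst p) (snd p) x * ent l w v (D (E p)))"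
        unfolding h_def by (rule norm_triangle_ineq4)
      also have "cmod (ent l w v (D x)) \<le> 2 / (1 - l) * (K * nrm B x)"
        using ent_bound[OF l, of "D x"] K(2)[OF x] x E0 by (meson D_closed mult_left_mono order_trans)
      also have "cmod (\<Sum>p\<in>R. ent l (fst p) (snd p) x * ent l w v (D (E p)))
          \<le> (\<Sum>p\<in>R. 2 / (1 - l) * nrm B x * cmod (ent l w v (D (E p))))"
        by (rule sum_norm_le, unfold norm_mult, intro mult_right_mono ent_bound[OF l x] norm_ge_zero)
      finally have *: "cmod (h x) \<le> 2 / (1 - l) * (K * nrm B x) + (\<Sum>p\<in>R. 2 / (1 - l) * nrm B x * cmod (ent l w v (D (E p))))"
        by simp
      have "(c * K + (\<Sum>p\<in>R. c * f p)) * r = c * (K * r) + (\<Sum>p\<in>R. c * r * f p)" for c r :: real and f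
        by (simp only: distrib_right sum_distrib_right) (simp only: mult_ac)
      then show "cmod (h x) \<le> (2 / (1 - l) * K + (\<Sum>p\<in>R. 2 / (1 - l) * cmod (ent l w v (D (E p))))) * nrm B x"
        using * by (simp only:)
    qed
    moreover have "(\<Sum>p\<in>R. ent l (fst p) (snd p) a * ent l w v (D (E p))) = 0"
      using a(2) by (intro sum.neutral) (auto simp: mrep_eq_0_iff[OF adm] R_def)
    ultimately show ?thesis by (simp add: h_def)
  qed
  then show ?thesis by (simp add: mrep_eq_0_iff[OF adm])
qed

end

end

end

section \<open>Approximately local derivations\<close>

context partial_homeo_toeplitz
begin

context
  fixes I :: "'o set" and l :: real and \<delta> :: "'b \<Rightarrow> 'b"
  assumes adm: "admissible I l"
    and inv: "\<And>D a. derivation TA D \<Longrightarrow> a \<in> Aplus \<Longrightarrow> mrep I l a = 0 \<Longrightarrow> mrep I l (D a) = 0"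
    and \<delta>: "approximately_local_derivation TA \<delta>"
begin

lemma \<delta>_lin: "bounded_linear_map TA TA \<delta>"
  using \<delta> by (simp add: approximately_local_derivation_def)

lemmas \<delta>_closed [simp] = bounded_linear_map_TA(1)[OF \<delta>_lin]
lemmas \<delta>_add = bounded_linear_map_TA(2)[OF \<delta>_lin]
lemmas \<delta>_smult = bounded_linear_map_TA(3)[OF \<delta>_lin]
lemmas \<delta>_minus = bounded_linear_map_TA(4)[OF \<delta>_lin]

lemma \<delta>_approx:
  assumes x: "x \<in> Aplus"
  shows "\<exists>D :: nat \<Rightarrow> 'b \<Rightarrow> 'b. (\<forall>k. derivation TA (D k)) \<and> (\<lambda>k. nrm B (D k x \<ominus> \<delta> x)) \<longlonglongrightarrow> 0"
proof -
  obtain D :: "nat \<Rightarrow> 'b \<Rightarrow> 'b" where D: "\<And>k. derivation TA (D k)" "(\<lambda>k. nrm TA (D k x \<ominus>\<^bsub>TA\<^esub> \<delta> x)) \<longlonglongrightarrow> 0"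
    using \<delta> x by (auto simp: approximately_local_derivation_def)
  have "nrm TA (D k x \<ominus>\<^bsub>TA\<^esub> \<delta> x) = nrm B (D k x \<ominus> \<delta> x)" for k
    using D_closed[OF D(1)] x by (simp add: TA_minus)
  then show ?thesis using D by auto
qed

lemma \<delta>_kernel:
  assumes x: "x \<in> Aplus" "mrep I l x = 0"
  shows "mrep I l (\<delta> x) = 0"
proof -
  obtain D where D: "\<And>k::nat. derivation TA (D k)" "(\<lambda>k. nrm B (D k x \<ominus> \<delta> x)) \<longlonglongrightarrow> 0"
    using \<delta>_approx[OF x(1)] by blast
  show ?thesis
    by (rule tendsto_mrep_zero[OF adm, of "\<lambda>k. D k x"])
      (use D inv D_closed[OF D(1)] x in auto)
qed

text \<open>For a derivation D the element D(b c) is in the kernel by invariance, so a D(b) c agrees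
  modulo the kernel with - a b D(c), which lies in it. The kernel is closed, so this survives the
  limit.\<close>

lemma \<delta>_zero_product:
  assumes abc: "a \<in> Aplus" "b \<in> Aplus" "c \<in> Aplus"
    and zero: "mrep I l a * mrep I l b = 0" "mrep I l b * mrep I l c = 0"
  shows "mrep I l a * mrep I l (\<delta> b) * mrep I l c = 0"
proof -
  obtain D where D: "\<And>k::nat. derivation TA (D k)" "(\<lambda>k. nrm B (D k b \<ominus> \<delta> b)) \<longlonglongrightarrow> 0"
    using \<delta>_approx[OF abc(2)] by blast
  have Dc: "D k x \<in> Aplus" if "x \<in> Aplus" for k x using D_closed[OF D(1)] that .
  have "mrep I l (a \<otimes> D k b \<otimes> c) = 0" for k
  proof -
    have "mrep I l (b \<otimes> c) = 0" using abc zero by (simp add: mrep_mult[OF adm])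
    then have "mrep I l (D k (b \<otimes> c)) = 0" using inv[OF D(1)] abc by blast
    then have "mrep I l (D k b) * mrep I l c = - (mrep I l b * mrep I l (D k c))"
      using abc Dc by (simp add: D_mult[OF D(1)] mrep_add[OF adm] mrep_mult[OF adm] eq_neg_iff_add_eq_0)
    then have "mrep I l (a \<otimes> D k b \<otimes> c) = - (mrep I l a * mrep I l b * mrep I l (D k c))"
      using abc Dc by (simp add: mrep_mult[OF adm] mult.assoc)
    then show ?thesis using zero by simp
  qed
  note zk = this
  have lim: "(\<lambda>k. nrm B (a \<otimes> D k b \<otimes> c \<ominus> a \<otimes> \<delta> b \<otimes> c)) \<longlonglongrightarrow> 0"
    using abc Dc D(2) by (intro tendsto_mult) (auto simp: dist_self)
  have "mrep I l (a \<otimes> \<delta> b \<otimes> c) = 0"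
    by (rule tendsto_mrep_zero[OF adm _ zk _ lim]) (use abc Dc in auto)
  then show ?thesis using abc by (simp add: mrep_mult[OF adm])
qed

lemma mem_dm_0: "y \<in> I \<Longrightarrow> y \<in> dm 0"
  using adm_supp[OF adm] supp_topspace by simp

text \<open>The tensor algebra may lack a unit, but over finitely many points a sum of bumps of
  degree 0 acts as one.\<close>

lemma ex_unit: "\<exists>u\<in>Aplus. mrep I l u = (\<Sum>y\<in>I. munit y y)"
proof -
  have "\<exists>u\<in>Aplus. mrep I l u = (\<Sum>y\<in>J. munit y y)" if "finite J" "J \<subseteq> I" for J
    using that
  proof (induction J)
    case empty
    have "mrep I l (0 \<odot> \<zero>) = scal 0 * mrep I l \<zero>" by (rule mrep_smult[OF adm]) simp
    then show ?case by (intro bexI[of _ \<zero>]) auto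
  next
    case (insert y J)
    then obtain u where u: "u \<in> Aplus" "mrep I l u = (\<Sum>y\<in>J. munit y y)" by auto
    have y: "y \<in> I" using insert by simp
    obtain e F where e: "hom 0 e F" "mrep I l e = munit y y"
      using ex_mrep_munit[OF adm y mem_dm_0[OF y]] y by auto
    show ?case
      using u e insert(1,2) by (intro bexI[of _ "e \<oplus> u"]) (simp_all add: mrep_add[OF adm])
  qed
  then show ?thesis using adm_finite[OF adm] by blast
qed

lemma sum_munit_mult: "(\<Sum>y\<in>I. munit y y) * matr I m = matr I m" "matr I m * (\<Sum>y\<in>I. munit y y) = matr I m"
proof -
  note fin = adm_finite[OF adm]
  have 1: "(\<Sum>y\<in>I. munit y y) = matr I (\<lambda>z y. if z = y then 1 else 0)"
  proof -
    have "(\<Sum>y\<in>I. scal (if z = y then 1 else 0) * munit z y) = munit z z" if "z \<in> I" for z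
    proof -
      have "(\<Sum>y\<in>I. scal (if z = y then 1 else 0) * munit z y) = (\<Sum>y\<in>I. if y = z then munit z z else 0)"
        by (rule sum.cong) auto
      then show ?thesis using fin that by simp
    qed
    then show ?thesis by (simp add: matr_def)
  qed
  show "(\<Sum>y\<in>I. munit y y) * matr I m = matr I m" "matr I m * (\<Sum>y\<in>I. munit y y) = matr I m"
    unfolding 1 matr_mult[OF fin]
    by (rule matr_eqI; use fin in \<open>simp add: if_distrib[of "\<lambda>x. x * _"] if_distrib[of "\<lambda>x. _ * x"] cong: if_cong\<close>)+
qed

text \<open>\<open>\<delta>\<close> induces a map on the image, to which the identity for zero
  products is applied with the unit as middle factor; it remains to see that the unit is sent to
  0.\<close>

lemma \<delta>_derivation_mod_kernel:
  assumes ab: "a \<in> Aplus" "b \<in> Aplus"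
  shows "mrep I l (\<delta> (a \<otimes> b) \<ominus> (\<delta> a \<otimes> b \<oplus> a \<otimes> \<delta> b)) = 0"
proof -
  note fin = adm_finite[OF adm]
  define S where "S = mrep I l ` Aplus"
  \<comment> \<open>The choice of the preimage does not matter, by
    \<open>\<delta>_kernel\<close>.\<close>
  define \<Delta> where "\<Delta> T = mrep I l (\<delta> (SOME a. a \<in> Aplus \<and> mrep I l a = T))" for T
  have \<Delta>: "\<Delta> (mrep I l a) = mrep I l (\<delta> a)" if a: "a \<in> Aplus" for a
  proof -
    define c where "c = (SOME c. c \<in> Aplus \<and> mrep I l c = mrep I l a)"
    have c: "c \<in> Aplus \<and> mrep I l c = mrep I l a"
      unfolding c_def by (rule someI[of _ a]) (use a in simp)
    then have "mrep I l (\<delta> (c \<ominus> a)) = 0" using a by (intro \<delta>_kernel) (simp_all add: mrep_minus[OF adm])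
    then show ?thesis using a c by (simp add: \<Delta>_def c_def[symmetric] \<delta>_minus mrep_minus[OF adm])
  qed
  obtain u where u: "u \<in> Aplus" "mrep I l u = (\<Sum>y\<in>I. munit y y)" using ex_unit by blast
  have unit: "mrep I l u * mrep I l a = mrep I l a" "mrep I l a * mrep I l u = mrep I l a" for a
    unfolding u(2) unfolding mrep_def by (rule sum_munit_mult)+
  define R where "R = {(z, y). z \<in> I \<and> y \<in> I \<and> (\<exists>m. y \<in> dm m \<and> orb m y = z)}"
  have RI: "R \<subseteq> I \<times> I" by (auto simp: R_def)
  then have finR: "finite R" using fin finite_subset by blast
  have RS: "munit z y \<in> S" if zyR: "(z, y) \<in> R" for z y
  proof -
    obtain m where m: "y \<in> I" "y \<in> dm m" "orb m y = z" "z \<in> I" using zyR by (auto simp: R_def)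
    then obtain \<xi> F where "hom m \<xi> F" "mrep I l \<xi> = munit z y" using ex_mrep_munit[OF adm m(1,2)] by auto
    then show ?thesis unfolding S_def by (metis hom_Aplus imageI)
  qed
  have yyS: "munit y y \<in> S" if "y \<in> I" for y
    by (rule RS) (use that mem_dm_0 in \<open>auto simp: R_def intro!: exI[of _ 0]\<close>)
  have addS: "T + T' \<in> S" if T: "T \<in> S" "T' \<in> S" for T T'
    using T unfolding S_def by (auto simp: mrep_add[OF adm, symmetric])
  define P where "P = (\<lambda>(z, y). munit z y) ` R"
  have "\<Delta> (mrep I l a * mrep I l u * mrep I l b)
     = \<Delta> (mrep I l a * mrep I l u) * mrep I l b + mrep I l a * \<Delta> (mrep I l u * mrep I l b)
       - mrep I l a * \<Delta> (mrep I l u) * mrep I l b"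
  proof (rule span_idempotents_zero_product[where S = S and u = "mrep I l u" and P = P])
    fix x y z assume "x \<in> S" "y \<in> S" "z \<in> S" "x * y = 0" "y * z = 0"
    then show "x * \<Delta> y * z = 0" using \<delta>_zero_product by (auto simp: S_def \<Delta>)
  next
    fix x y assume "x \<in> S" "y \<in> S"
    then show "x + y \<in> S \<and> \<Delta> (x + y) = \<Delta> x + \<Delta> y" "x * y \<in> S"
      by (auto simp: S_def \<Delta> \<delta>_add mrep_add[OF adm, symmetric] mrep_mult[OF adm, symmetric])
  next
    fix c x assume "x \<in> S"
    then show "scal c * x \<in> S \<and> \<Delta> (scal c * x) = scal c * \<Delta> x"
      by (auto simp: S_def \<Delta> \<delta>_smult mrep_smult[OF adm, symmetric])
  next
    fix x assume "x \<in> S"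
    then show "mrep I l u * x = x \<and> x * mrep I l u = x" "mrep I l u * \<Delta> x = \<Delta> x \<and> \<Delta> x * mrep I l u = \<Delta> x"
      by (auto simp: S_def \<Delta> unit)
  next
    show "P \<subseteq> S" using RS by (auto simp: P_def)
  next
    fix e assume "e \<in> P"
    then obtain z y where zy: "e = munit z y" "(z, y) \<in> R" by (auto simp: P_def)
    have y: "munit y y \<in> S" using zy yyS by (auto simp: R_def)
    show "\<exists>f\<in>S. \<exists>g\<in>S. f * f = f \<and> g * g = g \<and> e = f - g"
    proof (cases "z = y")
      case True
      have "mrep I l (0 \<odot> u) = scal 0 * mrep I l u" by (rule mrep_smult[OF adm u(1)])
      then have "(0 :: 'o cend) \<in> S" unfolding S_def using u(1) by (metis Aplus_ops(4) imageI mult_zero_left scal_simps(2))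
      then show ?thesis using True y zy by (intro bexI[of _ "munit y y"] bexI[of _ 0]) (auto simp: munit_mult)
    next
      case False
      \<comment> \<open>An off-diagonal matrix unit squares to zero; adding the diagonal unit of its
        column turns it into an idempotent.\<close>
      then show ?thesis using y zy addS[OF y RS[OF zy(2)]]
        by (intro bexI[of _ "munit y y + munit z y"] bexI[of _ "munit y y"])
          (auto simp: munit_mult distrib_left distrib_right)
    qed
  next
    fix T assume "T \<in> S"
    then obtain x where x: "x \<in> Aplus" "T = mrep I l x" by (auto simp: S_def)
    have "T = (\<Sum>p\<in>I \<times> I. scal (ent l (fst p) (snd p) x) * munit (fst p) (snd p))"
      by (simp add: x(2) mrep_def matr_def sum.cartesian_product case_prod_beta)
    also have "\<dots> = (\<Sum>p\<in>R. scal (ent l (fst p) (snd p) x) * munit (fst p) (snd p))"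
    proof (rule sum.mono_neutral_right)
      show "\<forall>p\<in>I \<times> I - R. scal (ent l (fst p) (snd p) x) * munit (fst p) (snd p) = 0"
      proof
        fix p assume p: "p \<in> I \<times> I - R"
        have "ent l (fst p) (snd p) x = 0"
          by (rule ent_eq_zero_of_unreachable[OF adm x(1)]) (use p in \<open>auto simp: R_def\<close>)
        then show "scal (ent l (fst p) (snd p) x) * munit (fst p) (snd p) = 0" by simp
      qed
    qed (use fin RI in auto)
    finally show "\<exists>J::('o \<times> 'o) set. \<exists>c g. finite J \<and> g ` J \<subseteq> P \<and> T = (\<Sum>i\<in>J. scal (c i) * g i)"
      using finR by (intro exI[of _ R] exI[of _ "\<lambda>p. ent l (fst p) (snd p) x"] exI[of _ "\<lambda>p. munit (fst p) (snd p)"])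
        (auto simp: P_def)
  qed (use ab u(1) in \<open>auto simp: S_def\<close>)
  then have main: "mrep I l (\<delta> (a \<otimes> b)) = mrep I l (\<delta> a) * mrep I l b + mrep I l a * mrep I l (\<delta> b)
       - mrep I l a * mrep I l (\<delta> u) * mrep I l b"
    by (simp only: unit mrep_mult[OF adm ab, symmetric] \<Delta> ab u(1) Aplus_ops)
  have "mrep I l (\<delta> u) = 0"
  proof -
    obtain D where D: "\<And>k::nat. derivation TA (D k)" "(\<lambda>k. nrm B (D k u \<ominus> \<delta> u)) \<longlonglongrightarrow> 0"
      using \<delta>_approx[OF u(1)] by blast
    have Du: "D k u \<in> Aplus" for k using D_closed[OF D(1)] u by blast
    have "mrep I l (D k u) = 0" for k
    proof -
      \<comment> \<open>Modulo the kernel \<open>u\<close> is a unit, so D(u u - u) has the same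
        image as 2 D(u) - D(u), and invariance makes this image zero.\<close>
      have "mrep I l (u \<otimes> u \<ominus> u) = 0" using u(1) by (simp add: mrep_minus[OF adm] mrep_mult[OF adm] unit)
      then have "mrep I l (D k (u \<otimes> u \<ominus> u)) = 0" using inv[OF D(1)] u(1) by blast
      then show ?thesis using u(1) Du
        by (simp add: D_minus[OF D(1)] D_mult[OF D(1)] mrep_minus[OF adm] mrep_mult[OF adm] mrep_add[OF adm] unit)
    qed
    then show ?thesis using tendsto_mrep_zero[OF adm, of "\<lambda>k. D k u"] D(2) Du u(1) by simp
  qed
  then show ?thesis
    using main ab by (simp add: mrep_minus[OF adm] mrep_add[OF adm] mrep_mult[OF adm])
qed

end

text \<open>Injectivity of \<open>\<sigma>\<close> on \<open>U\<close> cancels the common steps.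
  Hence an orbit that meets itself returns to its starting point, and there are no preperiodic
  points besides the periodic ones.\<close>

lemma funpow_\<sigma>_cancel:
  assumes "y \<in> dm i" "y \<in> dm (i + j)" "orb (i + j) y = orb i y"
  shows "orb j y = y"
  using assms
proof (induction i)
  case (Suc i)
  then have "orb i y \<in> U" "orb (i + j) y \<in> U" by (auto simp: dm_Suc)
  moreover have "\<sigma> (orb (i + j) y) = \<sigma> (orb i y)" using Suc.prems(3) by simp
  ultimately have "orb (i + j) y = orb i y" using \<sigma>_inj by (auto dest: inj_onD)
  then show ?case using Suc dm_Suc by simp
qed simp

text \<open>On the cycle \<open>I\<close> every point is reached from every other. The entry from
  \<open>y\<close> to \<open>orb n y\<close> adds up the coefficients of all degrees leading there;
  as it vanishes for every weight, \<open>power_series_zero\<close> separates them. The assumption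
  \<open>zero\<close> places \<open>a\<close> in each kernel that all derivations preserve.\<close>

lemma coef_eq_zero_periodic:
  assumes y: "y \<in> supp" and p: "p > 0" "y \<in> dm p" "orb p y = y"
    and a: "a \<in> Aplus"
    and zero: "\<And>I l. admissible I l \<Longrightarrow>
      (\<And>D a. derivation TA D \<Longrightarrow> a \<in> Aplus \<Longrightarrow> mrep I l a = 0 \<Longrightarrow> mrep I l (D a) = 0) \<Longrightarrow> mrep I l a = 0"
  shows "coef n y a = 0"
proof -
  define I where "I = (\<lambda>i. orb i y) ` {..<p}"
  have iter: "y \<in> dm (k * p) \<and> orb (k * p) y = y" for k
    by (induction k) (use p supp_topspace[OF y] in \<open>auto simp: dm_add add.commute[of p] funpow_add\<close>)
  have ydm: "y \<in> dm i" for i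
  proof -
    have "i \<le> i * p" using p(1) by simp
    then show ?thesis using iter[of i] dm_mono by blast
  qed
  have inI: "orb i y \<in> I" for i
  proof -
    have "orb i y = (\<sigma> ^^ (i mod p + (i div p) * p)) y" by simp
    also have "\<dots> = orb (i mod p) y" using iter[of "i div p"] by (simp only: funpow_add o_apply)
    finally show ?thesis using p(1) by (auto simp: I_def)
  qed
  have adm: "admissible I l" if "0 < l" "l < 1" for l
    unfolding admissible_def
  proof (intro conjI ballI allI impI)
    show "I \<subseteq> supp" using supp_funpow[OF y ydm] by (auto simp: I_def)
    fix z m n assume "z \<in> I"
    then obtain i where "z = orb i y" by (auto simp: I_def)
    then show "orb n z \<in> I" using inI[of "n + i"] by (simp add: funpow_add)
  qed (use that in \<open>auto simp: I_def\<close>)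
  have full: "\<exists>m. w \<in> dm m \<and> orb m w = z" if zw: "z \<in> I" "w \<in> I" for z w
  proof -
    obtain i j where ij: "z = orb i y" "w = orb j y" "j < p" using zw by (auto simp: I_def)
    have "(\<sigma> ^^ (i + (p - j))) w = orb (i + p) y"
      using ij(3) unfolding ij(2) by (simp add: funpow_add[symmetric, THEN fun_cong, unfolded o_apply])
    also have "\<dots> = z" using p(3) by (simp add: ij(1) funpow_add)
    finally have "(\<sigma> ^^ (i + (p - j))) w = z" .
    moreover have "w \<in> dm (i + (p - j))" using ydm[of "i + (p - j) + j"] by (simp only: dm_add ij(2))
    ultimately show ?thesis by blast
  qed
  define z where "z = orb n y"
  have "ent l z y a = 0" if l: "0 < l" "l < 1" for l
  proof -
    have "mrep I l a = 0"
      by (rule zero[OF adm[OF l]]) (use kernel_invariant_of_full[OF _ adm[OF l] full] in blast)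
    then show ?thesis using inI[of n] inI[of 0] mrep_eq_0_iff[OF adm[OF l]] by (simp add: z_def)
  qed
  then have "(if orb n y = z then coef n y a else 0) = 0"
    by (intro power_series_zero[of "\<lambda>m. if orb m y = z then coef m y a else 0" "2 * nrm B a"])
      (use coef_bound[OF a] nrm_nonneg a in \<open>auto simp: ent_def\<close>)
  then show ?thesis by (simp add: z_def)
qed

text \<open>The segment from \<open>y\<close> to \<open>orb n y\<close> is convex along the orbit
  because its points are distinct. Only degree \<open>n\<close> leads from \<open>y\<close> to the
  end point, so a single weight is enough.\<close>

lemma coef_eq_zero_aperiodic:
  assumes y: "y \<in> supp" "y \<in> dm n" and free: "\<And>p. p > 0 \<Longrightarrow> y \<in> dm p \<Longrightarrow> orb p y \<noteq> y"
    and a: "a \<in> Aplus"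
    and zero: "\<And>I l. admissible I l \<Longrightarrow>
      (\<And>D a. derivation TA D \<Longrightarrow> a \<in> Aplus \<Longrightarrow> mrep I l a = 0 \<Longrightarrow> mrep I l (D a) = 0) \<Longrightarrow> mrep I l a = 0"
  shows "coef n y a = 0"
proof -
  have inj_le: "i = j" if ij: "i \<le> j" "y \<in> dm i" "y \<in> dm j" "orb i y = orb j y" for i j
  proof (rule ccontr)
    assume "i \<noteq> j"
    then have j: "j - i > 0" "y \<in> dm (j - i)" using ij dm_mono[of "j - i" j] by auto
    have "orb (j - i) y = y" by (rule funpow_\<sigma>_cancel[of y i]) (use ij in auto)
    then show False using free[OF j] by simp
  qed
  have inj: "i = j" if "y \<in> dm i" "y \<in> dm j" "orb i y = orb j y" for i j
    using inj_le[of i j] inj_le[of j i] that by (metis linorder_le_cases)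
  define I where "I = (\<lambda>i. orb i y) ` {..n}"
  let ?l = "1/2 :: real"
  have dmi: "y \<in> dm i" if "i \<le> n" for i using dm_mono[OF that] y(2) by blast
  have adm: "admissible I ?l"
    unfolding admissible_def
  proof (intro conjI ballI allI impI)
    show "I \<subseteq> supp" using supp_funpow[OF y(1)] dmi by (auto simp: I_def)
    fix z m k assume z: "z \<in> I" "z \<in> dm (m + k)" "orb (m + k) z \<in> I"
    obtain i where i: "z = orb i y" "i \<le> n" using z by (auto simp: I_def)
    obtain j where j: "orb (m + k) z = orb j y" "j \<le> n" using z by (auto simp: I_def)
    have "y \<in> dm ((m + k) + i)" using z(2) dmi[OF i(2)] i(1) by (simp only: dm_add)
    moreover have "(\<sigma> ^^ ((m + k) + i)) y = orb j y" using j(1) i(1) by (simp only: funpow_add o_apply)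
    ultimately have "(m + k) + i = j" using inj dmi[OF j(2)] by blast
    then have "k + i \<le> n" using j(2) by simp
    moreover have "orb k z = orb (k + i) y" using i(1) by (simp only: funpow_add o_apply)
    ultimately show "orb k z \<in> I" unfolding I_def by blast
  qed (auto simp: I_def)
  have unique: "m = m'" if w: "w \<in> I" "w \<in> dm m" "w \<in> dm m'" "orb m w = orb m' w" for w m m'
  proof -
    obtain i where i: "w = orb i y" "i \<le> n" using w by (auto simp: I_def)
    have "y \<in> dm (m + i)" "y \<in> dm (m' + i)" using w dmi[OF i(2)] i(1) by (simp_all only: dm_add)
    moreover have "orb (m + i) y = orb (m' + i) y" using w(4) i(1) by (simp only: funpow_add o_apply)
    ultimately have "m + i = m' + i" using inj by blast
    then show ?thesis by simp
  qed
  have "mrep I ?l a = 0"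
  proof (rule zero[OF adm])
    fix D c assume D: "derivation TA D" and c: "c \<in> Aplus" "mrep I ?l c = 0"
    show "mrep I ?l (D c) = 0"
      by (rule kernel_invariant_of_free[OF D adm _ c]) (rule unique)
  qed
  moreover have "orb n y \<in> I" by (simp add: I_def)
  moreover have "y \<in> I" unfolding I_def by (rule image_eqI[of _ _ 0]) auto
  ultimately have 0: "ent ?l (orb n y) y a = 0" by (simp add: mrep_eq_0_iff[OF adm])
  have "ent ?l (orb n y) y a = (\<Sum>k. if k = n then coef n y a * of_real ?l ^ n else 0)"
    unfolding ent_def
  proof (rule suminf_cong)
    fix k
    show "(if orb k y = orb n y then coef k y a else 0) * of_real ?l ^ k
       = (if k = n then coef n y a * of_real ?l ^ n else 0)"
      using inj[of k n] y(2) coef_eq_zero_outside_dm[OF a, of y k] by (cases "y \<in> dm k") auto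
  qed
  also have "\<dots> = (\<Sum>k\<in>{n}. if k = n then coef n y a * of_real ?l ^ n else 0)"
    by (rule suminf_finite) auto
  finally show ?thesis using 0 by simp
qed

theorem approximately_local_derivation_is_derivation:
  assumes \<delta>: "approximately_local_derivation TA \<delta>"
  shows "derivation TA \<delta>"
  unfolding derivation_TA
proof (intro conjI ballI)
  have lin: "bounded_linear_map TA TA \<delta>" using \<delta> by (simp add: approximately_local_derivation_def)
  then show "bounded_linear_map TA TA \<delta>" .
  fix a b assume ab: "a \<in> Aplus" "b \<in> Aplus"
  note cl = bounded_linear_map_TA(1)[OF lin]
  define x where "x = \<delta> (a \<otimes> b) \<ominus> (\<delta> a \<otimes> b \<oplus> a \<otimes> \<delta> b)"
  have x: "x \<in> Aplus" using ab cl by (auto simp: x_def)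
  have zero: "mrep I l x = 0" if adm: "admissible I l" and
    inv: "\<And>D a. derivation TA D \<Longrightarrow> a \<in> Aplus \<Longrightarrow> mrep I l a = 0 \<Longrightarrow> mrep I l (D a) = 0" for I l
    unfolding x_def by (rule \<delta>_derivation_mod_kernel[OF adm _ \<delta> ab]) (rule inv)
  have "coef n y x = 0" if y: "y \<in> supp" for n y
  proof (cases "y \<in> dm n")
    case False
    then show ?thesis by (rule coef_eq_zero_outside_dm[OF x])
  next
    case True
    show ?thesis
    proof (cases "\<exists>p>0. y \<in> dm p \<and> orb p y = y")
      case True
      then show ?thesis using coef_eq_zero_periodic[OF y _ _ _ x zero] by blast
    next
      case False
      then show ?thesis using coef_eq_zero_aperiodic[OF y True _ x zero] by blast
    qed
  qed
  then have "x = \<zero>" by (rule eq_zero_if_coef_zero[OF x])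
  then have "nrm B (\<delta> (a \<otimes> b) \<ominus> (\<delta> a \<otimes> b \<oplus> a \<otimes> \<delta> b)) = 0" by (simp add: x_def)
  then show "\<delta> (a \<otimes> b) = \<delta> a \<otimes> b \<oplus> a \<otimes> \<delta> b" using ab cl by (intro eq_of_nrm_minus) auto
qed

end

theorem corollary4p10:
  fixes \<Omega> :: "'o topology" and U V :: "'o set" and \<sigma> :: "'o \<Rightarrow> 'o"
    and B :: "'b star_alg"
    and \<pi> :: "('o \<Rightarrow> complex) \<Rightarrow> 'b" and t :: "('o \<Rightarrow> complex) \<Rightarrow> 'b"
    and \<delta> :: "'b \<Rightarrow> 'b"
  assumes "locally_compact_space \<Omega>" and "Hausdorff_space \<Omega>"
    and "openin \<Omega> U" and "openin \<Omega> V"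
    and "homeomorphic_map (subtopology \<Omega> U) (subtopology \<Omega> V) \<sigma>"
    and "universal_toeplitz_representation (C0_alg \<Omega>) (partial_homeo_corr \<Omega> U \<sigma>) B \<pi> t"
    and "approximately_local_derivation
           (tensor_algebra (C0_alg \<Omega>) (partial_homeo_corr \<Omega> U \<sigma>) B \<pi> t) \<delta>"
  shows "derivation (tensor_algebra (C0_alg \<Omega>) (partial_homeo_corr \<Omega> U \<sigma>) B \<pi> t) \<delta>"
proof -
  interpret cstar_algebra B
    using assms(6) by (simp add: universal_toeplitz_representation_def)
  interpret partial_homeo_toeplitz \<Omega> U V \<sigma> B \<pi> t
    by unfold_locales (use assms in auto)
  show ?thesis
    using approximately_local_derivation_is_derivation assms(7) unfolding TA_def .
qed

end
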